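(* Let $(\mathcal H,\sqcup\!\sqcup_0)$ be the commutative associative $\mathbb Q$-algebra described in the context. Define the $\mathbb Q$-linear map $\zeta^{\rm des}_{\sqcup\!\sqcup}:\mathcal H\to\mathbb R$ by $\zeta^{\rm des}_{\sqcup\!\sqcup}(1):=1$ and $$\zeta^{\rm des}_{\sqcup\!\sqcup}(j^{k_r}y\cdots j^{k_1}y):=\lim_{t\to 1-0}{\rm Li}^{\rm des}(k_1,\dots,k_r)(t)$$ for $r\ge 1$ and $k_1,\dots,k_r\in\mathbb Z$. Then $\zeta^{\rm des}_{\sqcup\!\sqcup}$ is a $\mathbb Q$-algebra homomorphism from $(\mathcal H,\sqcup\!\sqcup_0)$ to $\mathbb R$; i.e., the special values $\zeta_r^{\rm des}(k_1,\dots,k_r)=\lim_{t\to1-0}{\rm Li}^{\rm des}(k_1,\dots,k_r)(t)$ of desingularized multiple zeta functions at arbitrary integer points multiply according to the product $\sqcup\!\sqcup_0$: the $\mathbb Q$-linear map $\mathcal H\to\mathbb R$ with $1\mapsto 1$ and $j^{k_r}y\cdots j^{k_1}y\mapsto \zeta^{\rm des}_r(k_1,\dots,k_r)$ is a $\mathbb Q$-algebra homomorphism.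
   Context: **The algebra $\mathcal H$.** Let $\mathbb Q\langle d,j,y\rangle$ be the non-commutative polynomial ring in letters $d,j,y$ with the relations $dj=jd=1$ (so $j^{-k}$ means $d^k$ for $k\in\mathbb N$). Define a $\mathbb Q$-bilinear product $\sqcup\!\sqcup_0$ on it by $w\sqcup\!\sqcup_0 1=1\sqcup\!\sqcup_0 w=w$ and, recursively for words $u,v$, $$yu\sqcup\!\sqcup_0 v:=u\sqcup\!\sqcup_0 yv:=y(u\sqcup\!\sqcup_0 v),\quad ju\sqcup\!\sqcup_0 jv:=j(u\sqcup\!\sqcup_0 jv)+j(ju\sqcup\!\sqcup_0 v),\quad du\sqcup\!\sqcup_0 dv:=d(u\sqcup\!\sqcup_0 dv)-u\sqcup\!\sqcup_0 d^2v,$$ $$du\sqcup\!\sqcup_0 jv:=d(u\sqcup\!\sqcup_0 jv)-u\sqcup\!\sqcup_0 v,\quad ju\sqcup\!\sqcup_0 dv:=d(ju\sqcup\!\sqcup_0 v)-u\sqcup\!\sqcup_0 v.$$ Let $\mathcal T$ be the $\mathbb Q$-linear span of $\{j^{k_1}y\cdots j^{k_{r-1}}yj^{k_r} : r\in\mathbb N,\ k_1,\dots,k_r\in\mathbb Z,\ k_r\ne0\}$ and let $\mathcal L$ be the two-sided ideal of $(\mathbb Q\langle d,j,y\rangle,\sqcup\!\sqcup_0)$ generated by $\{j^k(d(u\sqcup\!\sqcup_0v)-du\sqcup\!\sqcup_0v-u\sqcup\!\sqcup_0dv) : k\in\mathbb Z,\ u,v \text{ words ending in } y\}$, where words ending in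 $y$ are those of the form $j^{k_1}y\cdots j^{k_r}y$, $r\in\mathbb N$, $k_i\in\mathbb Z$. $\mathcal T$ is a two-sided ideal, $\mathcal H:=\mathbb Q\langle d,j,y\rangle/(\mathcal T+\mathcal L)$, and $(\mathcal H,\sqcup\!\sqcup_0)$ is known to be a commutative associative $\mathbb Q$-algebra. **The functions ${\rm Li}^{\rm des}$.** Let $\mathcal P_{(0,1)}:=\{f(t)\in t\mathbb R[[t]] : f(t)\text{ converges for } t\in(0,1)\}$ and let $\mathcal A:=\mathcal P_{(0,1)}[\log t]$ be the set of finite sums $\sum_{j=0}^N f_j(t)(\log t)^j$ with $f_j\in\mathcal P_{(0,1)}$. The operators $J[f]:=\int_0^t f(z)\frac{dz}{z}$ and $D[f]:=t\frac{df}{dt}$ map $\mathcal A$ to $\mathcal A$ and are mutually inverse; write $J^{-k}=D^k$ for $k\ge0$. Put ${\rm Li}^{\rm des}(0)(t):=\frac{t}{1-t}+\frac{t\log t}{(1-t)^2}\in\mathcal A$ and, for $(k_1,\dots,k_r)\in\mathbb Z^r$, $${\rm Li}^{\rm des}(k_1,\dots,k_r)(t):=J^{k_r}\Bigl[{\rm Li}^{\rm des}(0)(t)\,J^{k_{r-1}}\bigl[{\rm Li}^{\rm des}(0)(t)\cdots J^{k_1}[{\rm Li}^{\rm des}(0)(t)]\cdots\bigr]\Bigr].$$ **Desingularized multiple zeta function.** For $s_1,\dots,s_r\in\mathbb C\setminus\mathbb Z$, $$\zeta^{\rm des}_r(s_1,\dots,s_r):=\lim_{c\to1,\,c\ne1}\frac{1}{(1-c)^r}\prod_{k=1}^r\frac{1}{(e^{2\pi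 i s_k}-1)\Gamma(s_k)}\int_{\mathcal C^r}\prod_{j=1}^r\left(\frac{1}{\exp(\sum_{k=j}^rt_k)-1}-\frac{c}{\exp(c\sum_{k=j}^rt_k)-1}\right)\prod_{k=1}^rt_k^{s_k-1}dt_k$$ ($c$ real), where $\mathcal C$ is the Hankel contour: the positive real axis (top side, coming from $+\infty$), a circle around the origin of sufficiently small radius $\epsilon$ (counterclockwise), and the positive real axis (bottom side, going to $+\infty$). It extends to an entire function on $\mathbb C^r$, and $\zeta^{\rm des}_r(k_1,\dots,k_r)$ at integer points denotes the value of this extension.
   Formalization: T is not an ideal (j ⊔ dy = dyj − y) and T+L would contain yy, whose value is 1/4; so L is generated inside the span of 1 and words ending in y, the product on H is computed with representatives from that span, and the rules are read on reduced words. *)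

theory Defs
  imports "HOL-Analysis.Analysis" "HOL-Library.Poly_Mapping"
begin

section \<open>The algebra with letters d, j, y and its quotient\<close>

text \<open>
  Words in d, j, y modulo dj = jd = 1, in normal form:
  \<open>JPow k\<close> is $j^k$ and \<open>JPowY k w\<close> is $j^k y w$, where $j^{-1} = d$.
  Concatenation is written additively, because \<open>Poly_Mapping\<close> builds the monoid algebra
  over a (not necessarily commutative) \<open>monoid_add\<close>; so \<open>0\<close> is the empty word and
  \<open>1 = single 0 1\<close>, \<open>*\<close> are the unit and the concatenation product of \<open>word \<Rightarrow>\<^sub>0 rat\<close>.
\<close>

datatype word = JPow int | JPowY int word

instantiation word :: monoid_add
begin

definition zero_word :: word where "zero_word = JPow 0"

fun plus_word :: "word \<Rightarrow> word \<Rightarrow> word" where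
  "plus_word (JPow a) (JPow b) = JPow (a + b)"
| "plus_word (JPow a) (JPowY b w) = JPowY (a + b) w"
| "plus_word (JPowY a v) w = JPowY a (plus_word v w)"

instance
proof
  fix a b c :: word
  show "a + b + c = a + (b + c)"
  proof (induction a)
    case (JPow k)
    show ?case by (cases b; cases c) auto
  qed auto
  show "0 + a = a" by (cases a) (auto simp: zero_word_def)
  show "a + 0 = a" by (induction a) (auto simp: zero_word_def)
qed

end

type_synonym qdjy = "word \<Rightarrow>\<^sub>0 rat"

datatype letter = D | J | Y

fun letter_word :: "letter \<Rightarrow> word" where
  "letter_word D = JPow (- 1)"
| "letter_word J = JPow 1"
| "letter_word Y = JPowY 0 (JPow 0)"

lemma JPow_0_add [simp]: "JPow 0 + w = w"
  by (metis add_0 zero_word_def)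

lemma d_j_cancel:
  "letter_word D + letter_word J = 0" "letter_word J + letter_word D = 0"
  by (simp_all add: zero_word_def)

text \<open>First letter of the reduced form of a word, and the word left after removing it.\<close>

fun first_letter :: "word \<Rightarrow> letter option" where
  "first_letter (JPow k) = (if k = 0 then None else if k > 0 then Some J else Some D)"
| "first_letter (JPowY k w) = (if k = 0 then Some Y else if k > 0 then Some J else Some D)"

fun rest :: "word \<Rightarrow> word" where
  "rest (JPow k) = JPow (k - sgn k)"
| "rest (JPowY k w) = (if k = 0 then w else JPowY (k - sgn k) w)"

fun word_length :: "word \<Rightarrow> nat" where
  "word_length (JPow k) = nat \<bar>k\<bar>"
| "word_length (JPowY k w) = nat \<bar>k\<bar> + 1 + word_length w"

lemma first_letter_None: "first_letter w = None \<longleftrightarrow> w = 0"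
  by (cases w) (auto simp: zero_word_def)

lemma first_letter_rest: "first_letter w = Some l \<Longrightarrow> w = letter_word l + rest w"
  by (cases w; cases l) (auto simp: sgn_if split: if_splits)

lemma word_length_rest: "first_letter w = Some l \<Longrightarrow> Suc (word_length (rest w)) = word_length w"
  by (cases w; cases l) (auto simp: sgn_if split: if_splits)

lemma word_length_D_rest:
  "first_letter w = Some D \<Longrightarrow> word_length (letter_word D + w) = Suc (word_length w)"
  by (cases w) (auto split: if_splits)

lemma word_length_pair:
  assumes "(x, y) = (first_letter u, first_letter v)"
  shows "x = Some l \<Longrightarrow> word_length u = Suc (word_length (rest u))"
    "y = Some m \<Longrightarrow> word_length v = Suc (word_length (rest v))"
    "y = Some m \<Longrightarrow> m = D \<Longrightarrow> word_length (letter_word D + v) = Suc (word_length v)"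
  using assms word_length_rest word_length_D_rest by (metis Pair_inject)+

definition mon :: "word \<Rightarrow> qdjy" where "mon w = Poly_Mapping.single w 1"

abbreviation letter_mon :: "letter \<Rightarrow> qdjy" where "letter_mon l \<equiv> mon (letter_word l)"

definition qscale :: "rat \<Rightarrow> qdjy \<Rightarrow> qdjy" where
  "qscale c a = Poly_Mapping.single 0 c * a"

text \<open>
  The product on words. In the recursion $u = l\,u'$ always denotes the reduced form, i.e. $l$ is the
  first letter of $u$ and $u'$ is \<open>rest u\<close>. On unreduced words the rules contradict each other: the product
  of d and y = j(dy) is d(y) - dy = 0 by the rule for $du', jv'$, but yd by the rule for y.
  If both words begin with y, the two rules for y agree, see \<open>sha_word_Y_left\<close> and \<open>sha_word_Y_right\<close>.
\<close>

function sha_word :: "word \<Rightarrow> word \<Rightarrow> qdjy" where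
  "sha_word u v =
    (case (first_letter u, first_letter v) of
       (None, _) \<Rightarrow> mon v
     | (_, None) \<Rightarrow> mon u
     | (Some Y, _) \<Rightarrow> letter_mon Y * sha_word (rest u) v
     | (_, Some Y) \<Rightarrow> letter_mon Y * sha_word u (rest v)
     | (Some J, Some J) \<Rightarrow> letter_mon J * sha_word (rest u) v + letter_mon J * sha_word u (rest v)
     | (Some D, Some D) \<Rightarrow> letter_mon D * sha_word (rest u) v - sha_word (rest u) (letter_word D + v)
     | (Some D, Some J) \<Rightarrow> letter_mon D * sha_word (rest u) v - sha_word (rest u) (rest v)
     | (Some J, Some D) \<Rightarrow> letter_mon D * sha_word u (rest v) - sha_word (rest u) (rest v))"
  by pat_completeness auto
termination
proof (relation "measures [\<lambda>(u, v). word_length u + word_length v, \<lambda>(u, v). word_length u]", goal_cases)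
  case 1
  show ?case by simp
qed ((frule (1) word_length_pair(1))?, (frule (1) word_length_pair(2))?, (frule (2) word_length_pair(3))?,
    simp del: letter_word.simps)+

declare sha_word.simps [simp del]

definition lin_ext :: "(word \<Rightarrow> qdjy) \<Rightarrow> qdjy \<Rightarrow> qdjy" where
  "lin_ext f a = (\<Sum>w\<in>Poly_Mapping.keys a. qscale (Poly_Mapping.lookup a w) (f w))"

definition sha0 :: "qdjy \<Rightarrow> qdjy \<Rightarrow> qdjy"  (infixl "\<squnion>\<squnion>" 70) where
  "a \<squnion>\<squnion> b = lin_ext (\<lambda>u. lin_ext (\<lambda>v. sha_word u v) b) a"

interpretation qdjy: vector_space qscale
  by standard (auto simp: qscale_def distrib_left distrib_right single_add mult_single mult.assoc [symmetric])

text \<open>\<open>yword [k\<^sub>1, \<dots>, k\<^sub>r]\<close> is $j^{k_1} y \cdots j^{k_r} y$.\<close>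

fun yword :: "int list \<Rightarrow> word" where
  "yword [] = 0"
| "yword (k # ks) = JPow k + letter_word Y + yword ks"

definition T_space :: "qdjy set" where
  "T_space = qdjy.span {mon (yword ks + JPow k) | ks k. k \<noteq> 0}"

text \<open>The span of 1 and the words ending in y. It is a vector space complement of \<open>T_space\<close>.\<close>

definition Y_space :: "qdjy set" where
  "Y_space = qdjy.span (range (\<lambda>ks. mon (yword ks)))"

text \<open>Two-sided ideals of a subalgebra \<open>C\<close> of the nonassociative algebra \<open>(qdjy, \<squnion>\<squnion>)\<close>.\<close>

definition sha_ideal :: "qdjy set \<Rightarrow> qdjy set \<Rightarrow> bool" where
  "sha_ideal C I \<longleftrightarrow> qdjy.subspace I \<and> (\<forall>a\<in>C. \<forall>x\<in>I. a \<squnion>\<squnion> x \<in> I \<and> x \<squnion>\<squnion> a \<in> I)"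

definition leibniz :: "word \<Rightarrow> word \<Rightarrow> qdjy" where
  "leibniz u v = letter_mon D * sha_word u v - sha_word (letter_word D + u) v
     - sha_word u (letter_word D + v)"

definition L_gens :: "qdjy set" where
  "L_gens = {mon (JPow k) * leibniz (yword us) (yword vs) | k us vs. us \<noteq> [] \<and> vs \<noteq> []}"

text \<open>
  \<open>T_space\<close> is stated in the literature to be an ideal of \<open>(qdjy, \<squnion>\<squnion>)\<close>, but it is not one
  (\<open>T_space_not_ideal\<close> below: the product of j and dy is dyj - y), and the ideal that \<open>L_gens\<close>
  generates in the whole of \<open>qdjy\<close> is too big: together with \<open>T_space\<close> it contains the word yy
  (\<open>yy_in_literal_ideal\<close>), whose value under the desingularized zeta map is 1/4.
  Both defects come from products with words that do not end in y. The span of 1 and the words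
  ending in y is closed under the product, so the ideal is generated there, and the product on the
  quotient is computed with the representatives from that span. If \<open>T_space\<close> were an ideal,
  this would be the same as the quotient of \<open>(qdjy, \<squnion>\<squnion>)\<close> by the sum of the two ideals.
\<close>

definition L_space :: "qdjy set" where
  "L_space = sha_ideal Y_space hull L_gens"

text \<open>The projection onto \<open>Y_space\<close> along \<open>T_space\<close>.\<close>

definition proj_Y :: "qdjy \<Rightarrow> qdjy" where
  "proj_Y = lin_ext (\<lambda>w. if w \<in> range yword then mon w else 0)"

definition TL_space :: "qdjy set" where
  "TL_space = {t + l | t l. t \<in> T_space \<and> l \<in> L_space}"

subsection \<open>The rules of the product\<close>

lemma first_letter_add:
  "first_letter (letter_word Y + u) = Some Y"
  "first_letter u \<noteq> Some D \<Longrightarrow> first_letter (letter_word J + u) = Some J"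
  "first_letter u \<noteq> Some J \<Longrightarrow> first_letter (letter_word D + u) = Some D"
  by (cases u; auto split: if_splits)+

lemma rest_add:
  "rest (letter_word Y + u) = u"
  "first_letter u \<noteq> Some D \<Longrightarrow> rest (letter_word J + u) = u"
  "first_letter u \<noteq> Some J \<Longrightarrow> rest (letter_word D + u) = u"
  by (cases u; auto simp: sgn_if split: if_splits)+

lemma mon_add: "mon (u + v) = mon u * mon v"
  by (simp add: mon_def mult_single)

lemma mon_0: "mon 0 = 1"
  by (simp add: mon_def)

lemma sha_word_0 [simp]: "sha_word 0 v = mon v" "sha_word u 0 = mon u"
proof -
  have *: "first_letter (0::word) = None"
    by (simp add: first_letter_None)
  show "sha_word 0 v = mon v"
    by (subst sha_word.simps) (simp add: *)
  show "sha_word u 0 = mon u"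
  proof (cases "first_letter u")
    case None
    then show ?thesis
      by (subst sha_word.simps) (simp add: * first_letter_None)
  next
    case (Some l)
    then show ?thesis
      by (subst sha_word.simps) (cases l; simp add: *)
  qed
qed

lemma sha_word_Y_left: "sha_word (letter_word Y + u) v = letter_mon Y * sha_word u v"
proof (cases "v = 0")
  case True
  then show ?thesis by (simp add: mon_add del: letter_word.simps)
next
  case False
  then obtain l where "first_letter v = Some l"
    using first_letter_None by (cases "first_letter v") auto
  then show ?thesis
    by (subst sha_word.simps) (simp add: first_letter_add rest_add del: letter_word.simps)
qed

lemma sha_word_Y_right: "sha_word u (letter_word Y + v) = letter_mon Y * sha_word u v"
proof (induction "word_length u" arbitrary: u)
  case 0
  then have "u = 0" by (cases u) (auto simp: zero_word_def)
  then show ?case by (simp add: mon_add del: letter_word.simps)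
next
  case (Suc n)
  then obtain l where l: "first_letter u = Some l"
    using first_letter_None by (cases "first_letter u") (auto simp: zero_word_def)
  then have n: "n = word_length (rest u)"
    using word_length_rest Suc.hyps by fastforce
  show ?case
  proof (cases "l = Y")
    case True
    then have u: "u = letter_word Y + rest u"
      using first_letter_rest l by blast
    show ?thesis
      using Suc.hyps(1)[OF n] u sha_word_Y_left by metis
  next
    case False
    with l show ?thesis
      by (subst sha_word.simps)
        (cases l; simp add: first_letter_add rest_add del: letter_word.simps)
  qed
qed

lemma sha_word_JJ:
  "first_letter u \<noteq> Some D \<Longrightarrow> first_letter v \<noteq> Some D \<Longrightarrow>
   sha_word (letter_word J + u) (letter_word J + v) =
     letter_mon J * sha_word u (letter_word J + v) + letter_mon J * sha_word (letter_word J + u) v"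
  by (subst sha_word.simps) (simp add: first_letter_add rest_add del: letter_word.simps)

lemma sha_word_DD:
  "first_letter u \<noteq> Some J \<Longrightarrow> first_letter v \<noteq> Some J \<Longrightarrow>
   sha_word (letter_word D + u) (letter_word D + v) =
     letter_mon D * sha_word u (letter_word D + v)
     - sha_word u (letter_word D + (letter_word D + v))"
  by (subst sha_word.simps) (simp add: first_letter_add rest_add del: letter_word.simps)

lemma sha_word_DJ:
  "first_letter u \<noteq> Some J \<Longrightarrow> first_letter v \<noteq> Some D \<Longrightarrow>
   sha_word (letter_word D + u) (letter_word J + v) =
     letter_mon D * sha_word u (letter_word J + v) - sha_word u v"
  by (subst sha_word.simps) (simp add: first_letter_add rest_add del: letter_word.simps)

lemma sha_word_JD:
  "first_letter u \<noteq> Some D \<Longrightarrow> first_letter v \<noteq> Some J \<Longrightarrow>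
   sha_word (letter_word J + u) (letter_word D + v) =
     letter_mon D * sha_word (letter_word J + u) v - sha_word u v"
  by (subst sha_word.simps) (simp add: first_letter_add rest_add del: letter_word.simps)

subsection \<open>Bilinearity\<close>

lemma lookup_qscale: "Poly_Mapping.lookup (qscale c a) w = c * Poly_Mapping.lookup a w"
  by (simp add: qscale_def mult_map_scale_conv_mult [symmetric] map.rep_eq when_def)

lemma keys_qscale: "Poly_Mapping.keys (qscale c a) \<subseteq> Poly_Mapping.keys a"
  by (auto simp: in_keys_iff lookup_qscale)

lemma lin_ext_superset:
  assumes "finite S" "Poly_Mapping.keys a \<subseteq> S"
  shows "lin_ext f a = (\<Sum>w\<in>S. qscale (Poly_Mapping.lookup a w) (f w))"
  unfolding lin_ext_def using assms
  by (intro sum.mono_neutral_left) (auto simp: in_keys_iff)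

lemma lin_ext_add: "lin_ext f (a + b) = lin_ext f a + lin_ext f b"
proof -
  define S where "S = Poly_Mapping.keys a \<union> Poly_Mapping.keys b"
  have S: "finite S" "Poly_Mapping.keys a \<subseteq> S" "Poly_Mapping.keys b \<subseteq> S" "Poly_Mapping.keys (a + b) \<subseteq> S"
    using Poly_Mapping.keys_add [of a b] by (auto simp: S_def)
  then show ?thesis
    by (simp add: lin_ext_superset [of S] lookup_add qdjy.scale_left_distrib sum.distrib)
qed

lemma lin_ext_scale: "lin_ext f (qscale c a) = qscale c (lin_ext f a)"
  by (simp add: lin_ext_superset [OF _ keys_qscale] lin_ext_superset [of "Poly_Mapping.keys a" a]
      lookup_qscale qdjy.scale_sum_right)

lemma lin_ext_mon [simp]: "lin_ext f (mon w) = f w"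
  by (simp add: lin_ext_def mon_def)

lemma linear_lin_ext: "Vector_Spaces.linear qscale qscale (lin_ext f)"
  by unfold_locales (simp_all add: lin_ext_add lin_ext_scale)

lemma lin_ext_0 [simp]: "lin_ext f 0 = 0"
  by (simp add: lin_ext_def)

lemma lin_ext_diff: "lin_ext f (a - b) = lin_ext f a - lin_ext f b"
  by (metis add_diff_cancel_right' diff_add_cancel lin_ext_add)

lemma lin_ext_fun_add: "lin_ext (\<lambda>w. f w + g w) a = lin_ext f a + lin_ext g a"
  by (simp add: lin_ext_def qdjy.scale_right_distrib sum.distrib)

lemma lin_ext_fun_scale: "lin_ext (\<lambda>w. qscale c (f w)) a = qscale c (lin_ext f a)"
  by (simp add: lin_ext_def qdjy.scale_sum_right mult.commute)

lemma mon_expand: "a = lin_ext mon a"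
proof (rule poly_mapping_eqI)
  fix k
  have "Poly_Mapping.lookup (lin_ext mon a) k
      = (\<Sum>w\<in>Poly_Mapping.keys a. if w = k then Poly_Mapping.lookup a w else 0)"
    by (simp add: lin_ext_def lookup_sum lookup_qscale mon_def lookup_single when_def if_distrib cong: if_cong)
  also have "\<dots> = Poly_Mapping.lookup a k"
    by (simp add: in_keys_iff)
  finally show "Poly_Mapping.lookup a k = Poly_Mapping.lookup (lin_ext mon a) k" by simp
qed

lemma sha0_mon [simp]: "mon u \<squnion>\<squnion> mon v = sha_word u v"
  by (simp add: sha0_def)

lemma sha0_add_left: "(a + b) \<squnion>\<squnion> c = a \<squnion>\<squnion> c + b \<squnion>\<squnion> c"
  by (simp add: sha0_def lin_ext_add)

lemma sha0_add_right: "a \<squnion>\<squnion> (b + c) = a \<squnion>\<squnion> b + a \<squnion>\<squnion> c"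
  by (simp add: sha0_def lin_ext_add lin_ext_fun_add)

lemma sha0_scale_left: "qscale k a \<squnion>\<squnion> b = qscale k (a \<squnion>\<squnion> b)"
  by (simp add: sha0_def lin_ext_scale)

lemma sha0_scale_right: "a \<squnion>\<squnion> qscale k b = qscale k (a \<squnion>\<squnion> b)"
  by (simp add: sha0_def lin_ext_scale lin_ext_fun_scale)

lemma sha0_0 [simp]: "0 \<squnion>\<squnion> a = 0" "a \<squnion>\<squnion> 0 = 0"
  by (simp_all add: sha0_def lin_ext_0) (simp add: lin_ext_def)

lemma sha0_diff_left: "(a - b) \<squnion>\<squnion> c = a \<squnion>\<squnion> c - b \<squnion>\<squnion> c"
  by (metis add_diff_cancel_right' diff_add_cancel sha0_add_left)

lemma sha0_diff_right: "a \<squnion>\<squnion> (b - c) = a \<squnion>\<squnion> b - a \<squnion>\<squnion> c"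
  by (metis add_diff_cancel_right' diff_add_cancel sha0_add_right)

lemma sha0_1: "1 \<squnion>\<squnion> a = a" "a \<squnion>\<squnion> 1 = a"
proof -
  have "sha_word 0 = mon" by (rule ext) simp
  then show "1 \<squnion>\<squnion> a = a" "a \<squnion>\<squnion> 1 = a"
    by (simp_all add: sha0_def flip: mon_0 mon_expand)
qed

subsection \<open>The decomposition into Y_space and T_space\<close>

fun last_exp :: "word \<Rightarrow> int" where
  "last_exp (JPow k) = k"
| "last_exp (JPowY k w) = last_exp w"

lemma last_exp_yword: "last_exp (yword ks + JPow k) = k"
  by (induction ks) (auto simp: zero_word_def)

lemma word_eq_yword_add: "\<exists>ks. w = yword ks + JPow (last_exp w)"
proof (induction w)
  case (JPow k)
  show ?case by (rule exI [of _ "[]"]) simp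
next
  case (JPowY k w)
  then obtain ks where "w = yword ks + JPow (last_exp w)" by blast
  then show ?case by (intro exI [of _ "k # ks"]) simp
qed

lemma range_yword: "w \<in> range yword \<longleftrightarrow> last_exp w = 0"
proof
  assume "w \<in> range yword"
  then obtain ks where "w = yword ks + JPow 0"
    by (metis add_0_right rangeE zero_word_def)
  then show "last_exp w = 0" using last_exp_yword by metis
next
  assume "last_exp w = 0"
  then show "w \<in> range yword"
    using word_eq_yword_add [of w] by (metis add_0_right rangeI zero_word_def)
qed

lemma yword_eq_0: "yword ks = 0 \<longleftrightarrow> ks = []"
  by (cases ks) (auto simp: zero_word_def)

lemma proj_Y_mon: "proj_Y (mon w) = (if last_exp w = 0 then mon w else 0)"
  by (simp add: proj_Y_def range_yword)

lemma proj_Y_add: "proj_Y (a + b) = proj_Y a + proj_Y b"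
  and proj_Y_diff: "proj_Y (a - b) = proj_Y a - proj_Y b"
  and proj_Y_scale: "proj_Y (qscale c a) = qscale c (proj_Y a)"
  and proj_Y_0 [simp]: "proj_Y 0 = 0"
  by (simp_all add: proj_Y_def lin_ext_add lin_ext_diff lin_ext_scale)

lemma proj_Y_T: "a \<in> T_space \<Longrightarrow> proj_Y a = 0"
  unfolding T_space_def
  by (induction rule: qdjy.span_induct_alt)
    (auto simp: proj_Y_add proj_Y_scale proj_Y_mon last_exp_yword)

lemma proj_Y_Y: "a \<in> Y_space \<Longrightarrow> proj_Y a = a"
  unfolding Y_space_def
proof (induction rule: qdjy.span_induct_alt)
  case (step c x y)
  then obtain ks where "x = mon (yword ks)" by blast
  with step show ?case
    using range_yword [of "yword ks"] by (simp add: proj_Y_add proj_Y_scale proj_Y_mon)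
qed simp

lemma proj_Y_in_Y: "proj_Y a \<in> Y_space"
  unfolding proj_Y_def lin_ext_def Y_space_def
  by (intro qdjy.span_sum qdjy.span_scale) (auto intro: qdjy.span_base qdjy.span_zero)

lemma diff_proj_Y_in_T: "a - proj_Y a \<in> T_space"
proof -
  have "lin_ext mon a - proj_Y a \<in> T_space"
    unfolding proj_Y_def lin_ext_def T_space_def sum_subtractf [symmetric]
      qdjy.scale_right_diff_distrib [symmetric]
  proof (intro qdjy.span_sum qdjy.span_scale)
    fix w
    obtain ks where w: "w = yword ks + JPow (last_exp w)"
      using word_eq_yword_add by blast
    show "mon w - (if w \<in> range yword then mon w else 0)
        \<in> qdjy.span {mon (yword ks + JPow k) | ks k. k \<noteq> 0}"
    proof (cases "last_exp w = 0")
      case True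
      then show ?thesis by (simp add: range_yword qdjy.span_zero)
    next
      case False
      then have "mon w \<in> {mon (yword ks + JPow k) | ks k. k \<noteq> 0}"
        using w by (simp only: mem_Collect_eq) metis
      then show ?thesis using False by (simp add: range_yword qdjy.span_base)
    qed
  qed
  then show ?thesis by (simp flip: mon_expand)
qed

subsection \<open>The span of 1 and the words ending in y is a subalgebra\<close>

text \<open>The span of the nonempty words ending in y, closed under concatenation with any word from the left.\<close>

definition Y1_space :: "qdjy set" where
  "Y1_space = qdjy.span {mon w | w. last_exp w = 0 \<and> w \<noteq> 0}"

lemma Y1_mon: "last_exp w = 0 \<Longrightarrow> w \<noteq> 0 \<Longrightarrow> mon w \<in> Y1_space"
  unfolding Y1_space_def by (rule qdjy.span_base) blast

lemma Y1_subset_Y: "Y1_space \<subseteq> Y_space"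
proof -
  have "{mon w | w. last_exp w = 0 \<and> w \<noteq> 0} \<subseteq> range (\<lambda>ks. mon (yword ks))"
    using range_yword by (auto simp: image_iff) metis
  then show ?thesis
    unfolding Y1_space_def Y_space_def by (rule qdjy.span_mono)
qed

lemma last_exp_add: "last_exp v = 0 \<Longrightarrow> v \<noteq> 0 \<Longrightarrow> last_exp (u + v) = 0 \<and> u + v \<noteq> 0"
  by (induction u; cases v) (auto simp: zero_word_def)

lemma mon_mult_qscale: "mon w * qscale c a = qscale c (mon w * a)"
  by (simp add: qscale_def mon_def mult_single flip: mult.assoc)

lemma mon_mult_Y1: "a \<in> Y1_space \<Longrightarrow> mon w * a \<in> Y1_space"
  unfolding Y1_space_def
proof (induction rule: qdjy.span_induct_alt)
  case base
  show ?case by (simp add: qdjy.span_zero)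
next
  case (step c x y)
  then obtain v where v: "x = mon v" "last_exp v = 0" "v \<noteq> 0" by blast
  then have "mon w * x \<in> {mon w | w. last_exp w = 0 \<and> w \<noteq> 0}"
    using last_exp_add [of v w] by (auto simp flip: mon_add)
  then show ?case
    unfolding distrib_left mon_mult_qscale
    using step by (intro qdjy.span_add qdjy.span_scale) (auto intro: qdjy.span_base)
qed

lemma Y1_add: "a \<in> Y1_space \<Longrightarrow> b \<in> Y1_space \<Longrightarrow> a + b \<in> Y1_space"
  and Y1_diff: "a \<in> Y1_space \<Longrightarrow> b \<in> Y1_space \<Longrightarrow> a - b \<in> Y1_space"
  unfolding Y1_space_def by (fact qdjy.span_add qdjy.span_diff)+

lemma last_exp_rest: "first_letter w = Some l \<Longrightarrow> last_exp w = 0 \<Longrightarrow> last_exp (rest w) = 0"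
  by (cases w) (auto split: if_splits)

lemma rest_nonempty:
  "first_letter w = Some l \<Longrightarrow> l \<noteq> Y \<Longrightarrow> last_exp w = 0 \<Longrightarrow> rest w \<noteq> 0"
  by (cases w) (auto simp: zero_word_def split: if_splits)

lemma sha_word_in_Y1:
  "last_exp u = 0 \<Longrightarrow> last_exp v = 0 \<Longrightarrow> u \<noteq> 0 \<or> v \<noteq> 0 \<Longrightarrow> sha_word u v \<in> Y1_space"
proof (induction "(u, v)" arbitrary: u v
    rule: wf_induct_rule [OF wf_measures [of "[\<lambda>(u, v). word_length u + word_length v, \<lambda>(u, v). word_length u]"]])
  case 1
  have IH: "sha_word u' v' \<in> Y1_space"
    if "word_length u' + word_length v' < word_length u + word_length v \<or>
      word_length u' + word_length v' = word_length u + word_length v \<and> word_length u' < word_length u"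
      "last_exp u' = 0" "last_exp v' = 0" "u' \<noteq> 0 \<or> v' \<noteq> 0" for u' v'
    using 1(1) [of u' v'] that by simp
  show ?case
  proof (cases "u = 0 \<or> v = 0")
    case True
    then show ?thesis
      using 1 by (auto simp: Y1_mon)
  next
    case False
    then obtain l m where lm: "first_letter u = Some l" "first_letter v = Some m"
      using first_letter_None by (metis option.exhaust)
    have ru: "last_exp (rest u) = 0" "l \<noteq> Y \<Longrightarrow> rest u \<noteq> 0" "word_length u = Suc (word_length (rest u))"
      using last_exp_rest rest_nonempty word_length_rest lm 1 by metis+
    have rv: "last_exp (rest v) = 0" "m \<noteq> Y \<Longrightarrow> rest v \<noteq> 0" "word_length v = Suc (word_length (rest v))"
      using last_exp_rest rest_nonempty word_length_rest lm 1 by metis+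
    have dv: "last_exp (letter_word D + v) = 0" "letter_word D + v \<noteq> 0"
      using last_exp_add [of v "letter_word D"] False 1 by blast+
    have rest_left: "sha_word (rest u) v \<in> Y1_space"
      using False 1 ru by (intro IH) auto
    have rest_right: "sha_word u (rest v) \<in> Y1_space"
      using False 1 rv by (intro IH) auto
    have rest_both: "sha_word (rest u) (rest v) \<in> Y1_space" if "l \<noteq> Y"
      using that 1 ru rv by (intro IH) auto
    have rest_D: "sha_word (rest u) (letter_word D + v) \<in> Y1_space" if "m = D"
      using that 1 ru dv lm word_length_D_rest [of v] by (intro IH) auto
    show ?thesis
      using rest_left rest_right rest_both rest_D lm
      by (subst sha_word.simps)
        (cases l; cases m; simp add: mon_mult_Y1 Y1_add Y1_diff del: letter_word.simps)
  qed
qed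

lemma one_in_Y: "1 \<in> Y_space"
proof -
  have "mon (yword []) \<in> Y_space"
    unfolding Y_space_def by (rule qdjy.span_base) blast
  then show ?thesis by (simp add: mon_0)
qed

lemma subspace_Y: "qdjy.subspace Y_space"
  by (simp add: Y_space_def)

lemma sha_word_in_Y:
  assumes "last_exp u = 0" "last_exp v = 0"
  shows "sha_word u v \<in> Y_space"
proof (cases "u = 0 \<and> v = 0")
  case True
  then show ?thesis by (simp add: mon_0 one_in_Y)
next
  case False
  then show ?thesis using sha_word_in_Y1 assms Y1_subset_Y by blast
qed

lemma sha0_in_Y:
  assumes "a \<in> Y_space" "b \<in> Y_space"
  shows "a \<squnion>\<squnion> b \<in> Y_space"
  using assms(1) unfolding Y_space_def
proof (induction rule: qdjy.span_induct_alt)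
  case base
  show ?case by (simp add: qdjy.span_zero)
next
  case (step c x y)
  then obtain us where x: "x = mon (yword us)" by blast
  have "x \<squnion>\<squnion> b \<in> Y_space"
    using assms(2) unfolding Y_space_def
  proof (induction rule: qdjy.span_induct_alt)
    case base
    show ?case by (simp add: qdjy.span_zero)
  next
    case (step c z y)
    then obtain vs where z: "z = mon (yword vs)" by blast
    have "last_exp (yword us) = 0" "last_exp (yword vs) = 0"
      using range_yword by blast+
    then have "x \<squnion>\<squnion> z \<in> Y_space"
      by (simp add: x z sha_word_in_Y)
    then show ?case
      using step unfolding Y_space_def
      by (simp add: sha0_add_right sha0_scale_right qdjy.span_add qdjy.span_scale)
  qed
  then show ?case
    using step unfolding Y_space_def
    by (simp add: sha0_add_left sha0_scale_left qdjy.span_add qdjy.span_scale)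
qed

lemma L_gens_subset_Y: "L_gens \<subseteq> Y_space"
proof
  fix x assume "x \<in> L_gens"
  then obtain k us vs where x: "x = mon (JPow k) * leibniz (yword us) (yword vs)"
    and ne: "us \<noteq> []" "vs \<noteq> []"
    unfolding L_gens_def by blast
  have l: "last_exp (yword us) = 0" "last_exp (yword vs) = 0"
    using range_yword by blast+
  have n: "yword us \<noteq> 0" "yword vs \<noteq> 0"
    using ne by (simp_all add: yword_eq_0)
  have "leibniz (yword us) (yword vs) \<in> Y1_space"
    unfolding leibniz_def
    using last_exp_add [OF l(1) n(1)] last_exp_add [OF l(2) n(2)] l n
    by (intro Y1_diff mon_mult_Y1 sha_word_in_Y1) auto
  then show "x \<in> Y_space"
    using mon_mult_Y1 Y1_subset_Y x by blast
qed

subsection \<open>The ideal generated by the Leibniz relations\<close>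

lemma sha_ideal_L: "sha_ideal Y_space L_space"
  unfolding L_space_def
  by (rule hull_in) (auto simp: sha_ideal_def intro!: qdjy.subspace_Inter)

lemma subspace_L: "qdjy.subspace L_space"
  using sha_ideal_L by (simp add: sha_ideal_def)

lemma L_gens_subset_L: "L_gens \<subseteq> L_space"
  unfolding L_space_def by (rule hull_subset)

lemma L_subset_Y: "L_space \<subseteq> Y_space"
  unfolding L_space_def
  by (rule hull_minimal) (simp_all add: L_gens_subset_Y sha_ideal_def subspace_Y sha0_in_Y)

lemma subspace_TL: "qdjy.subspace TL_space"
  unfolding TL_space_def
  by (rule qdjy.subspace_sums) (simp_all add: T_space_def subspace_L)

lemma TL_iff: "a \<in> TL_space \<longleftrightarrow> proj_Y a \<in> L_space"
proof
  assume "a \<in> TL_space"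
  then obtain t l where "a = t + l" "t \<in> T_space" "l \<in> L_space"
    unfolding TL_space_def by blast
  then show "proj_Y a \<in> L_space"
    using L_subset_Y by (auto simp: proj_Y_add proj_Y_T proj_Y_Y subset_iff)
next
  assume "proj_Y a \<in> L_space"
  moreover have "a = (a - proj_Y a) + proj_Y a" by simp
  ultimately show "a \<in> TL_space"
    unfolding TL_space_def using diff_proj_Y_in_T by blast
qed

subsection \<open>The quotient algebra\<close>

lemma TL_refl: "a - a \<in> TL_space"
  by (simp add: qdjy.subspace_0 [OF subspace_TL])

lemma TL_0: "0 \<in> TL_space"
  by (rule qdjy.subspace_0 [OF subspace_TL])

lemma TL_minus: "a \<in> TL_space \<Longrightarrow> - a \<in> TL_space"
  by (rule qdjy.subspace_neg [OF subspace_TL])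

lemma TL_sym: "a - b \<in> TL_space \<Longrightarrow> b - a \<in> TL_space"
  by (drule TL_minus) simp

lemma TL_add: "a \<in> TL_space \<Longrightarrow> b \<in> TL_space \<Longrightarrow> a + b \<in> TL_space"
  by (rule qdjy.subspace_add [OF subspace_TL])

lemma TL_trans: "a - b \<in> TL_space \<Longrightarrow> b - c \<in> TL_space \<Longrightarrow> a - c \<in> TL_space"
  by (drule (1) TL_add) simp

quotient_type sha_alg = qdjy / "\<lambda>a b. a - b \<in> TL_space"
  by (intro equivpI reflpI sympI transpI) (fact TL_refl TL_sym TL_trans)+

instantiation sha_alg :: ab_group_add
begin

lift_definition zero_sha_alg :: sha_alg is "0 :: qdjy" .

lift_definition plus_sha_alg :: "sha_alg \<Rightarrow> sha_alg \<Rightarrow> sha_alg" is "\<lambda>a b :: qdjy. a + b"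
  by (drule (1) TL_add) (simp add: algebra_simps)

lift_definition uminus_sha_alg :: "sha_alg \<Rightarrow> sha_alg" is "\<lambda>a :: qdjy. - a"
  by (drule TL_minus) simp

lift_definition minus_sha_alg :: "sha_alg \<Rightarrow> sha_alg \<Rightarrow> sha_alg" is "\<lambda>a b :: qdjy. a - b"
proof -
  fix a a' b b' :: qdjy
  assume "a - a' \<in> TL_space" "b - b' \<in> TL_space"
  then show "a - b - (a' - b') \<in> TL_space"
    using TL_add [OF _ TL_sym] by (force simp: algebra_simps)
qed

instance
proof
  fix a b c :: sha_alg
  show "a + b + c = a + (b + c)" by transfer (simp add: TL_0 add.assoc)
  show "a + b = b + a" by transfer (simp add: TL_0 add.commute)
  show "0 + a = a" by transfer (simp add: TL_0)
  show "- a + a = 0" by transfer (simp add: TL_0)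
  show "a - b = a + - b" by transfer (simp add: TL_0)
qed

end

instantiation sha_alg :: "{one, times}"
begin

lift_definition one_sha_alg :: sha_alg is "1 :: qdjy" .

lift_definition times_sha_alg :: "sha_alg \<Rightarrow> sha_alg \<Rightarrow> sha_alg"
  is "\<lambda>a b. proj_Y a \<squnion>\<squnion> proj_Y b"
proof -
  fix a a' b b' :: qdjy
  assume "a - a' \<in> TL_space" "b - b' \<in> TL_space"
  then have L: "proj_Y a - proj_Y a' \<in> L_space" "proj_Y b - proj_Y b' \<in> L_space"
    by (simp_all add: TL_iff proj_Y_diff)
  have "proj_Y a \<squnion>\<squnion> proj_Y b - proj_Y a' \<squnion>\<squnion> proj_Y b'
      = (proj_Y a - proj_Y a') \<squnion>\<squnion> proj_Y b + proj_Y a' \<squnion>\<squnion> (proj_Y b - proj_Y b')"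
    by (simp add: sha0_diff_left sha0_diff_right)
  also have "\<dots> \<in> L_space"
    using L sha_ideal_L proj_Y_in_Y by (auto simp: sha_ideal_def intro!: qdjy.subspace_add)
  finally show "proj_Y a \<squnion>\<squnion> proj_Y b - proj_Y a' \<squnion>\<squnion> proj_Y b' \<in> TL_space"
    using L_subset_Y by (auto simp: TL_iff proj_Y_Y subset_iff)
qed

instance ..

end

lift_definition sha_scale :: "rat \<Rightarrow> sha_alg \<Rightarrow> sha_alg" is qscale
  by (drule qdjy.subspace_scale [OF subspace_TL]) (simp add: qdjy.scale_right_diff_distrib)

lift_definition sha_class :: "word \<Rightarrow> sha_alg" is mon .

section \<open>The functions Li\<close>

definition J_op :: "(real \<Rightarrow> real) \<Rightarrow> real \<Rightarrow> real" where
  "J_op f t = integral {0..t} (\<lambda>z. f z / z)"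

definition D_op :: "(real \<Rightarrow> real) \<Rightarrow> real \<Rightarrow> real" where
  "D_op f t = t * deriv f t"

definition J_pow :: "int \<Rightarrow> (real \<Rightarrow> real) \<Rightarrow> real \<Rightarrow> real" where
  "J_pow k = (if k \<ge> 0 then J_op ^^ nat k else D_op ^^ nat (- k))"

definition Li_des0 :: "real \<Rightarrow> real" where
  "Li_des0 t = t / (1 - t) + t * ln t / (1 - t)\<^sup>2"

text \<open>The argument list of \<open>Li_des_rev\<close> is $k_r, \dots, k_1$, the outermost operator first.\<close>

fun Li_des_rev :: "int list \<Rightarrow> real \<Rightarrow> real" where
  "Li_des_rev [] = (\<lambda>t. 1)"
| "Li_des_rev (k # ks) = J_pow k (\<lambda>t. Li_des0 t * Li_des_rev ks t)"

definition Li_des :: "int list \<Rightarrow> real \<Rightarrow> real" where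
  "Li_des ks = Li_des_rev (rev ks)"

section \<open>The desingularized multiple zeta function\<close>

text \<open>
  The Hankel contour of radius \<open>\<epsilon>\<close>, parametrized by the real line, together with the branch of the
  logarithm along it: the argument is 0 on the incoming ray ($u \le 0$), increases from 0 to $2\pi$
  on the circle, and is $2\pi$ on the outgoing ray ($u \ge 2\pi$).
\<close>

definition hankel_log :: "real \<Rightarrow> real \<Rightarrow> complex" where
  "hankel_log \<epsilon> u =
    (if u \<le> 0 then Complex (ln (\<epsilon> - u)) 0
     else if u \<le> 2 * pi then Complex (ln \<epsilon>) u
     else Complex (ln (\<epsilon> + (u - 2 * pi))) (2 * pi))"

definition hankel :: "real \<Rightarrow> real \<Rightarrow> complex" where
  "hankel \<epsilon> u = exp (hankel_log \<epsilon> u)"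

text \<open>
  Variables and exponents of depth \<open>r\<close> are indexed by \<open>0, \<dots>, r - 1\<close>. The power $t_k^{s_k - 1}$ uses the
  branch above, and $dt_k$ becomes \<open>vector_derivative\<close>, which exists except at \<open>0\<close> and \<open>2 * pi\<close>.
\<close>

definition hankel_integral :: "real \<Rightarrow> real \<Rightarrow> nat \<Rightarrow> (nat \<Rightarrow> complex) \<Rightarrow> complex" where
  "hankel_integral \<epsilon> c r s =
    (LINT u | Pi\<^sub>M {..<r} (\<lambda>_. lborel).
       (\<Prod>j<r. 1 / (exp (\<Sum>k\<in>{j..<r}. hankel \<epsilon> (u k)) - 1)
              - of_real c / (exp (of_real c * (\<Sum>k\<in>{j..<r}. hankel \<epsilon> (u k))) - 1)) *
       (\<Prod>k<r. exp ((s k - 1) * hankel_log \<epsilon> (u k)) * vector_derivative (hankel \<epsilon>) (at (u k))))"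

definition zeta_des_approx :: "real \<Rightarrow> real \<Rightarrow> nat \<Rightarrow> (nat \<Rightarrow> complex) \<Rightarrow> complex" where
  "zeta_des_approx \<epsilon> c r s =
    1 / (1 - of_real c) ^ r *
    (\<Prod>k<r. 1 / ((exp (2 * pi * \<i> * s k) - 1) * Gamma (s k))) * hankel_integral \<epsilon> c r s"

text \<open>
  $\mathbb{C}^r$ as the extensional functions on \<open>{..<r}\<close>; on this set the product topology of
  \<open>nat \<Rightarrow> complex\<close> is the usual one. A function of several complex variables is holomorphic if it is
  continuous and holomorphic in each variable separately.
\<close>

definition Cn :: "nat \<Rightarrow> (nat \<Rightarrow> complex) set" where
  "Cn r = PiE {..<r} (\<lambda>_. UNIV)"

definition entire_on_Cn :: "nat \<Rightarrow> ((nat \<Rightarrow> complex) \<Rightarrow> complex) \<Rightarrow> bool" where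
  "entire_on_Cn r F \<longleftrightarrow> continuous_on (Cn r) F \<and>
     (\<forall>s\<in>Cn r. \<forall>i<r. (\<lambda>z. F (s(i := z))) holomorphic_on UNIV)"

definition is_zeta_des :: "nat \<Rightarrow> ((nat \<Rightarrow> complex) \<Rightarrow> complex) \<Rightarrow> bool" where
  "is_zeta_des r F \<longleftrightarrow> entire_on_Cn r F \<and>
     (\<forall>s\<in>Cn r. (\<forall>k<r. s k \<notin> \<int>) \<longrightarrow>
        (\<forall>\<^sub>F \<epsilon> in at_right 0. ((\<lambda>c. zeta_des_approx \<epsilon> c r s) \<longlongrightarrow> F s) (at 1)))"

definition zeta_des :: "nat \<Rightarrow> (nat \<Rightarrow> complex) \<Rightarrow> complex" where
  "zeta_des r s = (THE w. \<exists>F. is_zeta_des r F \<and> w = F s)"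

section \<open>The map on the quotient algebra\<close>

text \<open>
  The linear map that sends 1 to 1 and $j^{k_r} y \cdots j^{k_1} y$ to the limit of
  \<open>Li_des [k\<^sub>1, \<dots>, k\<^sub>r]\<close>.
\<close>

definition is_zeta_des_sha :: "(sha_alg \<Rightarrow> real) \<Rightarrow> bool" where
  "is_zeta_des_sha Z \<longleftrightarrow>
     Vector_Spaces.linear sha_scale (\<lambda>q x. of_rat q * x) Z \<and> Z 1 = 1 \<and>
     (\<forall>ks. ks \<noteq> [] \<longrightarrow> (Li_des ks \<longlongrightarrow> Z (sha_class (yword (rev ks)))) (at_left 1))"

section \<open>Why the ideal is generated in the span of 1 and the words ending in y\<close>

lemma sha_word_j_dy:
  "sha_word (letter_word J) (letter_word D + letter_word Y)
     = mon (letter_word D + letter_word Y + letter_word J) - mon (letter_word Y)"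
proof -
  have "sha_word (letter_word J + 0) (letter_word D + (letter_word Y + 0))
      = letter_mon D * sha_word (letter_word J + 0) (letter_word Y + 0)
        - sha_word 0 (letter_word Y + 0)"
    by (rule sha_word_JD) (simp_all add: zero_word_def)
  then show ?thesis
    by (simp only: add_0_right sha_word_Y_right sha_word_0 mon_add mult.assoc mon_0 mult_1_right
        sha_word_Y_right [of _ 0, unfolded add_0_right sha_word_0])
qed

theorem T_space_not_ideal: "\<not> sha_ideal UNIV T_space"
proof
  assume I: "sha_ideal UNIV T_space"
  have "mon (yword [] + JPow 1) \<in> T_space"
    unfolding T_space_def by (rule qdjy.span_base) (metis (mono_tags, lifting) mem_Collect_eq one_neq_zero)
  then have "letter_mon J \<squnion>\<squnion> mon (letter_word D + letter_word Y) \<in> T_space"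
    using I by (simp only: sha_ideal_def) (metis UNIV_I add_0 letter_word.simps(2) yword.simps(1))
  then have "proj_Y (sha_word (letter_word J) (letter_word D + letter_word Y)) = 0"
    by (simp only: sha0_mon proj_Y_T)
  then have "mon (letter_word Y) = 0"
    unfolding sha_word_j_dy by (simp add: proj_Y_diff proj_Y_mon)
  then show False
    by (metis lookup_single_eq lookup_zero mon_def zero_neq_one)
qed

theorem yy_in_literal_ideal:
  assumes T: "T_space \<subseteq> S" and L: "sha_ideal UNIV hull L_gens \<subseteq> S" and S: "qdjy.subspace S"
  shows "mon (yword [0, 0]) \<in> S"
proof -
  let ?Y = "letter_word Y" and ?D = "letter_word D" and ?J = "letter_word J"
  define g where "g = leibniz ?Y ?Y"
  have y: "yword [0] = ?Y" by (simp add: zero_word_def)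
  have "g = mon (JPow 0) * leibniz (yword [0]) (yword [0])"
    unfolding y g_def by (simp add: mon_0 flip: zero_word_def)
  then have "g \<in> L_gens"
    unfolding L_gens_def by blast
  moreover have "sha_ideal UNIV (sha_ideal UNIV hull L_gens)"
    by (rule hull_in) (auto simp: sha_ideal_def intro!: qdjy.subspace_Inter)
  ultimately have "mon ?J \<squnion>\<squnion> g \<in> S"
    using L hull_inc [of g L_gens] by (auto simp: sha_ideal_def)
  have Y1: "sha_word u ?Y = mon ?Y * mon u" for u
    using sha_word_Y_right [of u 0] by simp
  have Y2: "sha_word ?Y u = mon ?Y * mon u" for u
    using sha_word_Y_left [of 0 u] by simp
  have g: "g = mon (?D + ?Y + ?Y) - mon (?Y + ?D + ?Y) - mon (?Y + ?D + ?Y)"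
    by (simp only: g_def leibniz_def Y1 Y2 mon_add mult.assoc)
  have 1: "sha_word ?J (?D + ?Y + ?Y) = mon (?D + ?Y + ?Y + ?J) - mon (?Y + ?Y)"
  proof -
    have "sha_word (?J + 0) (?D + (?Y + ?Y)) = mon ?D * sha_word (?J + 0) (?Y + ?Y) - sha_word 0 (?Y + ?Y)"
      by (rule sha_word_JD) (simp_all add: zero_word_def)
    then show ?thesis
      by (simp only: add_0_right add.assoc sha_word_Y_right Y1 sha_word_0 mon_add mult.assoc mon_0 mult_1_right)
  qed
  have 2: "sha_word ?J (?Y + ?D + ?Y) = mon (?Y + ?D + ?Y + ?J) - mon (?Y + ?Y)"
    by (simp only: add.assoc sha_word_Y_right sha_word_j_dy mon_add right_diff_distrib)
  have "mon ?J \<squnion>\<squnion> g = mon (?D + ?Y + ?Y + ?J) - mon (?Y + ?Y)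
      - (mon (?Y + ?D + ?Y + ?J) - mon (?Y + ?Y)) - (mon (?Y + ?D + ?Y + ?J) - mon (?Y + ?Y))"
    by (simp only: g sha0_diff_right sha0_mon 1 2)
  then have "proj_Y (mon ?J \<squnion>\<squnion> g) = mon (?Y + ?Y)"
    by (simp add: proj_Y_diff proj_Y_mon)
  moreover have "mon ?J \<squnion>\<squnion> g - proj_Y (mon ?J \<squnion>\<squnion> g) \<in> S"
    using T diff_proj_Y_in_T by blast
  ultimately have "mon (?Y + ?Y) \<in> S"
    using qdjy.subspace_diff [OF S \<open>mon ?J \<squnion>\<squnion> g \<in> S\<close>] by fastforce
  then show ?thesis
    by (simp add: zero_word_def)
qed

end

theory Submission
  imports Defs "HOL-Complex_Analysis.Complex_Analysis" "HOL-Real_Asymp.Real_Asymp"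
begin

text \<open>
  In the coordinate $t = e^{-x}$ the function \<open>Li_des0\<close> is \<open>gen\<close> $= B'$ with $B(x) = x/(e^x-1)$, hence
  holomorphic near $[0,\infty)$ and exponentially decaying, $D$ becomes $-d/dx$ and $J$ becomes
  $f \mapsto \int_0^\infty f(x+u)\,du$. These operators are mutually inverse on decaying holomorphic
  functions, so the limits at $t = 1$ are the values at $x = 0$. Since $D$ is a derivation, letting
  words act on the constant function 1 turns the product of words into the product of functions, and
  the Leibniz relations act as 0.

  In the integral over the Hankel contours, $(\frac{1}{e^x-1} - \frac{c}{e^{cx}-1})/(1-c)$ is the
  difference quotient of $B$ between $cx$ and $x$, which tends to \<open>gen\<close> and is dominated uniformly
  in \<open>c\<close>. The limit integral is an iterate of $f \mapsto \frac{1}{(e^{2\pi i s}-1)\Gamma(s)}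
  \int_{\mathcal C} f(x+u) u^{s-1}\,du$ and of multiplication by \<open>gen\<close>. Each of these transforms may be
  replaced by $\frac{1}{\Gamma(s)} \int_0^\infty f(x+u) u^{s-1}\,du$ where the real part of \<open>s\<close> is positive, and
  the two forms together give the entire extension. At an integer $s = k$ the transform is $J^k$.
\<close>

section \<open>Decaying functions on half strips\<close>

text \<open>Two obstacles shape the proof. The empty word has the value 1, which does not decay, so
  integration to infinity cannot be applied to it; j and d may act only on nonempty words that end
  in y, and this is why \<open>Y1_space\<close> excludes the empty word. Secondly, no single path
  serves all integers: the ray integral diverges at 0 for Re s <= 0, while the contour coefficient
  contains \<open>Gamma (1 - s)\<close> with poles at s = 1, 2, .... So every variable has a path of
  its own, and the paths are changed one variable at a time. The constants fit together as follows.
  B has its nearest poles at +-2 pi i. The width 2 leaves room for the dilated points c w with c <=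
  5/4, which lie in the strip of width 5/2 < 2 pi. A contour of radius at most eta moves the
  argument by at most eta to the left or vertically, so r of them cost r eta of the width, and the
  radius 1/(r + 1) keeps 0 inside. All estimates use the decay rate 1/2; the rate 3/4 for B' is kept
  in reserve, because a dilation by c >= 3/4 reduces it to 9/16 at worst.\<close>

definition half_strip :: "real \<Rightarrow> complex set" where
  "half_strip b = {z. - b < Re z \<and> \<bar>Im z\<bar> < b}"

lemma half_strip_eq: "half_strip b = {z. Re z > - b} \<inter> {z. Im z < b} \<inter> {z. Im z > - b}"
  by (auto simp: half_strip_def)

lemma open_half_strip [simp, intro]: "open (half_strip b)"
  unfolding half_strip_eq
  by (intro open_Int open_halfspace_Re_gt open_halfspace_Im_gt open_halfspace_Im_lt)

lemma convex_half_strip [simp, intro]: "convex (half_strip b)"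
  unfolding half_strip_eq
  by (intro convex_Int convex_halfspace_Re_gt convex_halfspace_Im_gt convex_halfspace_Im_lt)

lemma half_strip_mono: "a \<le> b \<Longrightarrow> half_strip a \<subseteq> half_strip b"
  by (auto simp: half_strip_def)

lemma half_strip_add:
  "z \<in> half_strip a \<Longrightarrow> Re w \<ge> - b \<Longrightarrow> \<bar>Im w\<bar> \<le> b \<Longrightarrow> z + w \<in> half_strip (a + b)"
  by (auto simp: half_strip_def)

lemma half_strip_add_nonneg:
  "z \<in> half_strip b \<Longrightarrow> t \<ge> 0 \<Longrightarrow> z + of_real t \<in> half_strip b"
  by (auto simp: half_strip_def)

lemma cball_half_strip:
  assumes "z \<in> half_strip b" and "r \<ge> 0"
  shows "cball z r \<subseteq> half_strip (b + r)"
proof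
  fix w assume "w \<in> cball z r"
  then have "norm (w - z) \<le> r" by (simp add: dist_norm norm_minus_commute)
  then have "\<bar>Re (w - z)\<bar> \<le> r" "\<bar>Im (w - z)\<bar> \<le> r"
    using abs_Re_le_cmod [of "w - z"] abs_Im_le_cmod [of "w - z"] by linarith+
  then have "z + (w - z) \<in> half_strip (b + r)"
    using assms by (intro half_strip_add) auto
  then show "w \<in> half_strip (b + r)" by simp
qed

lemma half_strip_smaller:
  assumes "z \<in> half_strip b"
  obtains a where "a < b" "z \<in> half_strip a"
proof -
  have "- Re z < b" "\<bar>Im z\<bar> < b" using assms by (auto simp: half_strip_def)
  then obtain a where "max (- Re z) \<bar>Im z\<bar> < a" "a < b"
    using dense [of "max (- Re z) \<bar>Im z\<bar>" b] by auto
  then show ?thesis by (intro that [of a]) (auto simp: half_strip_def)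
qed

text \<open>A bound on every smaller half strip, rather than on \<open>half_strip b\<close> itself,
  keeps the class closed under \<open>deriv\<close>: Cauchy's estimate costs some width, and an
  arbitrarily small amount suffices. The rate 1/2 is one of the rates below 1, the rate at which
  z/(e^z - 1) decays up to a linear factor.\<close>

definition decays :: "real \<Rightarrow> (complex \<Rightarrow> complex) \<Rightarrow> bool" where
  "decays b f \<longleftrightarrow> f holomorphic_on half_strip b \<and>
     (\<forall>a<b. \<exists>C. \<forall>z\<in>half_strip a. norm (f z) \<le> C * exp (- Re z / 2))"

lemma decays_bound:
  assumes "decays b f" "a < b"
  obtains C where "C \<ge> 0" "\<And>z. z \<in> half_strip a \<Longrightarrow> norm (f z) \<le> C * exp (- Re z / 2)"
proof -
  obtain C where C: "\<forall>z\<in>half_strip a. norm (f z) \<le> C * exp (- Re z / 2)"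
    using assms by (auto simp: decays_def)
  have "norm (f z) \<le> max C 0 * exp (- Re z / 2)" if "z \<in> half_strip a" for z
    using C that by (smt (verit) exp_gt_zero mult_right_mono)
  then show ?thesis by (intro that [of "max C 0"]) auto
qed

lemma decays_mono: "decays b f \<Longrightarrow> a \<le> b \<Longrightarrow> decays a f"
  unfolding decays_def by (meson half_strip_mono holomorphic_on_subset order_less_le_trans)

lemma decays_cong: "(\<And>z. z \<in> half_strip b \<Longrightarrow> f z = g z) \<Longrightarrow> decays b f = decays b g"
  unfolding decays_def
  by (intro conj_cong holomorphic_cong refl all_cong ex_cong1 ball_cong)
    (simp_all add: subsetD [OF half_strip_mono [OF less_imp_le]])

lemma decays_0: "decays b (\<lambda>_. 0)"
  unfolding decays_def by (auto intro!: exI [of _ 0])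

lemma decays_add:
  assumes "decays b f" "decays b g"
  shows "decays b (\<lambda>z. f z + g z)"
  unfolding decays_def
proof (intro conjI allI impI)
  show "(\<lambda>z. f z + g z) holomorphic_on half_strip b"
    using assms by (auto simp: decays_def intro!: holomorphic_intros)
  fix a assume "a < b"
  obtain C where C: "C \<ge> 0" "\<And>z. z \<in> half_strip a \<Longrightarrow> norm (f z) \<le> C * exp (- Re z / 2)"
    using decays_bound assms(1) \<open>a < b\<close> by blast
  obtain C' where C': "C' \<ge> 0" "\<And>z. z \<in> half_strip a \<Longrightarrow> norm (g z) \<le> C' * exp (- Re z / 2)"
    using decays_bound assms(2) \<open>a < b\<close> by blast
  have "norm (f z + g z) \<le> (C + C') * exp (- Re z / 2)" if "z \<in> half_strip a" for z
    using norm_triangle_ineq [of "f z" "g z"] C(2) [OF that] C'(2) [OF that]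
    by (simp add: distrib_right)
  then show "\<exists>C. \<forall>z\<in>half_strip a. norm (f z + g z) \<le> C * exp (- Re z / 2)" by blast
qed

lemma decays_cmult:
  assumes "decays b f"
  shows "decays b (\<lambda>z. c * f z)"
  unfolding decays_def
proof (intro conjI allI impI)
  show "(\<lambda>z. c * f z) holomorphic_on half_strip b"
    using assms by (auto simp: decays_def intro!: holomorphic_intros)
  fix a assume "a < b"
  obtain C where C: "C \<ge> 0" "\<And>z. z \<in> half_strip a \<Longrightarrow> norm (f z) \<le> C * exp (- Re z / 2)"
    using decays_bound assms \<open>a < b\<close> by blast
  have "norm (c * f z) \<le> (norm c * C) * exp (- Re z / 2)" if "z \<in> half_strip a" for z
    using C(2) [OF that] by (simp add: norm_mult mult.assoc mult_left_mono)
  then show "\<exists>C. \<forall>z\<in>half_strip a. norm (c * f z) \<le> C * exp (- Re z / 2)" by blast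
qed

lemma decays_mult:
  assumes "decays b f" "decays b g"
  shows "decays b (\<lambda>z. f z * g z)"
  unfolding decays_def
proof (intro conjI allI impI)
  show "(\<lambda>z. f z * g z) holomorphic_on half_strip b"
    using assms by (auto simp: decays_def intro!: holomorphic_intros)
  fix a assume "a < b"
  obtain C where C: "C \<ge> 0" "\<And>z. z \<in> half_strip a \<Longrightarrow> norm (f z) \<le> C * exp (- Re z / 2)"
    using decays_bound assms(1) \<open>a < b\<close> by blast
  obtain C' where C': "C' \<ge> 0" "\<And>z. z \<in> half_strip a \<Longrightarrow> norm (g z) \<le> C' * exp (- Re z / 2)"
    using decays_bound assms(2) \<open>a < b\<close> by blast
  \<comment> \<open>The product decays at twice the rate; the surplus factor is bounded because Re z
    > - a.\<close>
  have "norm (f z * g z) \<le> (C * C' * exp (a / 2)) * exp (- Re z / 2)" if "z \<in> half_strip a" for z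
  proof -
    have "norm (f z * g z) \<le> (C * exp (- Re z / 2)) * (C' * exp (- Re z / 2))"
      unfolding norm_mult using C C' that by (intro mult_mono) auto
    also have "\<dots> = (C * C' * exp (- Re z / 2)) * exp (- Re z / 2)" by simp
    also have "\<dots> \<le> (C * C' * exp (a / 2)) * exp (- Re z / 2)"
      using C(1) C'(1) that by (intro mult_right_mono mult_left_mono) (auto simp: half_strip_def)
    finally show ?thesis .
  qed
  then show "\<exists>C. \<forall>z\<in>half_strip a. norm (f z * g z) \<le> C * exp (- Re z / 2)" by blast
qed

text \<open>Cauchy's estimate on circles of radius r = (b - a)/2, which stay in
  \<open>half_strip (a + r)\<close> with a + r < b. On such a circle exp(- Re w/2) exceeds its value
  at the centre by a factor of at most exp(r/2).\<close>

lemma decays_deriv: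
  assumes "decays b f"
  shows "decays b (deriv f)"
  unfolding decays_def
proof (intro conjI allI impI)
  have hol: "f holomorphic_on half_strip b" using assms by (simp add: decays_def)
  then show "deriv f holomorphic_on half_strip b" by (intro holomorphic_deriv) auto
  fix a assume "a < b"
  define r where "r = (b - a) / 2"
  have r: "r > 0" "a + r < b" using \<open>a < b\<close> by (auto simp: r_def field_simps)
  obtain C where C: "C \<ge> 0" "\<And>z. z \<in> half_strip (a + r) \<Longrightarrow> norm (f z) \<le> C * exp (- Re z / 2)"
    using decays_bound [OF assms r(2)] by blast
  have "norm (deriv f z) \<le> (C * exp (r / 2) / r) * exp (- Re z / 2)" if z: "z \<in> half_strip a" for z
  proof -
    have cb: "cball z r \<subseteq> half_strip (a + r)"
      using z r by (intro cball_half_strip) auto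
    have cb': "cball z r \<subseteq> half_strip b"
      using cb half_strip_mono [of "a + r" b] r by auto
    have "norm ((deriv ^^ 1) f z) \<le> fact 1 * (C * exp (r / 2) * exp (- Re z / 2)) / r ^ 1"
    proof (rule Cauchy_inequality)
      show "f holomorphic_on ball z r"
        using hol cb' ball_subset_cball holomorphic_on_subset by blast
      show "continuous_on (cball z r) f"
        using hol cb' holomorphic_on_imp_continuous_on continuous_on_subset by blast
      fix w assume w: "norm (z - w) = r"
      then have "w \<in> cball z r" by (simp add: dist_norm)
      then have "norm (f w) \<le> C * exp (- Re w / 2)" using C cb by blast
      also have "\<dots> \<le> C * exp (r / 2 - Re z / 2)"
        using C(1) abs_Re_le_cmod [of "z - w"] w by (intro mult_left_mono) auto
      finally show "norm (f w) \<le> C * exp (r / 2) * exp (- Re z / 2)"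
        by (simp add: mult.assoc flip: exp_add)
    qed (use r in auto)
    then show ?thesis by simp
  qed
  then show "\<exists>C. \<forall>z\<in>half_strip a. norm (deriv f z) \<le> C * exp (- Re z / 2)" by blast
qed

section \<open>The generating function\<close>

definition bern :: "complex \<Rightarrow> complex" where
  "bern z = (if z = 0 then 1 else z / (exp z - 1))"

lemma exp_neq_1: "\<bar>Im z\<bar> < 2 * pi \<Longrightarrow> z \<noteq> 0 \<Longrightarrow> exp z \<noteq> 1"
proof
  assume z: "\<bar>Im z\<bar> < 2 * pi" "z \<noteq> 0" "exp z = 1"
  then obtain n :: int where n: "Re z = 0" "Im z = of_int (2 * n) * pi"
    by (auto simp: exp_eq_1)
  then have "\<bar>of_int n :: real\<bar> * (2 * pi) < 1 * (2 * pi)" using z(1) by (simp add: abs_mult)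
  then have "\<bar>of_int n :: real\<bar> < 1" by (subst (asm) mult_less_cancel_right) auto
  then have "n = 0" by linarith
  then show False using n z(2) by (auto simp: complex_eq_iff)
qed

text \<open>The reciprocal (e^z - 1)/z has a removable singularity at 0 and no zeros for |Im z| < 2
  pi.\<close>

lemma bern_holomorphic: "bern holomorphic_on half_strip (2 * pi)"
proof -
  have [simp]: "deriv (\<lambda>z. exp z - 1) 0 = (1 :: complex)"
    by (rule DERIV_imp_deriv) (auto intro!: derivative_eq_intros)
  define q where "q z = (if z = 0 then 1 else (exp z - 1) / z)" for z :: complex
  have "q holomorphic_on UNIV"
    by (rule pole_theorem_open_0 [where a = 0 and g = "\<lambda>z. exp z - 1"])
      (auto intro!: holomorphic_intros simp: q_def)
  moreover have "q z \<noteq> 0" if "z \<in> half_strip (2 * pi)" for z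
    using exp_neq_1 [of z] that by (auto simp: q_def half_strip_def)
  ultimately have "(\<lambda>z. inverse (q z)) holomorphic_on half_strip (2 * pi)"
    by (intro holomorphic_intros) (auto intro: holomorphic_on_subset)
  then show ?thesis
    by (rule holomorphic_transform) (auto simp: q_def bern_def)
qed

text \<open>The weight e^(z/4) records that \<open>bern\<close> decays at rate 3/4; rate 1/2 alone
  would not survive the dilation of the argument in \<open>approx_bounded\<close>. Compactness
  settles Re z <= 1. Beyond it |e^z - 1| >= e^x/2, and |z| is paid for by another e^(x/4), which
  leaves the exponent 1/4 + 1/4 - 1 = -1/2.\<close>

lemma bern_weighted_decays: "decays (2 * pi) (\<lambda>z. exp (z / 4) * bern z)"
  unfolding decays_def
proof (intro conjI allI impI)
  show hol: "(\<lambda>z. exp (z / 4) * bern z) holomorphic_on half_strip (2 * pi)"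
    by (intro holomorphic_intros bern_holomorphic) auto
  fix a :: real assume a: "a < 2 * pi"
  let ?f = "\<lambda>z. exp (z / 4) * bern z"
  show "\<exists>C. \<forall>z\<in>half_strip a. norm (?f z) \<le> C * exp (- Re z / 2)"
  proof (cases "a > 0")
    case False
    then have "half_strip a = {}" by (auto simp: half_strip_def)
    then show ?thesis by auto
  next
    case True
    have sub: "cbox (Complex (- a) (- a)) (Complex 1 a) \<subseteq> half_strip (2 * pi)"
      using a True by (auto simp: half_strip_def in_cbox_complex_iff)
    have "bounded (?f ` cbox (Complex (- a) (- a)) (Complex 1 a))"
      by (intro compact_imp_bounded compact_continuous_image compact_cbox
          holomorphic_on_imp_continuous_on holomorphic_on_subset [OF hol sub])
    then obtain M where M: "\<And>z. z \<in> cbox (Complex (- a) (- a)) (Complex 1 a) \<Longrightarrow> norm (?f z) \<le> M"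
      unfolding bounded_iff by blast
    have "norm (?f z) \<le> max (M * exp (1 / 2)) (2 * (4 + a)) * exp (- Re z / 2)"
      if z: "z \<in> half_strip a" for z
    proof (cases "Re z \<le> 1")
      case True
      then have "z \<in> cbox (Complex (- a) (- a)) (Complex 1 a)"
        using z by (auto simp: half_strip_def in_cbox_complex_iff)
      then have *: "norm (?f z) \<le> M" by (rule M)
      then have "norm (?f z) \<le> M * 1" by simp
      also have "\<dots> \<le> M * (exp (1 / 2) * exp (- Re z / 2))"
        using True order_trans [OF norm_ge_zero *] by (intro mult_left_mono) (auto simp flip: exp_add)
      also have "\<dots> \<le> max (M * exp (1 / 2)) (2 * (4 + a)) * exp (- Re z / 2)"
        unfolding mult.assoc [symmetric] by (intro mult_right_mono) auto
      finally show ?thesis .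
    next
      case False
      define x where "x = Re z"
      have x: "x > 1" using False by (simp add: x_def)
      have "norm z \<le> x + a"
        using cmod_le [of z] z x by (auto simp: half_strip_def x_def)
      also have "\<dots> \<le> (4 + a) * exp (x / 4)"
      proof -
        have "x \<le> 4 * exp (x / 4)" using exp_ge_add_one_self [of "x / 4"] by linarith
        moreover have "a \<le> a * exp (x / 4)" using \<open>a > 0\<close> x by simp
        ultimately show ?thesis by (simp add: distrib_right)
      qed
      finally have nz: "norm z \<le> (4 + a) * exp (x / 4)" .
      have "exp x \<ge> 2" using exp_ge_add_one_self [of x] x by linarith
      then have den: "norm (exp z - 1) \<ge> exp x / 2"
        using norm_triangle_ineq2 [of "exp z" 1] by (simp add: x_def)
      have "norm (?f z) = exp (x / 4) * norm z / norm (exp z - 1)"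
        using False by (auto simp: bern_def norm_divide norm_mult x_def)
      also have "\<dots> \<le> (exp (x / 4) * ((4 + a) * exp (x / 4))) / (exp x / 2)"
        using nz den \<open>a > 0\<close> by (intro frac_le mult_left_mono) auto
      also have "\<dots> = (2 * (4 + a)) * exp (- x / 2)"
      proof -
        have "exp (x / 4) * exp (x / 4) / exp x = exp (- x / 2)"
          by (simp flip: exp_diff exp_add)
        moreover have "(u * (k * u)) / (E / 2) = (2 * k) * (u * u / E)" for u k E :: real
          by simp
        ultimately show ?thesis by (simp only:)
      qed
      also have "\<dots> \<le> max (M * exp (1 / 2)) (2 * (4 + a)) * exp (- x / 2)"
        by (intro mult_right_mono) auto
      finally show ?thesis by (simp add: x_def)
    qed
    then show ?thesis by blast
  qed
qed

lemma bern_decays: "decays (2 * pi) bern"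
proof -
  have "decays (2 * pi) (\<lambda>z. exp (z / 4) * bern z)" by (rule bern_weighted_decays)
  then have f: "\<forall>a<2 * pi. \<exists>C. \<forall>z\<in>half_strip a. norm (exp (z / 4) * bern z) \<le> C * exp (- Re z / 2)"
    by (simp add: decays_def)
  show ?thesis
    unfolding decays_def
  proof (intro conjI allI impI bern_holomorphic)
    fix a :: real assume "a < 2 * pi"
    then obtain C where C: "\<And>z. z \<in> half_strip a \<Longrightarrow> norm (exp (z / 4) * bern z) \<le> C * exp (- Re z / 2)"
      using f by blast
    have "norm (bern z) \<le> (exp (a / 4) * C) * exp (- Re z / 2)" if z: "z \<in> half_strip a" for z
    proof -
      have "norm (bern z) = exp (- Re z / 4) * norm (exp (z / 4) * bern z)"
        by (simp add: norm_mult exp_minus)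
      also have "\<dots> \<le> exp (a / 4) * (C * exp (- Re z / 2))"
        using z C [OF z] by (intro mult_mono) (auto simp: half_strip_def)
      finally show ?thesis by (simp add: mult.assoc)
    qed
    then show "\<exists>C. \<forall>z\<in>half_strip a. norm (bern z) \<le> C * exp (- Re z / 2)" by blast
  qed
qed

lemma deriv_bern:
  assumes "\<bar>Im z\<bar> < 2 * pi" "z \<noteq> 0"
  shows "deriv bern z = 1 / (exp z - 1) - z * exp z / (exp z - 1)\<^sup>2"
proof (rule DERIV_imp_deriv)
  have ne: "exp z - 1 \<noteq> 0" using exp_neq_1 assms by simp
  have "((\<lambda>z. z / (exp z - 1)) has_field_derivative 1 / (exp z - 1) - z * exp z / (exp z - 1)\<^sup>2) (at z)"
    using ne by (auto intro!: derivative_eq_intros simp: divide_simps power2_eq_square)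
  then show "(bern has_field_derivative 1 / (exp z - 1) - z * exp z / (exp z - 1)\<^sup>2) (at z)"
    by (rule has_field_derivative_transform_within_open [of _ _ _ "- {0}"])
      (use assms in \<open>auto simp: bern_def\<close>)
qed

text \<open>Cut off outside \<open>half_strip 2\<close> so that it is \<open>nice\<close> and
  identities between functions hold everywhere.\<close>

definition gen :: "complex \<Rightarrow> complex" where
  "gen z = (if z \<in> half_strip 2 then deriv bern z else 0)"

lemma two_less_2pi: "2 < 2 * pi"
  using pi_gt3 by simp

lemma gen_decays: "decays 2 gen"
proof -
  have "decays 2 (deriv bern)"
    using decays_deriv [OF bern_decays] two_less_2pi by (auto intro: decays_mono)
  then show ?thesis
    by (subst decays_cong [of _ _ "deriv bern"]) (auto simp: gen_def)
qed

text \<open>With e^z = 1/t the closed form of B' turns into \<open>Li_des0\<close>.\<close>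

lemma gen_Li_des0:
  assumes "0 < t" "t < 1"
  shows "gen (of_real (- ln t)) = of_real (Li_des0 t)"
proof -
  let ?z = "complex_of_real (- ln t)"
  have e: "exp ?z = of_real (1 / t)"
    unfolding exp_of_real using assms by (simp add: exp_minus inverse_eq_divide)
  have ln: "ln t < 0" using assms by simp
  have "gen ?z = deriv bern ?z"
    using ln by (auto simp: gen_def half_strip_def)
  also have "\<dots> = 1 / (exp ?z - 1) - ?z * exp ?z / (exp ?z - 1)\<^sup>2"
    using ln pi_gt_zero by (intro deriv_bern) auto
  also have "\<dots> = of_real (1 / (1 / t - 1) + ln t * (1 / t) / (1 / t - 1)\<^sup>2)"
    unfolding e by simp
  also have "1 / (1 / t - 1) + ln t * (1 / t) / (1 / t - 1)\<^sup>2 = Li_des0 t"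
  proof -
    have "1 / t - 1 = (1 - t) / t" using assms by (simp add: field_simps)
    then show ?thesis
      using assms by (simp add: Li_des0_def power2_eq_square divide_simps)
  qed
  finally show ?thesis .
qed

section \<open>Differentiation and integration of decaying functions\<close>

text \<open>Source of the integrable majorants below; the convergence is that of the Gamma
  integral.\<close>

lemma powr_exp_integrable:
  assumes "c > 0"
  shows "set_integrable lborel {0<..} (\<lambda>t::real. t powr (c - 1) * exp (- t / 2))"
proof -
  have "(\<lambda>t. complex_of_real t powr (of_real c - 1) / of_real (exp (1 / 2 * t))) absolutely_integrable_on {0<..}"
    using assms by (intro absolutely_integrable_Gamma_integral) auto
  then have "(\<lambda>t. norm (complex_of_real t powr (of_real c - 1) / of_real (exp (1 / 2 * t)))) absolutely_integrable_on {0<..}"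
    by (rule absolutely_integrable_norm [unfolded o_def])
  then have "(\<lambda>t::real. t powr (c - 1) * exp (- t / 2)) absolutely_integrable_on {0<..}"
    by (subst set_integrable_cong [OF refl refl, of _ _ "\<lambda>t. norm (complex_of_real t powr (of_real c - 1) / of_real (exp (1 / 2 * t)))"])
       (auto simp: norm_divide exp_minus field_simps norm_powr_real_powr)
  then show ?thesis
    unfolding set_integrable_def by (subst (asm) integrable_completion) auto
qed

lemma exp_half_integrable: "set_integrable lborel {0<..} (\<lambda>t::real. exp (- t / 2))"
proof -
  have "set_integrable lborel {0<..} (\<lambda>t::real. t powr (1 - 1) * exp (- t / 2))"
    by (rule powr_exp_integrable) simp
  then show ?thesis
    by (rule set_integrable_cong [OF refl refl, THEN iffD1, rotated]) simp
qed

lemma FTC_half_line: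
  fixes F f :: "real \<Rightarrow> complex"
  assumes "\<And>t. t > 0 \<Longrightarrow> (F has_vector_derivative f t) (at t)"
    and "\<And>t. t > 0 \<Longrightarrow> isCont f t"
    and "set_integrable lborel {0<..} f"
    and "(F \<longlongrightarrow> A) (at_right 0)" and "(F \<longlongrightarrow> B) at_top"
  shows "(LINT t:{0<..}|lborel. f t) = B - A"
proof -
  have "(LBINT x=ereal 0..\<infinity>. f x) = B - A"
    using assms
    by (intro interval_integral_FTC_integrable)
      (auto simp only: ereal_tendsto_simps einterval_eq zero_ereal_def less_ereal.simps)
  then show ?thesis
    by (simp add: interval_lebesgue_integral_def)
qed

lemma decays_line:
  assumes "decays b f" "z \<in> half_strip b"
  obtains C where "C \<ge> 0" "\<And>t. t \<ge> 0 \<Longrightarrow> norm (f (z + of_real t)) \<le> C * exp (- t / 2)"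
proof -
  obtain a where a: "a < b" "z \<in> half_strip a" using half_strip_smaller assms by blast
  obtain C where C: "C \<ge> 0" "\<And>z. z \<in> half_strip a \<Longrightarrow> norm (f z) \<le> C * exp (- Re z / 2)"
    using decays_bound assms a by blast
  have "norm (f (z + of_real t)) \<le> C * exp (- Re z / 2) * exp (- t / 2)" if "t \<ge> 0" for t
    using C(2) [OF half_strip_add_nonneg [OF a(2) that]]
    by (simp add: mult.assoc diff_divide_distrib flip: exp_add)
  then show ?thesis using C(1) by (intro that [of "C * exp (- Re z / 2)"]) auto
qed

lemma decays_tendsto_0:
  assumes "decays b f" "z \<in> half_strip b"
  shows "((\<lambda>t. f (z + of_real t)) \<longlongrightarrow> 0) at_top"
proof -
  obtain C where C: "C \<ge> 0" "\<And>t. t \<ge> 0 \<Longrightarrow> norm (f (z + of_real t)) \<le> C * exp (- t / 2)"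
    using decays_line assms by blast
  have "((\<lambda>t::real. C * exp (- t / 2)) \<longlongrightarrow> 0) at_top" by real_asymp
  then show ?thesis
    by (rule Lim_null_comparison [rotated])
      (use C in \<open>auto intro!: eventually_mono [OF eventually_ge_at_top [of 0]]\<close>)
qed

lemma has_vector_derivative_line:
  assumes "(F has_field_derivative F') (at (z + of_real t))"
  shows "((\<lambda>t. F (z + of_real t)) has_vector_derivative F') (at t)"
proof -
  have "((\<lambda>t. z + of_real t) has_vector_derivative 1) (at t)"
    by (auto intro!: derivative_eq_intros)
  from field_vector_diff_chain_at [OF this assms] show ?thesis
    by (simp add: o_def)
qed

lemma isCont_line:
  assumes "f holomorphic_on half_strip b" "z + of_real t \<in> half_strip b"
  shows "isCont (\<lambda>t. f (z + of_real t)) t"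
proof -
  have "isCont f (z + of_real t)"
    using holomorphic_on_imp_continuous_on [OF assms(1)] assms(2)
    by (simp add: continuous_on_eq_continuous_at)
  moreover have "isCont (\<lambda>t. z + of_real t) t" by (intro continuous_intros)
  ultimately show ?thesis by (rule isCont_o2 [rotated])
qed

lemma line_set_integrable:
  assumes "f holomorphic_on half_strip b" "z \<in> half_strip b"
    and "set_integrable lborel {0<..} h"
    and "\<And>t. t > 0 \<Longrightarrow> norm (f (z + of_real t) * k t) \<le> h t"
    and "k \<in> borel_measurable lborel"
  shows "set_integrable lborel {0<..} (\<lambda>t. f (z + of_real t) * k t)"
proof (rule set_integrable_bound [OF assms(3)])
  have "continuous_on {0<..} (\<lambda>t. f (z + of_real t))"
    using isCont_line [OF assms(1) half_strip_add_nonneg [OF assms(2)]]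
    by (intro continuous_at_imp_continuous_on) auto
  then have "set_borel_measurable lborel {0<..} (\<lambda>t. f (z + of_real t))"
    unfolding set_borel_measurable_def
    by (auto intro!: borel_measurable_continuous_on_indicator)
  then have "(\<lambda>t. (indicator {0<..} t *\<^sub>R f (z + of_real t)) * k t) \<in> borel_measurable lborel"
    unfolding set_borel_measurable_def using assms(5) by (intro borel_measurable_times)
  then show "set_borel_measurable lborel {0<..} (\<lambda>t. f (z + of_real t) * k t)"
    unfolding set_borel_measurable_def by (simp add: mult_scaleR_left)
  show "AE t in lborel. t \<in> {0<..} \<longrightarrow> norm (f (z + of_real t) * k t) \<le> norm (h t)"
    using assms(4) by (auto intro!: AE_I2 order_trans [OF _ abs_ge_self])
qed

lemma decays_line_integrable:
  assumes "decays b f" "z \<in> half_strip b"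
  shows "set_integrable lborel {0<..} (\<lambda>t. f (z + of_real t))"
proof -
  obtain C where C: "C \<ge> 0" "\<And>t. t \<ge> 0 \<Longrightarrow> norm (f (z + of_real t)) \<le> C * exp (- t / 2)"
    using decays_line assms by blast
  have "set_integrable lborel {0<..} (\<lambda>t. f (z + of_real t) * 1)"
  proof (rule line_set_integrable)
    show "f holomorphic_on half_strip b" using assms by (simp add: decays_def)
    show "set_integrable lborel {0<..} (\<lambda>t. C * exp (- t / 2))"
      by (rule set_integrable_mult_right) (rule exp_half_integrable)
    show "norm (f (z + of_real t) * 1) \<le> C * exp (- t / 2)" if "t > 0" for t
      using C(2) [of t] that by simp
  qed (use assms in auto)
  then show ?thesis by simp
qed

section \<open>Integration along horizontal rays as the inverse of minus the derivative\<close>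

definition J_fun :: "(complex \<Rightarrow> complex) \<Rightarrow> complex \<Rightarrow> complex" where
  "J_fun f z = (LINT t:{0<..}|lborel. f (z + of_real t))"

lemma J_fun_primitive:
  assumes f: "decays b f" and z: "z \<in> half_strip b"
    and F: "\<And>w. w \<in> half_strip b \<Longrightarrow> (F has_field_derivative f w) (at w)"
    and lim: "((\<lambda>t. F (z + of_real t)) \<longlongrightarrow> l) at_top"
  shows "J_fun f z = l - F z"
  unfolding J_fun_def
proof (rule FTC_half_line)
  have hol: "f holomorphic_on half_strip b" using f by (simp add: decays_def)
  show "((\<lambda>t. F (z + of_real t)) has_vector_derivative f (z + of_real t)) (at t)" if "t > 0" for t
    using F half_strip_add_nonneg [OF z] that by (intro has_vector_derivative_line) auto
  show "isCont (\<lambda>t. f (z + of_real t)) t" if "t > 0" for t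
    using that by (intro isCont_line [OF hol] half_strip_add_nonneg z) auto
  have "F holomorphic_on half_strip b"
    using F by (auto simp: holomorphic_on_open)
  then have "isCont (\<lambda>t. F (z + of_real t)) 0"
    using z by (intro isCont_line) auto
  then have "((\<lambda>t. F (z + of_real t)) \<longlongrightarrow> F (z + of_real 0)) (at 0)"
    unfolding isCont_def .
  then show "((\<lambda>t. F (z + of_real t)) \<longlongrightarrow> F z) (at_right 0)"
    by (auto simp: filterlim_at_split)
  show "set_integrable lborel {0<..} (\<lambda>t. f (z + of_real t))"
    by (rule decays_line_integrable [OF f z])
qed (fact lim)

text \<open>The point is that \<open>l\<close> is the same for all horizontal rays: the segment that
  joins two rays far to the right has fixed length, and f is exponentially small on it. Then
  \<open>J_fun f\<close> is l - F, and its derivative is found without differentiating under the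
  integral sign.\<close>

lemma decays_primitive:
  assumes f: "decays b f"
  obtains F l where
    "\<And>w. w \<in> half_strip b \<Longrightarrow> (F has_field_derivative f w) (at w)"
    "\<And>z. z \<in> half_strip b \<Longrightarrow> ((\<lambda>t. F (z + of_real t)) \<longlongrightarrow> l) at_top"
proof (cases "half_strip b = {}")
  case True
  then show ?thesis using that by blast
next
  case False
  then obtain z0 where z0: "z0 \<in> half_strip b" by blast
  have hol: "f holomorphic_on half_strip b" using f by (simp add: decays_def)
  obtain F where F': "\<And>w. w \<in> half_strip b \<Longrightarrow> (F has_field_derivative f w) (at w within half_strip b)"
    using holomorphic_convex_primitive' [OF convex_half_strip open_half_strip hol] by blast
  have F: "(F has_field_derivative f w) (at w)" if "w \<in> half_strip b" for w
    using F' [OF that] at_within_open [OF that open_half_strip] by simp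
  \<comment> \<open>Convergence along each ray follows from integrability; at this stage the limit
    may still depend on z.\<close>
  have conv: "((\<lambda>s. F (z + of_real s)) \<longlongrightarrow> J_fun f z + F z) at_top" if z: "z \<in> half_strip b" for z
  proof -
    have int: "(LINT t:{0<..s}|lborel. f (z + of_real t)) = F (z + of_real s) - F z" if "s \<ge> 0" for s
    proof -
      have "(LBINT t=ereal 0..ereal s. f (z + of_real t)) = F (z + of_real s) - F (z + of_real 0)"
      proof (rule interval_integral_FTC_finite)
        show "continuous_on {min 0 s..max 0 s} (\<lambda>t. f (z + of_real t))"
          using that isCont_line [OF hol half_strip_add_nonneg [OF z]]
          by (simp add: continuous_at_imp_continuous_on)
        fix t assume "min 0 s \<le> t"
        then have "(F has_field_derivative f (z + of_real t)) (at (z + of_real t))"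
          using that by (intro F half_strip_add_nonneg z) auto
        then show "((\<lambda>t. F (z + of_real t)) has_vector_derivative f (z + of_real t)) (at t within {min 0 s..max 0 s})"
          by (rule has_vector_derivative_at_within [OF has_vector_derivative_line])
      qed
      then show ?thesis using that by (subst (asm) interval_integral_Ioc) auto
    qed
    have "((\<lambda>s. LINT t|lborel. indicator {..s} t *\<^sub>R (indicator {0<..} t *\<^sub>R f (z + of_real t)))
        \<longlongrightarrow> J_fun f z) at_top"
      unfolding J_fun_def set_lebesgue_integral_def
      using decays_line_integrable [OF f z]
      by (intro tendsto_integral_at_top) (auto simp: set_integrable_def)
    moreover have "eventually (\<lambda>s. (LINT t|lborel. indicator {..s} t *\<^sub>R (indicator {0<..} t *\<^sub>R f (z + of_real t)))
        = F (z + of_real s) - F z) at_top"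
      using eventually_ge_at_top [of 0]
    proof eventually_elim
      case (elim s)
      have "(LINT t|lborel. indicator {..s} t *\<^sub>R (indicator {0<..} t *\<^sub>R f (z + of_real t)))
          = (LINT t:{0<..s}|lborel. f (z + of_real t))"
        unfolding set_lebesgue_integral_def
        by (intro Bochner_Integration.integral_cong) (auto split: split_indicator)
      then show ?case using int [OF elim] by simp
    qed
    ultimately have "((\<lambda>s. F (z + of_real s) - F z) \<longlongrightarrow> J_fun f z) at_top"
      by (rule Lim_transform_eventually)
    from tendsto_add [OF this tendsto_const [of "F z"]] show ?thesis by simp
  qed
  have same: "((\<lambda>t. F (z + of_real t)) \<longlongrightarrow> J_fun f z0 + F z0) at_top" if z: "z \<in> half_strip b" for z
  proof -
    obtain a1 a2 where a12: "a1 < b" "z \<in> half_strip a1" "a2 < b" "z0 \<in> half_strip a2"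
      using half_strip_smaller z z0 by metis
    define a where "a = max a1 a2"
    have a: "a < b" "z \<in> half_strip a" "z0 \<in> half_strip a"
      using a12 half_strip_mono [of a1 a] half_strip_mono [of a2 a] by (auto simp: a_def)
    obtain C where C: "C \<ge> 0" "\<And>z. z \<in> half_strip a \<Longrightarrow> norm (f z) \<le> C * exp (- Re z / 2)"
      using decays_bound [OF f a(1)] by blast
    have bd: "norm (F (z + of_real t) - F (z0 + of_real t)) \<le> C * exp (a / 2 - t / 2) * norm (z - z0)"
      if "t \<ge> 0" for t
    proof -
      \<comment> \<open>This convex set contains z + t and z0 + t, because z and z0 have real parts
        above - a, and |f| <= C exp((a - t)/2) holds on it.\<close>
      define A where "A = half_strip a \<inter> {w. Re w > t - a}"
      have "norm (F (z + of_real t) - F (z0 + of_real t))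
          \<le> C * exp (a / 2 - t / 2) * norm (z + of_real t - (z0 + of_real t))"
      proof (rule field_differentiable_bound [of A F f])
        show "convex A" unfolding A_def by (intro convex_Int convex_halfspace_Re_gt) auto
        fix w assume w: "w \<in> A"
        then have "w \<in> half_strip b" using half_strip_mono [of a b] a by (auto simp: A_def)
        then show "(F has_field_derivative f w) (at w within A)"
          using F has_field_derivative_at_within by blast
        have "norm (f w) \<le> C * exp (- Re w / 2)" using C w by (auto simp: A_def)
        also have "\<dots> \<le> C * exp (a / 2 - t / 2)"
          using C(1) w by (intro mult_left_mono) (auto simp: A_def field_simps)
        finally show "norm (f w) \<le> C * exp (a / 2 - t / 2)" .
      qed (use a half_strip_add_nonneg that in \<open>auto simp: A_def half_strip_def\<close>)
      then show ?thesis by simp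
    qed
    have "((\<lambda>t::real. C * exp (a / 2 - t / 2) * norm (z - z0)) \<longlongrightarrow> 0) at_top" by real_asymp
    then have "((\<lambda>t. F (z + of_real t) - F (z0 + of_real t)) \<longlongrightarrow> 0) at_top"
      by (rule Lim_null_comparison [rotated])
        (use bd in \<open>auto intro!: eventually_mono [OF eventually_ge_at_top [of 0]]\<close>)
    from tendsto_add [OF this conv [OF z0]] show ?thesis by simp
  qed
  show ?thesis
    using that F same by blast
qed

lemma J_fun_has_derivative:
  assumes f: "decays b f" and z: "z \<in> half_strip b"
  shows "(J_fun f has_field_derivative - f z) (at z)"
proof -
  obtain F l where F: "\<And>w. w \<in> half_strip b \<Longrightarrow> (F has_field_derivative f w) (at w)"
    and l: "\<And>z. z \<in> half_strip b \<Longrightarrow> ((\<lambda>t. F (z + of_real t)) \<longlongrightarrow> l) at_top"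
    using decays_primitive [OF f] by blast
  have "((\<lambda>w. l - F w) has_field_derivative - f z) (at z)"
    using F z by (auto intro!: derivative_eq_intros)
  then show ?thesis
    by (rule has_field_derivative_transform_within_open [of _ _ _ "half_strip b"])
      (use J_fun_primitive [OF f _ F l] z in auto)
qed

lemma J_fun_decays:
  assumes f: "decays b f"
  shows "decays b (J_fun f)"
  unfolding decays_def
proof (intro conjI allI impI)
  show "J_fun f holomorphic_on half_strip b"
    using J_fun_has_derivative [OF f] by (auto simp: holomorphic_on_open)
  fix a assume "a < b"
  obtain C where C: "C \<ge> 0" "\<And>z. z \<in> half_strip a \<Longrightarrow> norm (f z) \<le> C * exp (- Re z / 2)"
    using decays_bound [OF f \<open>a < b\<close>] by blast
  define K where "K = (LINT t:{0<..}|lborel. exp (- t / 2 :: real))"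
  have "norm (J_fun f z) \<le> (C * K) * exp (- Re z / 2)" if z: "z \<in> half_strip a" for z
  proof -
    have "z \<in> half_strip b" using z half_strip_mono [of a b] \<open>a < b\<close> by auto
    then have int: "set_integrable lborel {0<..} (\<lambda>t. f (z + of_real t))"
      using f decays_line_integrable by blast
    have "norm (J_fun f z) \<le> (LINT t:{0<..}|lborel. norm (f (z + of_real t)))"
      unfolding J_fun_def using set_integral_norm_bound [OF int] .
    also have "\<dots> \<le> (LINT t:{0<..}|lborel. C * exp (- Re z / 2) * exp (- t / 2))"
    proof (rule set_integral_mono)
      show "set_integrable lborel {0<..} (\<lambda>t. C * exp (- Re z / 2) * exp (- t / 2))"
        by (rule set_integrable_mult_right) (rule exp_half_integrable)
      show "set_integrable lborel {0<..} (\<lambda>t. norm (f (z + of_real t)))"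
        using int by (rule set_integrable_norm)
      fix t :: real assume "t \<in> {0<..}"
      then show "norm (f (z + of_real t)) \<le> C * exp (- Re z / 2) * exp (- t / 2)"
        using C(2) [OF half_strip_add_nonneg [OF z, of t]]
        by (simp add: mult.assoc diff_divide_distrib flip: exp_add)
    qed
    also have "\<dots> = C * exp (- Re z / 2) * K" by (simp add: K_def)
    finally show ?thesis by (simp add: mult_ac)
  qed
  then show "\<exists>C. \<forall>z\<in>half_strip a. norm (J_fun f z) \<le> C * exp (- Re z / 2)" by blast
qed

text \<open>The primitive - f tends to 0 along the ray, so no constant of integration
  survives.\<close>

lemma J_fun_deriv:
  assumes f: "decays b f" and z: "z \<in> half_strip b"
  shows "J_fun (\<lambda>w. - deriv f w) z = f z"
proof -
  have "J_fun (\<lambda>w. - deriv f w) z = 0 - (\<lambda>w. - f w) z"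
  proof (rule J_fun_primitive [OF _ z])
    show "decays b (\<lambda>w. - deriv f w)"
      using decays_cmult [OF decays_deriv [OF f], of "- 1"] by simp
    show "((\<lambda>w. - f w) has_field_derivative - deriv f w) (at w)" if "w \<in> half_strip b" for w
      using f that by (intro DERIV_minus holomorphic_derivI [OF _ open_half_strip]) (auto simp: decays_def)
    show "((\<lambda>t. - f (z + of_real t)) \<longlongrightarrow> 0) at_top"
      using tendsto_minus [OF decays_tendsto_0 [OF f z]] by simp
  qed
  then show ?thesis by simp
qed

section \<open>The action of words on functions\<close>

text \<open>Vanishing outside the half strip makes such a function determined by its values inside,
  so that \<open>D_I\<close>, \<open>I_D\<close> and the Leibniz rule become equations of functions
  without side conditions on the argument.\<close>

definition nice :: "(complex \<Rightarrow> complex) \<Rightarrow> bool" where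
  "nice f \<longleftrightarrow> decays 2 f \<and> (\<forall>z. z \<notin> half_strip 2 \<longrightarrow> f z = 0)"

definition D_fun :: "(complex \<Rightarrow> complex) \<Rightarrow> complex \<Rightarrow> complex" where
  "D_fun f z = (if z \<in> half_strip 2 then - deriv f z else 0)"

definition I_fun :: "(complex \<Rightarrow> complex) \<Rightarrow> complex \<Rightarrow> complex" where
  "I_fun f z = (if z \<in> half_strip 2 then J_fun f z else 0)"

definition I_pow :: "int \<Rightarrow> (complex \<Rightarrow> complex) \<Rightarrow> complex \<Rightarrow> complex" where
  "I_pow k = (if k \<ge> 0 then I_fun ^^ nat k else D_fun ^^ nat (- k))"

lemma nice_gen: "nice gen"
  using gen_decays by (simp add: nice_def gen_def)

lemma nice_0: "nice (\<lambda>_. 0)"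
  by (simp add: nice_def decays_0)

lemma nice_add: "nice f \<Longrightarrow> nice g \<Longrightarrow> nice (\<lambda>z. f z + g z)"
  by (simp add: nice_def decays_add)

lemma nice_cmult: "nice f \<Longrightarrow> nice (\<lambda>z. c * f z)"
  by (simp add: nice_def decays_cmult)

lemma nice_mult: "nice f \<Longrightarrow> nice g \<Longrightarrow> nice (\<lambda>z. f z * g z)"
  by (simp add: nice_def decays_mult)

lemma nice_has_derivative:
  "nice f \<Longrightarrow> z \<in> half_strip 2 \<Longrightarrow> (f has_field_derivative - D_fun f z) (at z)"
  by (auto simp: nice_def decays_def D_fun_def intro: holomorphic_derivI [OF _ open_half_strip])

lemma D_fun_eqI:
  "z \<in> half_strip 2 \<Longrightarrow> (f has_field_derivative - d) (at z) \<Longrightarrow> D_fun f z = d"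
  by (simp add: D_fun_def DERIV_imp_deriv)

lemma nice_D: "nice f \<Longrightarrow> nice (D_fun f)"
  unfolding nice_def
  using decays_cmult [OF decays_deriv [of 2 f], of "- 1"]
  by (auto simp: D_fun_def cong: decays_cong)

lemma nice_I: "nice f \<Longrightarrow> nice (I_fun f)"
  unfolding nice_def using J_fun_decays [of 2 f]
  by (auto simp: I_fun_def cong: decays_cong)

lemma D_I: "nice f \<Longrightarrow> D_fun (I_fun f) = f"
proof
  fix z assume f: "nice f"
  show "D_fun (I_fun f) z = f z"
  proof (cases "z \<in> half_strip 2")
    case True
    have "(J_fun f has_field_derivative - f z) (at z)"
      using f J_fun_has_derivative [OF _ True] by (simp add: nice_def)
    then have "(I_fun f has_field_derivative - f z) (at z)"
      by (rule has_field_derivative_transform_within_open [OF _ open_half_strip True])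
        (simp add: I_fun_def)
    then show ?thesis by (rule D_fun_eqI [OF True])
  next
    case False
    then show ?thesis using f by (simp add: D_fun_def nice_def)
  qed
qed

lemma J_fun_cong:
  assumes "\<And>w. w \<in> half_strip b \<Longrightarrow> f w = g w" "z \<in> half_strip b"
  shows "J_fun f z = J_fun g z"
  unfolding J_fun_def using assms half_strip_add_nonneg
  by (intro set_lebesgue_integral_cong) auto

lemma I_D: "nice f \<Longrightarrow> I_fun (D_fun f) = f"
proof
  fix z assume f: "nice f"
  show "I_fun (D_fun f) z = f z"
  proof (cases "z \<in> half_strip 2")
    case True
    then have "J_fun (D_fun f) z = J_fun (\<lambda>w. - deriv f w) z"
      by (intro J_fun_cong [where b = 2]) (auto simp: D_fun_def)
    then show ?thesis
      using f True J_fun_deriv [OF _ True] by (simp add: I_fun_def nice_def)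
  next
    case False
    then show ?thesis using f by (simp add: I_fun_def nice_def)
  qed
qed

lemma D_mult:
  assumes "nice f" "nice g"
  shows "D_fun (\<lambda>z. f z * g z) = (\<lambda>z. D_fun f z * g z + f z * D_fun g z)"
proof
  fix z
  show "D_fun (\<lambda>z. f z * g z) z = D_fun f z * g z + f z * D_fun g z"
  proof (cases "z \<in> half_strip 2")
    case True
    then show ?thesis
      using DERIV_mult [OF nice_has_derivative nice_has_derivative, OF assms(1) _ assms(2)]
      by (intro D_fun_eqI) (auto simp: algebra_simps)
  qed (simp add: D_fun_def)
qed

lemma D_add:
  assumes "nice f" "nice g"
  shows "D_fun (\<lambda>z. f z + g z) = (\<lambda>z. D_fun f z + D_fun g z)"
proof
  fix z
  show "D_fun (\<lambda>z. f z + g z) z = D_fun f z + D_fun g z"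
  proof (cases "z \<in> half_strip 2")
    case True
    then show ?thesis
      using DERIV_add [OF nice_has_derivative nice_has_derivative, OF assms(1) _ assms(2)]
      by (intro D_fun_eqI) auto
  qed (simp add: D_fun_def)
qed

lemma D_cmult:
  assumes "nice f"
  shows "D_fun (\<lambda>z. c * f z) = (\<lambda>z. c * D_fun f z)"
proof
  fix z
  show "D_fun (\<lambda>z. c * f z) z = c * D_fun f z"
  proof (cases "z \<in> half_strip 2")
    case True
    then show ?thesis
      using DERIV_cmult [OF nice_has_derivative, OF assms(1)]
      by (intro D_fun_eqI) auto
  qed (simp add: D_fun_def)
qed

lemma D_inj: "nice f \<Longrightarrow> nice g \<Longrightarrow> D_fun f = D_fun g \<Longrightarrow> f = g"
  by (metis I_D)

text \<open>Linearity is transferred from \<open>D_fun\<close>, which is injective on nice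
  functions.\<close>

lemma I_add:
  assumes "nice f" "nice g"
  shows "I_fun (\<lambda>z. f z + g z) = (\<lambda>z. I_fun f z + I_fun g z)"
  by (rule D_inj) (simp_all add: D_I D_add nice_add nice_I assms)

lemma I_cmult:
  assumes "nice f"
  shows "I_fun (\<lambda>z. c * f z) = (\<lambda>z. c * I_fun f z)"
  by (rule D_inj) (simp_all add: D_I D_cmult nice_cmult nice_I assms)

lemma I_pow_0 [simp]: "I_pow 0 f = f"
  by (simp add: I_pow_def)

lemma I_pow_1: "I_pow 1 f = I_fun f" and I_pow_m1: "I_pow (- 1) f = D_fun f"
  by (simp_all add: I_pow_def)

lemma nice_I_pow:
  assumes "nice f"
  shows "nice (I_pow k f)"
proof -
  have "nice ((I_fun ^^ n) f)" "nice ((D_fun ^^ n) f)" for n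
    by (induction n) (use assms in \<open>auto intro: nice_I nice_D\<close>)
  then show ?thesis by (simp add: I_pow_def)
qed

lemma I_pow_I:
  assumes "nice f"
  shows "I_pow (k + 1) f = I_fun (I_pow k f)"
proof (cases "k \<ge> 0")
  case True
  then have "nat (k + 1) = Suc (nat k)" by simp
  then show ?thesis using True by (simp add: I_pow_def)
next
  case False
  then obtain n where n: "nat (- k) = Suc n" by (cases "nat (- k)") auto
  have "nice ((D_fun ^^ n) f)"
    by (induction n) (use assms in \<open>auto intro: nice_D\<close>)
  moreover have "k = - int (Suc n)" using n False by linarith
  ultimately show ?thesis
    by (cases n) (auto simp: I_pow_def I_D nat_add_distrib)
qed

lemma I_pow_D:
  assumes "nice f"
  shows "I_pow (k - 1) f = D_fun (I_pow k f)"
  using I_pow_I [OF assms, of "k - 1"] D_I [OF nice_I_pow [OF assms]] by simp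

text \<open>The operator form of dj = jd = 1: exponents of adjacent powers add up even when their
  signs differ.\<close>

lemma I_pow_add:
  assumes "nice f"
  shows "I_pow (a + b) f = I_pow a (I_pow b f)"
proof (induction a rule: int_induct [where k = 0])
  case (step1 i)
  then show ?case
    using I_pow_I [OF assms, of "i + b"] I_pow_I [OF nice_I_pow [OF assms], of i b]
    by (simp add: ac_simps)
next
  case (step2 i)
  then show ?case
    using I_pow_D [OF assms, of "i + b"] I_pow_D [OF nice_I_pow [OF assms], of i b]
    by (simp add: algebra_simps)
qed simp

lemma I_pow_plus:
  assumes "nice f" "nice g"
  shows "I_pow k (\<lambda>z. f z + g z) = (\<lambda>z. I_pow k f z + I_pow k g z)"
proof (induction k rule: int_induct [where k = 0])
  case (step1 i)
  then show ?case
    by (simp add: I_pow_I assms nice_add I_add nice_I_pow)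
next
  case (step2 i)
  then show ?case
    by (simp add: I_pow_D assms nice_add D_add nice_I_pow)
qed simp

lemma I_pow_cmult:
  assumes "nice f"
  shows "I_pow k (\<lambda>z. c * f z) = (\<lambda>z. c * I_pow k f z)"
proof (induction k rule: int_induct [where k = 0])
  case (step1 i)
  then show ?case
    by (simp add: I_pow_I assms nice_cmult I_cmult nice_I_pow)
next
  case (step2 i)
  then show ?case
    by (simp add: I_pow_D assms nice_cmult D_cmult nice_I_pow)
qed simp

text \<open>The value on \<open>JPow k\<close> is junk unless \<open>k = 0\<close>: only words ending in y act on the function 1.\<close>

fun val :: "word \<Rightarrow> complex \<Rightarrow> complex" where
  "val (JPow k) = (\<lambda>_. 1)"
| "val (JPowY k w) = I_pow k (\<lambda>z. gen z * val w z)"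

lemma nice_gen_val: "nice (\<lambda>z. gen z * val w z)"
proof (induction w)
  case (JPow k)
  then show ?case by (simp add: nice_gen)
next
  case (JPowY k w)
  then show ?case by (auto intro: nice_mult nice_gen nice_I_pow)
qed

lemma nonempty_Y: "last_exp w = 0 \<Longrightarrow> w \<noteq> 0 \<Longrightarrow> \<exists>k v. w = JPowY k v"
  by (cases w) (auto simp: zero_word_def)

lemma nice_val: "last_exp w = 0 \<Longrightarrow> w \<noteq> 0 \<Longrightarrow> nice (val w)"
  using nonempty_Y [of w] nice_I_pow [OF nice_gen_val] by auto

lemma val_JPow_add: "last_exp w = 0 \<Longrightarrow> w \<noteq> 0 \<Longrightarrow> val (JPow k + w) = I_pow k (val w)"
  using nonempty_Y [of w] by (auto simp: I_pow_add nice_gen_val)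

lemma val_Y_add: "val (letter_word Y + w) = (\<lambda>z. gen z * val w z)"
  by simp

lemma val_0 [simp]: "val 0 = (\<lambda>_. 1)"
  by (simp add: zero_word_def)

section \<open>Linear extension of the action to the whole algebra\<close>

definition valq :: "qdjy \<Rightarrow> complex \<Rightarrow> complex" where
  "valq a z = (\<Sum>w\<in>Poly_Mapping.keys a. of_rat (Poly_Mapping.lookup a w) * val w z)"

lemma valq_superset:
  assumes "finite S" "Poly_Mapping.keys a \<subseteq> S"
  shows "valq a z = (\<Sum>w\<in>S. of_rat (Poly_Mapping.lookup a w) * val w z)"
  unfolding valq_def using assms
  by (intro sum.mono_neutral_left) (auto simp: in_keys_iff)

lemma valq_add: "valq (a + b) z = valq a z + valq b z"
proof -
  define S where "S = Poly_Mapping.keys a \<union> Poly_Mapping.keys b"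
  have S: "finite S" "Poly_Mapping.keys a \<subseteq> S" "Poly_Mapping.keys b \<subseteq> S" "Poly_Mapping.keys (a + b) \<subseteq> S"
    using Poly_Mapping.keys_add [of a b] by (auto simp: S_def)
  then show ?thesis
    by (simp add: valq_superset [of S] lookup_add of_rat_add distrib_right sum.distrib)
qed

lemma valq_scale: "valq (qscale c a) z = of_rat c * valq a z"
  by (simp add: valq_superset [OF _ keys_qscale] valq_superset [of "Poly_Mapping.keys a" a]
      lookup_qscale of_rat_mult sum_distrib_left mult.assoc)

lemma valq_mon [simp]: "valq (mon w) = val w"
  by (rule ext) (simp add: valq_def mon_def)

lemma valq_0 [simp]: "valq 0 z = 0"
  by (simp add: valq_def)

lemma valq_diff: "valq (a - b) z = valq a z - valq b z"
  using valq_add [of "a - b" b z] by simp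

text \<open>Restricted to \<open>Y1_space\<close> because the empty word has the constant value 1,
  which cannot be integrated to infinity. Niceness is carried through the induction since the
  linearity of \<open>I_pow\<close> depends on it.\<close>

lemma valq_JPow_mult:
  assumes "a \<in> Y1_space"
  shows "nice (valq a) \<and> valq (mon (JPow k) * a) = I_pow k (valq a)"
  using assms unfolding Y1_space_def
proof (induction rule: qdjy.span_induct_alt)
  case base
  have "I_pow k (\<lambda>_. 0) = (\<lambda>_. 0)"
    using I_pow_cmult [OF nice_0, of k 0] by simp
  moreover have "valq 0 = (\<lambda>_. 0)" by (rule ext) simp
  ultimately show ?case using nice_0 by simp
next
  case (step c x y)
  then obtain w where w: "x = mon w" "last_exp w = 0" "w \<noteq> 0" by blast
  have nx: "nice (val w)" using nice_val w by blast
  have eq: "valq (qscale c x + y) = (\<lambda>z. of_rat c * val w z + valq y z)"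
    by (rule ext) (simp add: valq_add valq_scale w)
  have "valq (mon (JPow k) * (qscale c x + y)) = (\<lambda>z. of_rat c * I_pow k (val w) z + I_pow k (valq y) z)"
  proof (rule ext)
    fix z
    have "mon (JPow k) * (qscale c x + y) = qscale c (mon (JPow k + w)) + mon (JPow k) * y"
      by (simp only: distrib_left mon_mult_qscale w mon_add)
    then show "valq (mon (JPow k) * (qscale c x + y)) z = of_rat c * I_pow k (val w) z + I_pow k (valq y) z"
      using step w by (simp add: valq_add valq_scale val_JPow_add)
  qed
  moreover have "I_pow k (\<lambda>z. of_rat c * val w z + valq y z)
      = (\<lambda>z. of_rat c * I_pow k (val w) z + I_pow k (valq y) z)"
    using nx step by (simp add: I_pow_plus nice_cmult I_pow_cmult)
  ultimately show ?case
    unfolding eq using nx step by (auto intro: nice_add nice_cmult)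
qed

lemma valq_Y_mult: "valq (letter_mon Y * a) z = gen z * valq a z"
proof -
  have *: "valq (letter_mon Y * (\<Sum>w\<in>S. qscale (f w) (mon w))) z
      = gen z * valq (\<Sum>w\<in>S. qscale (f w) (mon w)) z" if "finite S" for S f
    using that
  proof induction
    case (insert x F)
    have "letter_mon Y * (\<Sum>w\<in>insert x F. qscale (f w) (mon w))
        = qscale (f x) (mon (letter_word Y + x)) + letter_mon Y * (\<Sum>w\<in>F. qscale (f w) (mon w))"
      by (simp only: sum.insert insert.hyps distrib_left mon_mult_qscale mon_add not_False_eq_True)
    then have "valq (letter_mon Y * (\<Sum>w\<in>insert x F. qscale (f w) (mon w))) z
        = of_rat (f x) * val (letter_word Y + x) z + gen z * valq (\<Sum>w\<in>F. qscale (f w) (mon w)) z"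
      using insert.IH by (simp only: valq_add valq_scale valq_mon)
    then show ?case
      using insert.hyps by (simp only: val_Y_add sum.insert valq_add valq_scale valq_mon not_False_eq_True)
        (simp add: algebra_simps)
  qed simp
  have "a = (\<Sum>w\<in>Poly_Mapping.keys a. qscale (Poly_Mapping.lookup a w) (mon w))"
    using mon_expand [of a] by (simp add: lin_ext_def)
  then show ?thesis using * [OF finite_keys, of "Poly_Mapping.lookup a" a] by metis
qed

section \<open>Values of the product\<close>

text \<open>Each rule of the product is a form of the Leibniz rule: the rules with a d are D(fg) =
  (Df)g + f(Dg) solved for one term, the rule for two j is its integrated form, and y is
  multiplication by \<open>gen\<close>. The induction follows the termination measure of
  \<open>sha_word\<close>; in the rule for two d the total length is kept and only the first word
  gets shorter.\<close>

lemma valq_sha_word: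
  "last_exp u = 0 \<Longrightarrow> last_exp v = 0 \<Longrightarrow> valq (sha_word u v) = (\<lambda>z. val u z * val v z)"
proof (induction "(u, v)" arbitrary: u v
    rule: wf_induct_rule [OF wf_measures [of "[\<lambda>(u, v). word_length u + word_length v, \<lambda>(u, v). word_length u]"]])
  case 1
  have IH: "valq (sha_word u' v') = (\<lambda>z. val u' z * val v' z)"
    if "word_length u' + word_length v' < word_length u + word_length v \<or>
      word_length u' + word_length v' = word_length u + word_length v \<and> word_length u' < word_length u"
      "last_exp u' = 0" "last_exp v' = 0" for u' v'
    using 1(1) [of u' v'] that by simp
  show ?case
  proof (cases "u = 0 \<or> v = 0")
    case True
    then show ?thesis by auto
  next
    case False
    then obtain l m where lm: "first_letter u = Some l" "first_letter v = Some m"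
      using first_letter_None by (metis option.exhaust)
    have ru: "last_exp (rest u) = 0" "l \<noteq> Y \<Longrightarrow> rest u \<noteq> 0" "word_length u = Suc (word_length (rest u))"
      "u = letter_word l + rest u"
      using last_exp_rest rest_nonempty word_length_rest first_letter_rest lm 1 by metis+
    have rv: "last_exp (rest v) = 0" "m \<noteq> Y \<Longrightarrow> rest v \<noteq> 0" "word_length v = Suc (word_length (rest v))"
      "v = letter_word m + rest v"
      using last_exp_rest rest_nonempty word_length_rest first_letter_rest lm 1 by metis+
    have dv: "last_exp (letter_word D + v) = 0" "letter_word D + v \<noteq> 0"
      using last_exp_add [of v "letter_word D"] False 1 by blast+
    have rest_left: "valq (sha_word (rest u) v) = (\<lambda>z. val (rest u) z * val v z)"
      using 1 ru by (intro IH) auto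
    have rest_right: "valq (sha_word u (rest v)) = (\<lambda>z. val u z * val (rest v) z)"
      using 1 rv by (intro IH) auto
    have rest_both: "valq (sha_word (rest u) (rest v)) = (\<lambda>z. val (rest u) z * val (rest v) z)"
      using 1 ru rv by (intro IH) auto
    have rest_D: "valq (sha_word (rest u) (letter_word D + v))
        = (\<lambda>z. val (rest u) z * val (letter_word D + v) z)" if "m = D"
      using that 1 ru dv lm word_length_D_rest [of v] by (intro IH) auto
    have nu: "nice (val u)" and nv: "nice (val v)"
      using nice_val False 1 by blast+
    have nru: "l \<noteq> Y \<Longrightarrow> nice (val (rest u))" and nrv: "m \<noteq> Y \<Longrightarrow> nice (val (rest v))"
      using nice_val ru rv by blast+
    have Y1: "sha_word (rest u) v \<in> Y1_space" "sha_word u (rest v) \<in> Y1_space"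
      using sha_word_in_Y1 False 1 ru rv by blast+
    have D_val: "val (letter_word D + v) = D_fun (val v)"
      using val_JPow_add [of v "- 1"] False 1 by (simp add: I_pow_m1)
    have J1: "valq (letter_mon J * a) = I_fun (valq a)" and D1: "valq (letter_mon D * a) = D_fun (valq a)"
      if "a \<in> Y1_space" for a
      using valq_JPow_mult [OF that, of 1] valq_JPow_mult [OF that, of "- 1"]
      by (simp_all add: I_pow_1 I_pow_m1)
    have uJ: "val u = I_fun (val (rest u))" if "l = J"
      using val_JPow_add [of "rest u" 1] ru that by (metis I_pow_1 letter.distinct(5) letter_word.simps(2))
    have uD: "val u = D_fun (val (rest u))" if "l = D"
      using val_JPow_add [of "rest u" "- 1"] ru that by (metis I_pow_m1 letter.distinct(3) letter_word.simps(1))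
    have vJ: "val v = I_fun (val (rest v))" if "m = J"
      using val_JPow_add [of "rest v" 1] rv that by (metis I_pow_1 letter.distinct(5) letter_word.simps(2))
    have vD: "val v = D_fun (val (rest v))" if "m = D"
      using val_JPow_add [of "rest v" "- 1"] rv that by (metis I_pow_m1 letter.distinct(3) letter_word.simps(1))
    have uY: "val u = (\<lambda>z. gen z * val (rest u) z)" if "l = Y"
      using val_Y_add [of "rest u"] ru that by metis
    have vY: "val v = (\<lambda>z. gen z * val (rest v) z)" if "m = Y"
      using val_Y_add [of "rest v"] rv that by metis
    consider "l = Y" | "l \<noteq> Y" "m = Y" | "l = J" "m = J" | "l = D" "m = D" | "l = D" "m = J" | "l = J" "m = D"
      by (metis letter.exhaust)
    then show ?thesis
    proof cases
      case 1
      then have "sha_word u v = letter_mon Y * sha_word (rest u) v"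
        using lm by (subst sha_word.simps) simp
      then show ?thesis using rest_left uY [OF 1]
        by (auto simp: valq_Y_mult mult.assoc simp del: letter_word.simps)
    next
      case 2
      then have "sha_word u v = letter_mon Y * sha_word u (rest v)"
        using lm by (subst sha_word.simps) (cases l; simp)
      then show ?thesis using rest_right vY [OF 2(2)]
        by (auto simp: valq_Y_mult mult_ac simp del: letter_word.simps)
    next
      case 3
      then have eq: "sha_word u v = letter_mon J * sha_word (rest u) v + letter_mon J * sha_word u (rest v)"
        using lm by (subst sha_word.simps) simp
      have "valq (sha_word u v) = (\<lambda>z. I_fun (\<lambda>z. val (rest u) z * val v z) z + I_fun (\<lambda>z. val u z * val (rest v) z) z)"
        unfolding eq by (rule ext) (simp only: valq_add J1 Y1 rest_left rest_right)
      also have "\<dots> = I_fun (\<lambda>z. val (rest u) z * val v z + val u z * val (rest v) z)"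
        using nru nrv nu nv 3 by (subst I_add) (auto intro: nice_mult)
      \<comment> \<open>As \<open>D_fun\<close> undoes the outer integrals, the sum of the two
        integrands is D of the product, and \<open>I_fun\<close> gives the product back.\<close>
      also have "(\<lambda>z. val (rest u) z * val v z + val u z * val (rest v) z) = D_fun (\<lambda>z. val u z * val v z)"
        using nu nv nru nrv 3 uJ vJ by (subst D_mult) (auto simp: D_I)
      also have "I_fun \<dots> = (\<lambda>z. val u z * val v z)"
        using nu nv by (intro I_D nice_mult)
      finally show ?thesis .
    next
      case 4
      then have eq: "sha_word u v = letter_mon D * sha_word (rest u) v - sha_word (rest u) (letter_word D + v)"
        using lm by (subst sha_word.simps) simp
      have "valq (sha_word u v) = (\<lambda>z. D_fun (\<lambda>z. val (rest u) z * val v z) z - val (rest u) z * D_fun (val v) z)"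
        unfolding eq by (rule ext) (simp only: valq_diff D1 Y1 rest_left rest_D [OF 4(2)] D_val)
      also have "D_fun (\<lambda>z. val (rest u) z * val v z) = (\<lambda>z. val u z * val v z + val (rest u) z * D_fun (val v) z)"
        using nru nv 4 uD by (subst D_mult) auto
      finally show ?thesis by simp
    next
      case 5
      then have eq: "sha_word u v = letter_mon D * sha_word (rest u) v - sha_word (rest u) (rest v)"
        using lm by (subst sha_word.simps) simp
      have "valq (sha_word u v) = (\<lambda>z. D_fun (\<lambda>z. val (rest u) z * val v z) z - val (rest u) z * val (rest v) z)"
        unfolding eq by (rule ext) (simp only: valq_diff D1 Y1 rest_left rest_both)
      also have "D_fun (\<lambda>z. val (rest u) z * val v z) = (\<lambda>z. val u z * val v z + val (rest u) z * val (rest v) z)"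
        using nru nv nrv 5 uD vJ by (subst D_mult) (auto simp: D_I)
      finally show ?thesis by simp
    next
      case 6
      then have eq: "sha_word u v = letter_mon D * sha_word u (rest v) - sha_word (rest u) (rest v)"
        using lm by (subst sha_word.simps) simp
      have "valq (sha_word u v) = (\<lambda>z. D_fun (\<lambda>z. val u z * val (rest v) z) z - val (rest u) z * val (rest v) z)"
        unfolding eq by (rule ext) (simp only: valq_diff D1 Y1 rest_right rest_both)
      also have "D_fun (\<lambda>z. val u z * val (rest v) z) = (\<lambda>z. val (rest u) z * val (rest v) z + val u z * val v z)"
        using nu nru nrv 6 uJ vD by (subst D_mult) (auto simp: D_I)
      finally show ?thesis by simp
    qed
  qed
qed

lemma last_exp_yword': "last_exp (yword ks) = 0"
  using range_yword by blast

lemma valq_sha0: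
  assumes "a \<in> Y_space" "b \<in> Y_space"
  shows "valq (a \<squnion>\<squnion> b) z = valq a z * valq b z"
  using assms(1) unfolding Y_space_def
proof (induction rule: qdjy.span_induct_alt)
  case (step c x y)
  then obtain us where x: "x = mon (yword us)" by blast
  have "valq (x \<squnion>\<squnion> b) z = valq x z * valq b z"
    using assms(2) unfolding Y_space_def
  proof (induction rule: qdjy.span_induct_alt)
    case (step c w y)
    then obtain vs where w: "w = mon (yword vs)" by blast
    have "valq (x \<squnion>\<squnion> w) z = valq x z * valq w z"
      by (simp add: x w valq_sha_word last_exp_yword')
    then show ?case
      using step by (simp add: sha0_add_right sha0_scale_right valq_add valq_scale distrib_left)
  qed simp
  then show ?case
    using step by (simp add: sha0_add_left sha0_scale_left valq_add valq_scale distrib_right)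
qed simp

text \<open>By \<open>valq_sha0\<close> the elements of \<open>Y_space\<close> with value 0 form an
  ideal of it, so only the generators have to be examined; for them the claim is the Leibniz rule
  for D, to which a power of j is then applied.\<close>

lemma valq_L:
  assumes "a \<in> L_space"
  shows "valq a = (\<lambda>_. 0)"
proof -
  define K where "K = {a \<in> Y_space. \<forall>z. valq a z = 0}"
  have "sha_ideal Y_space K"
    unfolding sha_ideal_def
  proof (intro conjI ballI)
    show "qdjy.subspace K"
      using subspace_Y unfolding K_def
      by (auto simp: qdjy.subspace_def valq_add valq_scale)
  qed (auto simp: K_def sha0_in_Y valq_sha0)
  moreover have "L_gens \<subseteq> K"
  proof
    fix x assume x: "x \<in> L_gens"
    then obtain k us vs where eq: "x = mon (JPow k) * leibniz (yword us) (yword vs)"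
      and ne: "us \<noteq> []" "vs \<noteq> []"
      unfolding L_gens_def by blast
    define u v where "u = yword us" and "v = yword vs"
    have l: "last_exp u = 0" "last_exp v = 0" and n: "u \<noteq> 0" "v \<noteq> 0"
      using ne by (simp_all add: u_def v_def last_exp_yword' yword_eq_0)
    have du: "last_exp (letter_word D + u) = 0" "letter_word D + u \<noteq> 0"
      and dv: "last_exp (letter_word D + v) = 0" "letter_word D + v \<noteq> 0"
      using last_exp_add l n by blast+
    have Y1: "sha_word u v \<in> Y1_space" using sha_word_in_Y1 l n by blast
    have L1: "leibniz u v \<in> Y1_space"
      unfolding leibniz_def using du dv l n by (intro Y1_diff mon_mult_Y1 sha_word_in_Y1) auto
    have nice: "nice (val u)" "nice (val v)" using nice_val l n by blast+
    have D_val: "val (letter_word D + u) = D_fun (val u)" "val (letter_word D + v) = D_fun (val v)"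
      using val_JPow_add [of _ "- 1"] l n by (simp_all add: I_pow_m1)
    have "valq (letter_mon D * sha_word u v) = D_fun (\<lambda>z. val u z * val v z)"
      using valq_JPow_mult [OF Y1, of "- 1"] l by (simp add: I_pow_m1 valq_sha_word)
    also have "\<dots> = (\<lambda>z. D_fun (val u) z * val v z + val u z * D_fun (val v) z)"
      by (rule D_mult [OF nice])
    finally have "valq (leibniz u v) = (\<lambda>_. 0)"
      by (intro ext) (simp only: leibniz_def valq_diff valq_sha_word l du dv D_val, simp)
    moreover have "I_pow k (\<lambda>_. 0) = (\<lambda>_. 0)"
      using I_pow_cmult [OF nice_0, of k 0] by simp
    ultimately have "valq x = (\<lambda>_. 0)"
      using valq_JPow_mult [OF L1, of k] eq by (simp add: u_def v_def)
    then show "x \<in> K" using L_gens_subset_Y x by (auto simp: K_def)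
  qed
  ultimately have "L_space \<subseteq> K"
    unfolding L_space_def by (intro hull_minimal)
  then show ?thesis using assms by (auto simp: K_def)
qed

section \<open>The functions Li\<close>

lemma has_vector_derivative_ln_comp:
  fixes F :: "complex \<Rightarrow> complex"
  assumes "(F has_field_derivative F') (at (of_real (- ln t)))" "t > 0"
  shows "((\<lambda>s. F (of_real (- ln s))) has_vector_derivative - F' / of_real t) (at t)"
proof -
  have "((\<lambda>s. - ln s) has_real_derivative - (1 / t)) (at t)"
    using assms(2) by (auto intro!: derivative_eq_intros)
  then have "((\<lambda>s. complex_of_real (- ln s)) has_vector_derivative of_real (- (1 / t))) (at t)"
    by (intro has_vector_derivative_of_real) (simp add: has_real_derivative_iff_has_vector_derivative)
  from field_vector_diff_chain_at [OF this assms(1)] show ?thesis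
    by (simp add: o_def)
qed

lemma minus_ln_half_strip: "0 < t \<Longrightarrow> t < 1 \<Longrightarrow> of_real (- ln t) \<in> half_strip b \<longleftrightarrow> b > 0"
  by (auto simp: half_strip_def intro: order_less_trans [of _ 0])

lemma D_op_D_fun:
  assumes f: "nice f"
    and g: "\<And>t. 0 < t \<Longrightarrow> t < 1 \<Longrightarrow> of_real (g t) = f (of_real (- ln t))"
    and t: "0 < t" "t < 1"
  shows "of_real (D_op g t) = D_fun f (of_real (- ln t))"
proof -
  let ?d = "D_fun f (of_real (- ln t)) / of_real t"
  have "((\<lambda>s. f (of_real (- ln s))) has_vector_derivative - (- D_fun f (of_real (- ln t))) / of_real t) (at t)"
    using t by (intro has_vector_derivative_ln_comp nice_has_derivative f) (simp_all add: minus_ln_half_strip del: of_real_minus)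
  then have "((\<lambda>s. f (of_real (- ln s))) has_vector_derivative ?d) (at t)"
    by simp
  then have *: "((\<lambda>s. complex_of_real (g s)) has_vector_derivative ?d) (at t)"
    by (rule has_vector_derivative_transform_within_open [where S = "{0<..<1}"])
      (use t g in \<open>auto simp del: of_real_minus\<close>)
  have "((\<lambda>s. Re (complex_of_real (g s))) has_vector_derivative Re ?d) (at t)"
    by (rule bounded_linear.has_vector_derivative [OF bounded_linear_Re *])
  then have "deriv g t = Re ?d"
    by (intro DERIV_imp_deriv) (simp add: has_real_derivative_iff_has_vector_derivative)
  \<comment> \<open>A function with real values has a real derivative; this identifies the complex
    derivative with \<open>deriv g\<close>.\<close>
  moreover have "((\<lambda>s. Im (complex_of_real (g s))) has_vector_derivative Im ?d) (at t)"
    by (rule bounded_linear.has_vector_derivative [OF bounded_linear_Im *])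
  then have "((\<lambda>s. 0 :: real) has_vector_derivative Im ?d) (at t)"
    by (simp only: Im_complex_of_real)
  then have "Im ?d = 0"
    by (rule vector_derivative_unique_at [OF _ has_vector_derivative_const])
  ultimately have "of_real (deriv g t) = ?d" by (simp add: complex_eq_iff)
  then show ?thesis using t by (simp add: D_op_def)
qed

text \<open>\<open>I_fun f\<close> at - ln s is a primitive of g(s)/s. It tends to 0 as s -> 0,
  since - ln s then tends to infinity, so the lower boundary term vanishes.\<close>

lemma J_op_I_fun:
  assumes f: "nice f"
    and g: "\<And>t. 0 < t \<Longrightarrow> t < 1 \<Longrightarrow> of_real (g t) = f (of_real (- ln t))"
    and t: "0 < t" "t < 1"
  shows "of_real (J_op g t) = I_fun f (of_real (- ln t))"
proof -
  \<comment> \<open>At s = 0 the logarithm has a mere default value; the primitive is extended there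
    by its limit 0.\<close>
  let ?F = "\<lambda>s. if s > 0 then I_fun f (of_real (- ln s)) else 0"
  let ?l = "I_fun f (of_real (- ln t))"
  have deriv: "((\<lambda>s. I_fun f (of_real (- ln s))) has_vector_derivative complex_of_real (g s / s)) (at s)"
    if "0 < s" "s < 1" for s
  proof -
    have "((\<lambda>s. I_fun f (of_real (- ln s))) has_vector_derivative
        - (- D_fun (I_fun f) (of_real (- ln s))) / of_real s) (at s)"
      using that by (intro has_vector_derivative_ln_comp nice_has_derivative nice_I f)
        (simp_all add: minus_ln_half_strip del: of_real_minus)
    then show ?thesis using g [OF that] by (simp add: D_I f)
  qed
  have "((\<lambda>s. complex_of_real (g s / s)) has_integral (?F t - ?F 0)) {0..t}"
  proof (rule fundamental_theorem_of_calculus_interior)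
    have "(?F \<longlongrightarrow> ?F s) (at s within {0..t})" if s: "s \<in> {0..t}" for s
    proof (cases "s = 0")
      case True
      have "filterlim (\<lambda>s::real. - ln s) at_top (at_right 0)" by real_asymp
      from filterlim_compose [OF decays_tendsto_0 [of 2 "I_fun f" 0] this]
      have "((\<lambda>s. I_fun f (of_real (- ln s))) \<longlongrightarrow> 0) (at_right 0)"
        using nice_I [OF f] by (simp add: nice_def half_strip_def)
      then have "(?F \<longlongrightarrow> 0) (at_right 0)"
        by (rule Lim_transform_eventually) (auto simp: eventually_at_filter)
      moreover have "at 0 within {0..t} = at_right 0"
        using t by (intro at_within_nhd [of _ "{..<t}"]) auto
      ultimately show ?thesis using True by simp
    next
      case False
      then have "0 < s" "s < 1" using s t by auto
      then have "isCont (\<lambda>s. I_fun f (of_real (- ln s))) s"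
        using deriv has_vector_derivative_continuous by blast
      then have "((\<lambda>s. I_fun f (of_real (- ln s))) \<longlongrightarrow> I_fun f (of_real (- ln s))) (at s)"
        by (simp add: isCont_def)
      then have "((\<lambda>s. I_fun f (of_real (- ln s))) \<longlongrightarrow> ?F s) (at s)"
        using \<open>0 < s\<close> by simp
      then have "(?F \<longlongrightarrow> ?F s) (at s)"
        by (rule Lim_transform_within_open [where s = "{0<..}"]) (use \<open>0 < s\<close> in auto)
      then show ?thesis by (rule tendsto_within_subset) auto
    qed
    then show "continuous_on {0..t} ?F"
      unfolding continuous_on_def by blast
    fix s assume s: "s \<in> {0<..<t}"
    then have "0 < s" "s < 1" using t by auto
    from deriv [OF this] show "(?F has_vector_derivative complex_of_real (g s / s)) (at s)"
      by (rule has_vector_derivative_transform_within_open [where S = "{0<..}"])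
        (use \<open>0 < s\<close> in auto)
  qed (use t in auto)
  then have *: "((\<lambda>s. complex_of_real (g s / s)) has_integral ?l) {0..t}"
    using t by simp
  have "((\<lambda>s. Re (complex_of_real (g s / s))) has_integral Re ?l) {0..t}"
    using has_integral_linear [OF * bounded_linear_Re] by (simp only: o_def)
  then have "J_op g t = Re ?l"
    unfolding J_op_def by (intro integral_unique) (simp only: Re_complex_of_real)
  moreover have "((\<lambda>s. Im (complex_of_real (g s / s))) has_integral Im ?l) {0..t}"
    using has_integral_linear [OF * bounded_linear_Im] by (simp only: o_def)
  then have "((\<lambda>s. 0 :: real) has_integral Im ?l) {0..t}" by (simp only: Im_complex_of_real)
  then have "Im ?l = 0" by (simp only: has_integral_0_eq)
  ultimately show ?thesis by (simp add: complex_eq_iff)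
qed

lemma J_pow_I_pow:
  assumes f: "nice f"
    and g: "\<And>t. 0 < t \<Longrightarrow> t < 1 \<Longrightarrow> of_real (g t) = f (of_real (- ln t))"
    and t: "0 < t" "t < 1"
  shows "of_real (J_pow k g t) = I_pow k f (of_real (- ln t))"
proof -
  have "nice ((I_fun ^^ n) f) \<and>
      (\<forall>t. 0 < t \<longrightarrow> t < 1 \<longrightarrow> of_real ((J_op ^^ n) g t) = (I_fun ^^ n) f (of_real (- ln t)))" for n
    by (induction n) (use f g in \<open>auto intro: nice_I J_op_I_fun simp del: of_real_minus\<close>)
  moreover have "nice ((D_fun ^^ n) f) \<and>
      (\<forall>t. 0 < t \<longrightarrow> t < 1 \<longrightarrow> of_real ((D_op ^^ n) g t) = (D_fun ^^ n) f (of_real (- ln t)))" for n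
    by (induction n) (use f g in \<open>auto intro: nice_D D_op_D_fun simp del: of_real_minus\<close>)
  ultimately show ?thesis using t by (simp add: J_pow_def I_pow_def del: of_real_minus)
qed

lemma yword_Cons: "yword (k # ks) = JPowY k (yword ks)"
  by simp

lemma Li_des_rev_val:
  "0 < t \<Longrightarrow> t < 1 \<Longrightarrow> of_real (Li_des_rev ks t) = val (yword ks) (of_real (- ln t))"
proof (induction ks arbitrary: t)
  case (Cons k ks)
  show ?case
    unfolding yword_Cons Li_des_rev.simps val.simps
    using Cons by (intro J_pow_I_pow nice_gen_val) (auto simp: gen_Li_des0 simp del: of_real_minus)
qed simp

lemma val_yword_continuous: "isCont (val (yword ks)) 0"
proof (cases "ks = []")
  case False
  then have "nice (val (yword ks))"
    by (intro nice_val last_exp_yword') (simp add: yword_eq_0)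
  from nice_has_derivative [OF this, of 0] show ?thesis
    by (auto simp: half_strip_def dest: DERIV_isCont)
qed simp

lemma Li_des_rev_tendsto: "((\<lambda>t. complex_of_real (Li_des_rev ks t)) \<longlongrightarrow> val (yword ks) 0) (at_left 1)"
proof -
  have "((\<lambda>t::real. complex_of_real (- ln t)) \<longlongrightarrow> of_real (- ln 1)) (at_left 1)"
    by (intro tendsto_intros) auto
  then have "((\<lambda>t. val (yword ks) (of_real (- ln t))) \<longlongrightarrow> val (yword ks) 0) (at_left 1)"
    by (intro isCont_tendsto_compose [OF val_yword_continuous]) simp
  moreover have "eventually (\<lambda>t::real. t \<in> {0<..<1}) (at_left 1)"
    by (rule eventually_at_left_real) simp
  then have "eventually (\<lambda>t. val (yword ks) (of_real (- ln t)) = complex_of_real (Li_des_rev ks t)) (at_left 1)"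
    by eventually_elim (simp add: Li_des_rev_val del: of_real_minus)
  ultimately show ?thesis by (rule Lim_transform_eventually)
qed

text \<open>The value at 0 is a limit of the real numbers \<open>Li_des_rev ks t\<close>.\<close>

lemma Im_val_yword: "Im (val (yword ks) 0) = 0"
  using tendsto_Im [OF Li_des_rev_tendsto [of ks]]
  by (simp add: tendsto_const_iff)

section \<open>The map on the quotient algebra\<close>

lemma of_rat_of_real: "complex_of_rat q = complex_of_real (of_rat q)"
  by (cases q) (simp add: of_rat_rat)

lemma Im_valq_Y: "a \<in> Y_space \<Longrightarrow> Im (valq a 0) = 0"
  unfolding Y_space_def
  by (induction rule: qdjy.span_induct_alt) (auto simp: valq_add valq_scale Im_val_yword of_rat_of_real)

text \<open>The real part loses nothing, see \<open>Im_valq_Y\<close>. The projection picks the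
  representative with which the quotient multiplies.\<close>

lift_definition zeta_sha :: "sha_alg \<Rightarrow> real" is "\<lambda>a. Re (valq (proj_Y a) 0)"
proof -
  fix a b :: qdjy
  assume "a - b \<in> TL_space"
  then have "valq (proj_Y a - proj_Y b) 0 = 0"
    using valq_L by (simp add: TL_iff proj_Y_diff)
  then show "Re (valq (proj_Y a) 0) = Re (valq (proj_Y b) 0)"
    by (simp add: valq_diff)
qed

lemma zeta_sha_add: "zeta_sha (x + y) = zeta_sha x + zeta_sha y"
  by transfer (simp add: proj_Y_add valq_add)

lemma zeta_sha_scale: "zeta_sha (sha_scale q x) = of_rat q * zeta_sha x"
  by transfer (simp add: proj_Y_scale valq_scale of_rat_of_real)

lemma zeta_sha_mult: "zeta_sha (x * y) = zeta_sha x * zeta_sha y"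
  by transfer (simp add: proj_Y_Y sha0_in_Y proj_Y_in_Y valq_sha0 Im_valq_Y)

lemma zeta_sha_1: "zeta_sha 1 = 1"
  by transfer (simp add: proj_Y_Y one_in_Y, simp flip: mon_0)

lemma zeta_sha_yword: "zeta_sha (sha_class (yword ks)) = Re (val (yword ks) 0)"
  by transfer (simp add: proj_Y_mon last_exp_yword')

lemma of_real_zeta_sha_yword: "complex_of_real (zeta_sha (sha_class (yword ks))) = val (yword ks) 0"
  by (simp add: zeta_sha_yword complex_eq_iff Im_val_yword)

lemma sha_alg_vector_space: "vector_space sha_scale"
  by unfold_locales
    (transfer, simp add: qdjy.scale_right_distrib qdjy.scale_left_distrib TL_0)+

lemma is_zeta_des_sha_zeta_sha: "is_zeta_des_sha zeta_sha"
  unfolding is_zeta_des_sha_def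
proof (intro conjI allI impI)
  interpret A: vector_space sha_scale by (rule sha_alg_vector_space)
  interpret B: vector_space "\<lambda>q x. of_rat q * x :: real"
    by unfold_locales (auto simp: algebra_simps of_rat_add of_rat_mult)
  show "Vector_Spaces.linear sha_scale (\<lambda>q x. of_rat q * x) zeta_sha"
    by unfold_locales (simp_all add: zeta_sha_add zeta_sha_scale)
  show "zeta_sha 1 = 1" by (rule zeta_sha_1)
  fix ks :: "int list"
  show "(Li_des ks \<longlongrightarrow> zeta_sha (sha_class (yword (rev ks)))) (at_left 1)"
    using tendsto_Re [OF Li_des_rev_tendsto [of "rev ks"]]
    by (simp add: zeta_sha_yword Li_des_def)
qed

text \<open>Every class has a representative in \<open>Y_space\<close>, namely the projection of any
  of its elements; hence the classes of the words \<open>yword ks\<close> span the quotient.\<close>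

lemma sha_alg_induct [case_names yword zero step]:
  assumes "\<And>ks. P (sha_class (yword ks))"
    and "P 0" and "\<And>q x y. P x \<Longrightarrow> P y \<Longrightarrow> P (sha_scale q x + y)"
  shows "P x"
proof -
  have Y: "P (abs_sha_alg a)" if "a \<in> Y_space" for a
    using that unfolding Y_space_def
  proof (induction rule: qdjy.span_induct_alt)
    case base
    show ?case using assms(2) by (simp add: zero_sha_alg_def)
  next
    case (step c x y)
    then obtain ks where "x = mon (yword ks)" by blast
    then have "P (sha_scale c (abs_sha_alg x) + abs_sha_alg y)"
      using assms(1) [of ks] assms(3) step by (simp add: sha_class_def)
    then show ?case by (simp add: sha_scale.abs_eq plus_sha_alg.abs_eq)
  qed
  have "abs_sha_alg (rep_sha_alg x) = abs_sha_alg (proj_Y (rep_sha_alg x))"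
    by (simp add: sha_alg.abs_eq_iff TL_iff proj_Y_diff proj_Y_Y proj_Y_in_Y
        qdjy.subspace_0 [OF subspace_L])
  then show ?thesis
    using Y [OF proj_Y_in_Y] Quotient_abs_rep [OF Quotient_sha_alg] by metis
qed

lemma is_zeta_des_sha_unique:
  assumes "is_zeta_des_sha Z" "is_zeta_des_sha Z'"
  shows "Z = Z'"
proof
  fix x
  have lin: "Vector_Spaces.linear sha_scale (\<lambda>q x. of_rat q * x) Z"
    "Vector_Spaces.linear sha_scale (\<lambda>q x. of_rat q * x) Z'"
    using assms by (auto simp: is_zeta_des_sha_def)
  show "Z x = Z' x"
  proof (induction x rule: sha_alg_induct)
    case (yword ks)
    show ?case
    proof (cases "ks = []")
      case True
      then have "sha_class (yword ks) = 1" by (simp add: sha_class_def one_sha_alg_def mon_0)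
      then show ?thesis using assms by (simp add: is_zeta_des_sha_def)
    next
      case False
      have "(Li_des (rev ks) \<longlongrightarrow> Z (sha_class (yword (rev (rev ks))))) (at_left 1)"
        "(Li_des (rev ks) \<longlongrightarrow> Z' (sha_class (yword (rev (rev ks))))) (at_left 1)"
        using assms False unfolding is_zeta_des_sha_def by blast+
      then show ?thesis using tendsto_unique [OF trivial_limit_at_left_real] by force
    qed
  next
    case zero
    show ?case using lin by (metis Vector_Spaces.linear_def module_hom.zero module_hom_iff_linear)
  next
    case (step q x y)
    then show ?case using lin by (simp add: Vector_Spaces.linear_iff)
  qed
qed

section \<open>Holomorphic dependence on parameters\<close>

text \<open>Only f itself is assumed to be dominated locally. Cauchy's estimate turns this into the
  bound B/r for the difference quotients, and dominated convergence along sequences gives the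
  derivative.\<close>

lemma holomorphic_integral:
  fixes f :: "complex \<Rightarrow> 'a \<Rightarrow> complex"
  assumes U: "open U"
    and hol: "\<And>x. x \<in> space M \<Longrightarrow> (\<lambda>z. f z x) holomorphic_on U"
    and meas: "\<And>z. z \<in> U \<Longrightarrow> f z \<in> borel_measurable M"
    and bound: "\<And>z0. z0 \<in> U \<Longrightarrow> \<exists>\<delta>>0. \<exists>B. integrable M B \<and>
      (\<forall>z\<in>ball z0 \<delta> \<inter> U. \<forall>x\<in>space M. norm (f z x) \<le> B x)"
  shows "(\<lambda>z. \<integral>x. f z x \<partial>M) holomorphic_on U"
  unfolding holomorphic_on_open [OF U]
proof
  fix z0 assume z0: "z0 \<in> U"
  obtain \<delta>0 B where \<delta>0: "\<delta>0 > 0" and B: "integrable M B"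
    and B': "\<And>z x. z \<in> ball z0 \<delta>0 \<inter> U \<Longrightarrow> x \<in> space M \<Longrightarrow> norm (f z x) \<le> B x"
    using bound [OF z0] by blast
  obtain \<delta>1 where \<delta>1: "\<delta>1 > 0" "ball z0 \<delta>1 \<subseteq> U"
    using U z0 openE by blast
  define \<delta> where "\<delta> = min \<delta>0 \<delta>1"
  have \<delta>: "\<delta> > 0" "ball z0 \<delta> \<subseteq> U" using \<delta>0 \<delta>1 by (auto simp: \<delta>_def)
  have bd: "norm (f z x) \<le> B x" if "z \<in> ball z0 \<delta>" "x \<in> space M" for z x
    using B' that \<delta>(2) by (auto simp: \<delta>_def subset_iff)
  \<comment> \<open>With a third of the radius, circles of radius r around points of
    \<open>ball z0 r\<close> stay inside \<open>ball z0 \<delta>\<close>.\<close>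
  define r where "r = \<delta> / 3"
  have r: "r > 0" "\<delta> = 3 * r" using \<delta> by (auto simp: r_def)
  have sub: "cball w r \<subseteq> ball z0 \<delta>" if "w \<in> ball z0 r" for w
  proof
    fix y assume "y \<in> cball w r"
    then show "y \<in> ball z0 \<delta>"
      using that r dist_triangle [of z0 y w] by simp
  qed
  have lip: "norm (f (z0 + h) x - f z0 x) \<le> B x / r * norm h" if h: "norm h < r" and x: "x \<in> space M" for h x
  proof -
    have "norm (f (z0 + h) x - f z0 x) \<le> B x / r * norm (z0 + h - z0)"
    proof (rule field_differentiable_bound [of "ball z0 r" "\<lambda>z. f z x" "deriv (\<lambda>z. f z x)"])
      fix w assume w: "w \<in> ball z0 r"
      have "w \<in> U" using sub [OF w] \<delta> r by force
      then show "((\<lambda>z. f z x) has_field_derivative deriv (\<lambda>z. f z x) w) (at w within ball z0 r)"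
        using holomorphic_derivI [OF hol [OF x] U] has_field_derivative_at_within by blast
      have "norm ((deriv ^^ 1) (\<lambda>z. f z x) w) \<le> fact 1 * B x / r ^ 1"
      proof (rule Cauchy_inequality)
        have "cball w r \<subseteq> U" using sub [OF w] \<delta> by blast
        then have *: "(\<lambda>z. f z x) holomorphic_on cball w r"
          by (rule holomorphic_on_subset [OF hol [OF x]])
        show "(\<lambda>z. f z x) holomorphic_on ball w r"
          by (rule holomorphic_on_subset [OF * ball_subset_cball])
        show "continuous_on (cball w r) (\<lambda>z. f z x)"
          by (rule holomorphic_on_imp_continuous_on [OF *])
        fix y assume "norm (w - y) = r"
        then have "y \<in> cball w r" by (simp add: dist_norm)
        then show "norm (f y x) \<le> B x" using bd x sub [OF w] by blast
      qed (use r in auto)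
      then show "norm (deriv (\<lambda>z. f z x) w) \<le> B x / r" by simp
    qed (use r h in \<open>auto simp: dist_norm\<close>)
    then show ?thesis by simp
  qed
  have int: "integrable M (f z)" if "z \<in> ball z0 \<delta>" for z
    using B by (rule Bochner_Integration.integrable_bound)
      (use that \<delta> meas bd in \<open>auto intro!: AE_I2 order_trans [OF _ abs_ge_self]\<close>)
  have "((\<lambda>h. ((\<integral>x. f (z0 + h) x \<partial>M) - (\<integral>x. f z0 x \<partial>M)) / h)
      \<longlongrightarrow> (\<integral>x. deriv (\<lambda>z. f z x) z0 \<partial>M)) (at 0)"
    unfolding tendsto_at_iff_sequentially o_def
  proof (intro allI impI)
    fix X :: "nat \<Rightarrow> complex"
    assume X0: "\<forall>i. X i \<in> UNIV - {0}" and X: "X \<longlonglongrightarrow> 0"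
    obtain N where N: "\<And>n. n \<ge> N \<Longrightarrow> norm (X n) < r"
      using LIMSEQ_D [OF X r(1)] by auto
    define Y where "Y = (\<lambda>n. X (n + N))"
    have Y: "Y \<longlonglongrightarrow> 0" "\<And>n. Y n \<noteq> 0" "\<And>n. norm (Y n) < r"
      unfolding Y_def by (rule LIMSEQ_ignore_initial_segment [OF X]) (use X0 N in auto)
    have zY: "z0 + Y n \<in> ball z0 \<delta>" for n
      using Y(3) [of n] r by (simp add: dist_norm)
    have zY': "z0 + Y n \<in> U" for n using zY \<delta> by blast
    have lim: "(\<lambda>n. (f (z0 + Y n) x - f z0 x) / Y n) \<longlonglongrightarrow> deriv (\<lambda>z. f z x) z0"
      if x: "x \<in> space M" for x
    proof -
      have "((\<lambda>h. (f (z0 + h) x - f z0 x) / h) \<longlongrightarrow> deriv (\<lambda>z. f z x) z0) (at 0)"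
        using holomorphic_derivI [OF hol [OF x] U z0, of UNIV] unfolding DERIV_def .
      moreover have "filterlim Y (at 0) sequentially"
        using Y by (simp add: filterlim_at)
      ultimately show ?thesis by (rule filterlim_compose)
    qed
    have m: "(\<lambda>x. (f (z0 + Y n) x - f z0 x) / Y n) \<in> borel_measurable M" for n
      using meas [OF zY'] meas [OF z0] by measurable
    have "(\<lambda>n. \<integral>x. (f (z0 + Y n) x - f z0 x) / Y n \<partial>M) \<longlonglongrightarrow> (\<integral>x. deriv (\<lambda>z. f z x) z0 \<partial>M)"
    proof (rule integral_dominated_convergence)
      show "(\<lambda>x. deriv (\<lambda>z. f z x) z0) \<in> borel_measurable M"
        by (rule borel_measurable_LIMSEQ_metric [OF m]) (rule lim)
      show "integrable M (\<lambda>x. B x / r)" using B by simp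
      show "AE x in M. (\<lambda>n. (f (z0 + Y n) x - f z0 x) / Y n) \<longlonglongrightarrow> deriv (\<lambda>z. f z x) z0"
        using lim by (intro AE_I2)
      show "AE x in M. norm ((f (z0 + Y n) x - f z0 x) / Y n) \<le> B x / r" for n
        using lip [OF Y(3) [of n]] Y(2) [of n]
        by (intro AE_I2) (simp add: norm_divide pos_divide_le_eq)
    qed (rule m)
    moreover have "(\<integral>x. (f (z0 + Y n) x - f z0 x) / Y n \<partial>M)
        = ((\<integral>x. f (z0 + Y n) x \<partial>M) - (\<integral>x. f z0 x \<partial>M)) / Y n" for n
      using int [OF zY] int [of z0] \<delta> by simp
    ultimately have "(\<lambda>n. ((\<integral>x. f (z0 + Y n) x \<partial>M) - (\<integral>x. f z0 x \<partial>M)) / Y n)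
        \<longlonglongrightarrow> (\<integral>x. deriv (\<lambda>z. f z x) z0 \<partial>M)" by (simp only:)
    then show "(\<lambda>n. ((\<integral>x. f (z0 + X n) x \<partial>M) - (\<integral>x. f z0 x \<partial>M)) / X n)
        \<longlonglongrightarrow> (\<integral>x. deriv (\<lambda>z. f z x) z0 \<partial>M)"
      unfolding Y_def by (rule LIMSEQ_offset)
  qed
  then show "\<exists>f'. ((\<lambda>z. \<integral>x. f z x \<partial>M) has_field_derivative f') (at z0)"
    unfolding DERIV_def by blast
qed

section \<open>Paths and kernels\<close>

text \<open>
  The parameter 0 stands for the real ray, a positive parameter for the Hankel contour of that radius.
  The coefficient of the Hankel kernel is $1/((e^{2\pi i s}-1)\Gamma(s))$, rewritten by the
  reflection formula so that it makes sense at the nonpositive integers.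
\<close>

definition ray :: "real \<Rightarrow> real \<Rightarrow> complex" where
  "ray p u = (if p = 0 then of_real \<bar>u\<bar> else hankel p u)"

definition coef :: "real \<Rightarrow> complex \<Rightarrow> complex" where
  "coef p s = (if p = 0 then rGamma s else Gamma (1 - s) * exp (- (of_real pi * \<i> * s)) / (2 * of_real pi * \<i>))"

definition kern :: "real \<Rightarrow> complex \<Rightarrow> real \<Rightarrow> complex" where
  "kern p s u = coef p s *
     (if p = 0 then if u > 0 then exp ((s - 1) * of_real (ln u)) else 0
      else exp ((s - 1) * hankel_log p u) * vector_derivative (hankel p) (at u))"

text \<open>On the ray the condition is convergence at 0; on a contour it excludes the poles s = 1,
  2, ... of \<open>Gamma (1 - s)\<close>. Together the two cases cover the plane.\<close>

definition adm :: "real \<Rightarrow> complex set" where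
  "adm p = (if p = 0 then {s. Re s > 0} else {s. 1 - s \<notin> \<int>\<^sub>\<le>\<^sub>0})"

lemma open_adm: "open (adm p)"
proof (cases "p = 0")
  case True
  then show ?thesis by (simp add: adm_def open_halfspace_Re_gt)
next
  case False
  have "adm p = (\<lambda>s. 1 - s) -` (- \<int>\<^sub>\<le>\<^sub>0)" using False by (auto simp: adm_def)
  then show ?thesis
    by (simp only:) (intro open_vimage open_Compl closed_nonpos_Ints continuous_intros)
qed

lemma coef_holomorphic: "coef p holomorphic_on adm p"
proof (cases "p = 0")
  case True
  then have "coef p = rGamma" by (auto simp: coef_def)
  then show ?thesis by (simp add: holomorphic_rGamma)
next
  case False
  then have "coef p = (\<lambda>s. Gamma (1 - s) * exp (- (of_real pi * \<i> * s)) / (2 * of_real pi * \<i>))"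
    by (auto simp: coef_def)
  then show ?thesis using False
    by (auto intro!: holomorphic_intros simp: adm_def)
qed

text \<open>Since e^(2 pi i s) - 1 = 2 i e^(pi i s) sin(pi s), the sine cancels against the one in
  the reflection formula.\<close>

lemma coef_Hankel:
  assumes "p \<noteq> 0" "s \<notin> \<int>"
  shows "coef p s = 1 / ((exp (2 * pi * \<i> * s) - 1) * Gamma s)"
proof -
  have sin: "sin (of_real pi * s) \<noteq> 0"
  proof
    assume "sin (of_real pi * s) = 0"
    then obtain n where "of_real pi * s = of_real (of_int n * pi)"
      unfolding sin_eq_0 by blast
    then have "s = of_int n" by simp
    then show False using assms(2) by simp
  qed
  have refl: "Gamma s * Gamma (1 - s) = of_real pi / sin (of_real pi * s)"
    by (rule Gamma_reflection_complex)
  have "Gamma s \<noteq> 0" using refl sin by auto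
  have *: "exp (2 * pi * \<i> * s) - 1 = 2 * \<i> * exp (of_real pi * \<i> * s) * sin (of_real pi * s)"
  proof -
    have "sin (of_real pi * s) * (2 * \<i>) = exp (\<i> * (of_real pi * s)) - exp (- (\<i> * (of_real pi * s)))"
      by (rule iffD1 [OF nonzero_eq_divide_eq sin_exp_eq]) simp
    then have "2 * \<i> * exp (of_real pi * \<i> * s) * sin (of_real pi * s)
        = exp (of_real pi * \<i> * s) * (exp (\<i> * (of_real pi * s)) - exp (- (\<i> * (of_real pi * s))))"
      by (metis mult.assoc mult.commute)
    also have "\<dots> = exp (2 * pi * \<i> * s) - 1"
      by (simp add: right_diff_distrib algebra_simps flip: exp_add)
    finally show ?thesis by simp
  qed
  have "Gamma (1 - s) = of_real pi / (sin (of_real pi * s) * Gamma s)"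
  proof -
    have "Gamma (1 - s) = (Gamma s * Gamma (1 - s)) / Gamma s" using \<open>Gamma s \<noteq> 0\<close> by simp
    then show ?thesis by (simp only: refl divide_divide_eq_left)
  qed
  then show ?thesis
    using assms(1) sin \<open>Gamma s \<noteq> 0\<close> unfolding *
    by (simp add: coef_def exp_minus divide_simps)
qed

section \<open>The Hankel contour as a parametrized path: pieces, derivative and bounds\<close>

lemma hankel_cases:
  assumes "p > 0"
  shows "u \<le> 0 \<Longrightarrow> hankel p u = of_real (p - u)"
    "0 \<le> u \<Longrightarrow> u \<le> 2 * pi \<Longrightarrow> hankel p u = of_real p * exp (\<i> * of_real u)"
    "u \<ge> 2 * pi \<Longrightarrow> hankel p u = of_real (p + (u - 2 * pi))"
proof -
  have *: "exp (Complex a b) = of_real (exp a) * exp (\<i> * of_real b)" for a b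
    by (simp add: Complex_eq exp_add exp_of_real)
  show 1: "hankel p u = of_real (p - u)" if "u \<le> 0" for u
    using assms that by (simp add: hankel_def hankel_log_def *)
  show 2: "hankel p u = of_real p * exp (\<i> * of_real u)" if "0 \<le> u" "u \<le> 2 * pi" for u
    using assms that by (cases "u = 0") (auto simp: hankel_def hankel_log_def *)
  show "hankel p u = of_real (p + (u - 2 * pi))" if "u \<ge> 2 * pi"
  proof (cases "u = 2 * pi")
    case True
    then show ?thesis using 2 [of u] by (simp add: exp_eq_1 mult.commute)
  next
    case False
    have "exp (\<i> * of_real (2 * pi)) = 1" by (simp add: exp_eq_1)
    moreover have "\<not> u \<le> 0" "\<not> u \<le> 2 * pi" using that False pi_gt_zero by linarith+
    ultimately show ?thesis using assms
      by (simp add: hankel_def hankel_log_def * del: of_real_mult)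
  qed
qed

lemma hankel_log_measurable [measurable]: "hankel_log p \<in> borel_measurable borel"
  unfolding hankel_log_def [abs_def] Complex_eq by measurable

lemma ray_measurable [measurable]: "ray p \<in> borel_measurable borel"
  unfolding ray_def [abs_def] hankel_def by measurable

lemma hankel_vector_derivative:
  assumes "p > 0"
  shows "u < 0 \<Longrightarrow> vector_derivative (hankel p) (at u) = - 1"
    "0 < u \<Longrightarrow> u < 2 * pi \<Longrightarrow> vector_derivative (hankel p) (at u) = \<i> * hankel p u"
    "u > 2 * pi \<Longrightarrow> vector_derivative (hankel p) (at u) = 1"
proof -
  show "vector_derivative (hankel p) (at u) = - 1" if "u < 0"
  proof (rule vector_derivative_at)
    have "((\<lambda>u. complex_of_real (p - u)) has_vector_derivative - 1) (at u)"
      by (auto intro!: derivative_eq_intros)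
    then show "(hankel p has_vector_derivative - 1) (at u)"
      by (rule has_vector_derivative_transform_within_open [where S = "{..<0}"])
        (use that assms in \<open>auto simp: hankel_cases\<close>)
  qed
  show "vector_derivative (hankel p) (at u) = 1" if "u > 2 * pi"
  proof (rule vector_derivative_at)
    have "((\<lambda>u. complex_of_real (p + (u - 2 * pi))) has_vector_derivative 1) (at u)"
      by (auto intro!: derivative_eq_intros)
    then show "(hankel p has_vector_derivative 1) (at u)"
      by (rule has_vector_derivative_transform_within_open [where S = "{2 * pi<..}"])
        (use that assms in \<open>auto simp: hankel_cases\<close>)
  qed
  show "vector_derivative (hankel p) (at u) = \<i> * hankel p u" if "0 < u" "u < 2 * pi"
  proof (rule vector_derivative_at)
    have "((\<lambda>u. of_real p * exp (\<i> * of_real u)) has_vector_derivative of_real p * (exp (\<i> * of_real u) * \<i>)) (at u)"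
      by (rule has_vector_derivative_real_field [where f = "\<lambda>z. of_real p * exp (\<i> * z)"])
        (auto intro!: derivative_eq_intros)
    then show "(hankel p has_vector_derivative \<i> * hankel p u) (at u)"
    proof (rule has_vector_derivative_eq_rhs [OF has_vector_derivative_transform_within_open])
      show "open {0<..<2 * pi}" "u \<in> {0<..<2 * pi}" using that by auto
      show "of_real p * exp (\<i> * of_real y) = hankel p y" if "y \<in> {0<..<2 * pi}" for y
        using that by (simp add: hankel_cases(2) [OF assms])
      show "of_real p * (exp (\<i> * of_real u) * \<i>) = \<i> * hankel p u"
        using that by (simp add: hankel_cases(2) [OF assms])
    qed
  qed
qed

text \<open>At the corners 0 and 2 pi the derivative has an unspecified value; a change on a finite
  set preserves measurability.\<close>

lemma hankel_vector_derivative_measurable: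
  assumes "p > 0"
  shows "(\<lambda>u. vector_derivative (hankel p) (at u)) \<in> borel_measurable borel"
proof -
  have "(\<lambda>u. if u < 0 then - 1 else if u < 2 * pi then \<i> * (of_real p * exp (\<i> * of_real u)) else 1)
      \<in> borel_measurable borel" by measurable
  then show ?thesis
    by (rule measurable_discrete_difference [where X = "{0, 2 * pi}"])
      (auto simp: hankel_vector_derivative [OF assms] hankel_cases(2) [OF assms])
qed

lemma kern_measurable:
  assumes "p \<ge> 0"
  shows "kern p s \<in> borel_measurable borel"
proof (cases "p = 0")
  case True
  then show ?thesis unfolding kern_def [abs_def] by simp
next
  case False
  then have "p > 0" using assms by simp
  note [measurable] = hankel_vector_derivative_measurable [OF this]
  show ?thesis unfolding kern_def [abs_def] using False by simp
qed

lemma kern_holomorphic: "(\<lambda>s. kern p s u) holomorphic_on adm p"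
  unfolding kern_def by (cases "p = 0"; cases "u > 0") (auto intro!: holomorphic_intros coef_holomorphic)

text \<open>The first two bounds say how far a path can push the argument out of a half strip. The
  third converts decay in the real part into decay in the parameter u, with 2 pi for the length of
  the circular piece. For p = 0 the value |u| keeps them true on the negative axis, where the kernel
  vanishes.\<close>

lemma ray_bounds:
  assumes "p \<ge> 0"
  shows "Re (ray p u) \<ge> - p" "\<bar>Im (ray p u)\<bar> \<le> p" "Re (ray p u) \<ge> \<bar>u\<bar> - p - 2 * pi"
proof -
  have "Re (ray p u) \<ge> - p \<and> \<bar>Im (ray p u)\<bar> \<le> p \<and> Re (ray p u) \<ge> \<bar>u\<bar> - p - 2 * pi"
  proof (cases "p = 0")
    case True
    then show ?thesis using pi_gt_zero by (simp add: ray_def)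
  next
    case False
    then have p: "p > 0" and ray: "ray p u = hankel p u" using assms by (auto simp: ray_def)
    consider "u \<le> 0" | "0 \<le> u" "u \<le> 2 * pi" | "u \<ge> 2 * pi" by linarith
    then show ?thesis
    proof cases
      case 1
      moreover have "- pi \<le> p" using p pi_gt_zero by linarith
      ultimately show ?thesis using p by (simp add: ray hankel_cases(1) [OF p])
    next
      case 2
      have "exp (\<i> * complex_of_real u) = cis u" by (simp add: cis_conv_exp)
      then have e: "ray p u = of_real p * cis u" using 2 by (simp add: ray hankel_cases(2) [OF p])
      have "\<bar>p * cos u\<bar> \<le> p" "\<bar>p * sin u\<bar> \<le> p"
        using p by (simp_all add: abs_mult mult_left_le)
      then have "- p \<le> p * cos u" "u - p - 2 * pi \<le> p * cos u" "\<bar>p * sin u\<bar> \<le> p"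
        using 2 by linarith+
      then show ?thesis using 2(1) by (simp add: e)
    next
      case 3
      then have "u \<ge> 0" using pi_gt_zero by linarith
      then show ?thesis using 3 p by (simp add: ray hankel_cases(3) [OF p])
    qed
  qed
  then show "Re (ray p u) \<ge> - p" "\<bar>Im (ray p u)\<bar> \<le> p" "Re (ray p u) \<ge> \<bar>u\<bar> - p - 2 * pi" by auto
qed

lemma add_ray_half_strip:
  assumes "0 \<le> p" "p \<le> b" "z \<in> half_strip a"
  shows "z + ray p u \<in> half_strip (a + b)"
  using half_strip_add [OF assms(3), of p "ray p u"] ray_bounds [OF assms(1), of u]
    half_strip_mono [of "a + p" "a + b"] assms by auto

text \<open>Two half-line integrals of exp(- t/2), rescaled by 1/2 and -1/2; only the point 0 is
  missed.\<close>

lemma exp_abs_integrable: "integrable lborel (\<lambda>u::real. exp (- \<bar>u\<bar> / 4))"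
proof -
  have *: "integrable lborel (\<lambda>u::real. indicator {0<..} u *\<^sub>R exp (- u / 2))"
    using exp_half_integrable by (simp add: set_integrable_def)
  have 1: "integrable lborel (\<lambda>u::real. indicator {0<..} (0 + (1 / 2) * u) *\<^sub>R exp (- (0 + (1 / 2) * u) / 2))"
    by (subst lborel_integrable_real_affine_iff) (use * in auto)
  have 2: "integrable lborel (\<lambda>u::real. indicator {0<..} (0 + (- 1 / 2) * u) *\<^sub>R exp (- (0 + (- 1 / 2) * u) / 2))"
    by (subst lborel_integrable_real_affine_iff) (use * in auto)
  have "integrable lborel (\<lambda>u::real. indicator {0<..} (0 + (1 / 2) * u) *\<^sub>R exp (- (0 + (1 / 2) * u) / 2)
      + indicator {0<..} (0 + (- 1 / 2) * u) *\<^sub>R exp (- (0 + (- 1 / 2) * u) / 2))"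
    using 1 2 by (rule Bochner_Integration.integrable_add)
  then show ?thesis
    by (rule integrable_discrete_difference [where X = "{0}", THEN iffD1, rotated -1])
      (auto simp: indicator_def abs_if)
qed

text \<open>The majorant is locally uniform in s, as is needed for both limits and holomorphy in s.
  The factor exp(- Re t/2) stands for the decay of the function to be transformed.\<close>

lemma kern_bound:
  assumes p: "p \<ge> 0" and s0: "s0 \<in> adm p"
  shows "\<exists>\<delta>>0. \<exists>B. integrable lborel B \<and>
    (\<forall>s\<in>ball s0 \<delta>. \<forall>u. norm (kern p s u) * exp (- Re (ray p u) / 2) \<le> B u)"
proof -
  obtain \<delta>0 where \<delta>0: "\<delta>0 > 0" "cball s0 \<delta>0 \<subseteq> adm p"
    using open_adm s0 open_contains_cball by blast
  \<comment> \<open>For p = 0 the radius a = Re s0/2 confines Re s to [a, 3a], so that u^(Re s - 1)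
    is at most the sum of the two extreme powers.\<close>
  define \<delta> where "\<delta> = (if p = 0 then min \<delta>0 (Re s0 / 2) else \<delta>0)"
  have \<delta>: "\<delta> > 0" "cball s0 \<delta> \<subseteq> adm p"
    using \<delta>0 s0 by (auto simp: \<delta>_def adm_def subset_iff)
  have "continuous_on (cball s0 \<delta>) (coef p)"
    using coef_holomorphic \<delta>(2) holomorphic_on_imp_continuous_on holomorphic_on_subset by blast
  then have "bounded (coef p ` cball s0 \<delta>)"
    by (intro compact_imp_bounded compact_continuous_image compact_cball)
  then obtain M0 where M0: "\<And>s. s \<in> cball s0 \<delta> \<Longrightarrow> norm (coef p s) \<le> M0"
    unfolding bounded_iff by blast
  have M0_0: "M0 \<ge> 0" using order_trans [OF norm_ge_zero M0 [of s0]] \<delta>(1) by simp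
  show ?thesis
  proof (cases "p = 0")
    case True
    define a where "a = Re s0 / 2"
    have a: "a > 0" using s0 True by (simp add: a_def adm_def)
    define B where "B u = M0 * (indicator {0<..} u * (u powr (a - 1) * exp (- u / 2))
      + indicator {0<..} u * (u powr (3 * a - 1) * exp (- u / 2)))" for u :: real
    have "integrable lborel B"
      unfolding B_def [abs_def]
      using powr_exp_integrable [of a] powr_exp_integrable [of "3 * a"] a
      by (simp add: set_integrable_def)
    moreover have "norm (kern p s u) * exp (- Re (ray p u) / 2) \<le> B u" if s: "s \<in> ball s0 \<delta>" for s u
    proof (cases "u > 0")
      case u: True
      have "norm (s0 - s) < a" using s True by (simp add: \<delta>_def dist_norm a_def)
      then have Res: "a \<le> Re s" "Re s \<le> 3 * a"
        using abs_Re_le_cmod [of "s0 - s"] by (auto simp: a_def)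
      have "u powr (Re s - 1) \<le> u powr (a - 1) + u powr (3 * a - 1)"
      proof (cases "u \<ge> 1")
        case True
        then have "u powr (Re s - 1) \<le> u powr (3 * a - 1)" using Res by (intro powr_mono) auto
        then show ?thesis using powr_ge_zero [of u "a - 1"] by linarith
      next
        case False
        then have "u powr (Re s - 1) \<le> u powr (a - 1)" using Res u by (intro powr_mono') auto
        then show ?thesis using powr_ge_zero [of u "3 * a - 1"] by linarith
      qed
      moreover have "norm (kern p s u) = norm (coef p s) * u powr (Re s - 1)"
        using u True by (simp add: kern_def norm_mult powr_def)
      moreover have "norm (coef p s) \<le> M0" using M0 s by simp
      ultimately have "norm (kern p s u) \<le> M0 * (u powr (a - 1) + u powr (3 * a - 1))"
        using M0_0 by (simp add: mult_mono)
      then have "norm (kern p s u) * exp (- u / 2) \<le> M0 * (u powr (a - 1) + u powr (3 * a - 1)) * exp (- u / 2)"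
        by (rule mult_right_mono) auto
      then show ?thesis using u True by (simp add: ray_def B_def algebra_simps)
    next
      case False
      then show ?thesis using True by (simp add: kern_def B_def)
    qed
    ultimately show ?thesis using \<delta>(1) by blast
  next
    case False
    then have pp: "p > 0" using p by simp
    define A where "A = norm (s0 - 1) + \<delta>"
    have A: "A > 0" using \<delta> by (simp add: A_def add_nonneg_pos)
    let ?v = "\<lambda>u. vector_derivative (hankel p) (at u)"
    \<comment> \<open>The last two norms absorb the unspecified derivatives at the corners.\<close>
    define V where "V = 1 + p + norm (?v 0) + norm (?v (2 * pi))"
    have V: "norm (?v u) \<le> V" for u
    proof -
      consider "u < 0" | "u = 0" | "0 < u" "u < 2 * pi" | "u = 2 * pi" | "u > 2 * pi" by linarith
      then show ?thesis
      proof cases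
        case 3
        then have "norm (?v u) = p"
          using pp by (simp add: hankel_vector_derivative(2) [OF pp] hankel_cases(2) [OF pp] norm_mult)
        then show ?thesis by (simp add: V_def)
      qed (use pp in \<open>auto simp: V_def hankel_vector_derivative(1,3) [OF pp]\<close>)
    qed
    \<comment> \<open>\<open>A\<close> bounds |s - 1|. From ln x <= x - 1 at x = y/(4A) follows A ln
      y <= A ln(4A) + y/4, and y <= p + |u|. So |t^(s - 1)| grows at most like exp(|u|/4), which
      uses half of the available decay exp(- |u|/2).\<close>
    define c where "c = A * (\<bar>ln p\<bar> + \<bar>ln (4 * A)\<bar> + 2 * pi) + p / 4"
    have hl: "A * norm (hankel_log p u) \<le> c + \<bar>u\<bar> / 4" for u
    proof -
      have im: "\<bar>Im (hankel_log p u)\<bar> \<le> 2 * pi"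
        using pi_gt_zero by (auto simp: hankel_log_def)
      obtain y where y: "Re (hankel_log p u) = ln y" "p \<le> y" "y \<le> p + \<bar>u\<bar>"
      proof -
        consider "u \<le> 0" | "0 < u" "u \<le> 2 * pi" | "u > 2 * pi" by linarith
        then show ?thesis
        proof cases
          case 1
          then show ?thesis using pp by (intro that [of "p - u"]) (auto simp: hankel_log_def)
        next
          case 2
          then show ?thesis using pp by (intro that [of p]) (auto simp: hankel_log_def)
        next
          case 3
          then have "\<not> u \<le> 0" "u - 2 * pi \<le> \<bar>u\<bar>" using pi_gt_zero by linarith+
          then show ?thesis using pp 3
            by (intro that [of "p + (u - 2 * pi)"]) (simp_all add: hankel_log_def)
        qed
      qed
      have "ln p \<le> ln y" using y pp by simp
      moreover have "ln y \<le> ln (4 * A) + y / (4 * A)"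
      proof -
        have "ln y = ln (4 * A) + ln (y / (4 * A))" using y pp A by (simp add: ln_div)
        also have "ln (y / (4 * A)) \<le> y / (4 * A)"
          using ln_le_minus_one [of "y / (4 * A)"] y pp A by simp
        finally show ?thesis by simp
      qed
      moreover have "y / (4 * A) \<ge> 0" using y pp A by simp
      ultimately have "\<bar>ln y\<bar> \<le> \<bar>ln p\<bar> + \<bar>ln (4 * A)\<bar> + y / (4 * A)" by linarith
      then have "norm (hankel_log p u) \<le> \<bar>ln p\<bar> + \<bar>ln (4 * A)\<bar> + y / (4 * A) + 2 * pi"
        using cmod_le [of "hankel_log p u"] im y(1) by simp
      then have "A * norm (hankel_log p u) \<le> A * (\<bar>ln p\<bar> + \<bar>ln (4 * A)\<bar> + y / (4 * A) + 2 * pi)"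
        using A by (intro mult_left_mono) auto
      also have "\<dots> = A * (\<bar>ln p\<bar> + \<bar>ln (4 * A)\<bar> + 2 * pi) + y / 4"
        using A by (simp add: distrib_left)
      also have "\<dots> \<le> c + \<bar>u\<bar> / 4" using y by (simp add: c_def)
      finally show ?thesis .
    qed
    define C where "C = M0 * V * exp (c + p / 2 + pi)"
    define B where "B u = C * exp (- \<bar>u\<bar> / 4)" for u :: real
    have "integrable lborel B"
      unfolding B_def [abs_def] using exp_abs_integrable by simp
    moreover have "norm (kern p s u) * exp (- Re (ray p u) / 2) \<le> B u" if s: "s \<in> ball s0 \<delta>" for s u
    proof -
      have "norm (s - 1) \<le> A"
        using s norm_triangle_ineq [of "s - s0" "s0 - 1"] by (simp add: A_def dist_norm norm_minus_commute)
      then have "norm ((s - 1) * hankel_log p u) \<le> A * norm (hankel_log p u)"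
        by (simp add: norm_mult mult_right_mono)
      then have "norm (exp ((s - 1) * hankel_log p u)) \<le> exp (c + \<bar>u\<bar> / 4)"
        using norm_exp [of "(s - 1) * hankel_log p u"] hl [of u] by (meson exp_le_cancel_iff order_trans)
      then have "norm (exp ((s - 1) * hankel_log p u)) * norm (?v u) \<le> exp (c + \<bar>u\<bar> / 4) * V"
        by (rule mult_mono [OF _ V]) auto
      moreover have "norm (coef p s) \<le> M0" using M0 s by simp
      ultimately have "norm (coef p s) * (norm (exp ((s - 1) * hankel_log p u)) * norm (?v u))
          \<le> M0 * (exp (c + \<bar>u\<bar> / 4) * V)"
        using M0_0 by (intro mult_mono [of "norm (coef p s)"] mult_nonneg_nonneg norm_ge_zero)
      then have 1: "norm (kern p s u) \<le> M0 * (exp (c + \<bar>u\<bar> / 4) * V)"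
        using False by (simp only: kern_def norm_mult if_False)
      have 2: "exp (- Re (ray p u) / 2) \<le> exp (p / 2 + pi - \<bar>u\<bar> / 2)"
        using ray_bounds(3) [OF p, of u] by (simp add: field_simps)
      have "norm (kern p s u) * exp (- Re (ray p u) / 2)
          \<le> (M0 * (exp (c + \<bar>u\<bar> / 4) * V)) * exp (p / 2 + pi - \<bar>u\<bar> / 2)"
        by (rule mult_mono [OF 1 2 order_trans [OF norm_ge_zero 1]]) simp
      also have "\<dots> = M0 * V * (exp (c + \<bar>u\<bar> / 4) * exp (p / 2 + pi - \<bar>u\<bar> / 2))" by simp
      also have "exp (c + \<bar>u\<bar> / 4) * exp (p / 2 + pi - \<bar>u\<bar> / 2) = exp (c + p / 2 + pi) * exp (- \<bar>u\<bar> / 4)"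
        by (simp add: exp_add [symmetric])
      finally show ?thesis by (simp add: B_def C_def mult.assoc)
    qed
    ultimately show ?thesis using \<delta>(1) by blast
  qed
qed

section \<open>Iterated integrals\<close>

text \<open>The shift z carries the recursion: the last variable enters every partial sum, so
  splitting it off merely moves z.\<close>

definition gprod :: "(complex \<Rightarrow> complex) \<Rightarrow> nat \<Rightarrow> complex \<Rightarrow> (nat \<Rightarrow> complex) \<Rightarrow> complex" where
  "gprod g r z t = (\<Prod>j<r. g (z + (\<Sum>k\<in>{j..<r}. t k)))"

definition integrand ::
  "(complex \<Rightarrow> complex) \<Rightarrow> (nat \<Rightarrow> real) \<Rightarrow> (nat \<Rightarrow> complex) \<Rightarrow> nat \<Rightarrow> complex \<Rightarrow> (nat \<Rightarrow> real) \<Rightarrow> complex" where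
  "integrand g p s r z u = gprod g r z (\<lambda>k. ray (p k) (u k)) * (\<Prod>k<r. kern (p k) (s k) (u k))"

definition multi ::
  "(complex \<Rightarrow> complex) \<Rightarrow> (nat \<Rightarrow> real) \<Rightarrow> (nat \<Rightarrow> complex) \<Rightarrow> nat \<Rightarrow> complex \<Rightarrow> complex" where
  "multi g p s r z = (\<integral>u. integrand g p s r z u \<partial>Pi\<^sub>M {..<r} (\<lambda>_. lborel))"

text \<open>For p = 0 this is the Weyl fractional integral of order s, otherwise its continuation in
  s as a contour integral.\<close>

definition weyl :: "real \<Rightarrow> complex \<Rightarrow> (complex \<Rightarrow> complex) \<Rightarrow> complex \<Rightarrow> complex" where
  "weyl p s f z = (\<integral>u. kern p s u * f (z + ray p u) \<partial>lborel)"

text \<open>In contrast to \<open>decays\<close> the constant is explicit, since the passage c -> 1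
  needs one constant for the whole family \<open>approx c\<close>.\<close>

definition bounded_by :: "real \<Rightarrow> (complex \<Rightarrow> complex) \<Rightarrow> bool" where
  "bounded_by M g \<longleftrightarrow> M \<ge> 0 \<and> (\<forall>w\<in>half_strip 2. norm (g w) \<le> M * exp (- Re w / 2))"

lemma gprod_Suc: "gprod g (Suc r) z t = g (z + t r) * gprod g r (z + t r) t"
proof -
  have "(\<Sum>k\<in>{j..<Suc r}. t k) = t r + (\<Sum>k\<in>{j..<r}. t k)" if "j < r" for j
    using that by (simp add: add.commute)
  then have "z + (\<Sum>k\<in>{j..<Suc r}. t k) = z + t r + (\<Sum>k\<in>{j..<r}. t k)" if "j < r" for j
    using that by (simp only: add.assoc)
  then have "(\<Prod>j<r. g (z + (\<Sum>k\<in>{j..<Suc r}. t k))) = (\<Prod>j<r. g (z + t r + (\<Sum>k\<in>{j..<r}. t k)))"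
    by (intro prod.cong refl) (simp only: lessThan_iff)
  then show ?thesis unfolding gprod_def prod.lessThan_Suc by simp
qed

text \<open>Each path uses up at most eta of the width 2. Each factor of the product is charged to
  the decay in one variable only, the first of its partial sum; the rest of its argument has real
  part above -2 and contributes at most exp 1.\<close>

lemma gprod_bound:
  assumes "bounded_by M g" "\<eta> \<ge> 0"
  shows "(\<And>k. k < r \<Longrightarrow> 0 \<le> p k \<and> p k \<le> \<eta>) \<Longrightarrow> z \<in> half_strip (2 - real r * \<eta>) \<Longrightarrow>
    norm (gprod g r z (\<lambda>k. ray (p k) (u k))) \<le> (M * exp 1) ^ r * (\<Prod>k<r. exp (- Re (ray (p k) (u k)) / 2))"
proof (induction r arbitrary: z)
  case 0
  then show ?case by (simp add: gprod_def)
next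
  case (Suc r)
  let ?t = "ray (p r) (u r)"
  have M: "M \<ge> 0" using assms by (simp add: bounded_by_def)
  have z: "z + ?t \<in> half_strip (2 - real r * \<eta>)"
    using add_ray_half_strip [of "p r" \<eta> z "2 - real (Suc r) * \<eta>" "u r"] Suc.prems
    by (simp add: algebra_simps)
  then have z2: "z + ?t \<in> half_strip 2"
    using half_strip_mono [of "2 - real r * \<eta>" 2] assms(2) by auto
  have "z \<in> half_strip 2"
    using Suc.prems(2) half_strip_mono [of "2 - real (Suc r) * \<eta>" 2] assms(2) by auto
  then have "- Re z \<le> 2" by (simp add: half_strip_def)
  have "norm (g (z + ?t)) \<le> M * exp (- Re (z + ?t) / 2)"
    using assms(1) z2 unfolding bounded_by_def by blast
  also have "\<dots> \<le> M * exp (1 - Re ?t / 2)"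
    using M \<open>- Re z \<le> 2\<close> by (intro mult_left_mono) auto
  also have "\<dots> = (M * exp 1) * exp (- Re ?t / 2)"
    by (simp add: mult.assoc flip: exp_add)
  finally have "norm (g (z + ?t)) \<le> (M * exp 1) * exp (- Re ?t / 2)" .
  moreover have "norm (gprod g r (z + ?t) (\<lambda>k. ray (p k) (u k)))
      \<le> (M * exp 1) ^ r * (\<Prod>k<r. exp (- Re (ray (p k) (u k)) / 2))"
    using Suc.prems z by (intro Suc.IH) auto
  ultimately have "norm (g (z + ?t)) * norm (gprod g r (z + ?t) (\<lambda>k. ray (p k) (u k)))
      \<le> ((M * exp 1) * exp (- Re ?t / 2)) * ((M * exp 1) ^ r * (\<Prod>k<r. exp (- Re (ray (p k) (u k)) / 2)))"
    using M by (intro mult_mono) auto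
  then show ?case by (simp add: gprod_Suc norm_mult mult_ac)
qed

interpretation lborel_product: product_sigma_finite "\<lambda>_::nat. lborel :: real measure"
  by standard

text \<open>The majorant is a product of one-variable majorants, the same for all g and z and for
  all s near s0; the limits and derivatives of \<open>multi\<close> rest on it.\<close>

lemma integrand_bound:
  assumes p: "\<And>k. k < r \<Longrightarrow> 0 \<le> p k \<and> p k \<le> \<eta>" and \<eta>: "\<eta> \<ge> 0"
    and s0: "\<And>k. k < r \<Longrightarrow> s0 k \<in> adm (p k)"
  obtains \<delta> B where "\<delta> > 0" "integrable (Pi\<^sub>M {..<r} (\<lambda>_. lborel)) B"
    "\<And>g M z s u. bounded_by M g \<Longrightarrow> z \<in> half_strip (2 - real r * \<eta>) \<Longrightarrow>
      (\<And>k. k < r \<Longrightarrow> s k \<in> ball (s0 k) \<delta>) \<Longrightarrow>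
      norm (integrand g p s r z u) \<le> (M * exp 1) ^ r * B u"
proof -
  have "\<forall>k\<in>{..<r}. \<exists>\<delta> B. \<delta> > 0 \<and> integrable lborel B \<and>
    (\<forall>s\<in>ball (s0 k) \<delta>. \<forall>u. norm (kern (p k) s u) * exp (- Re (ray (p k) u) / 2) \<le> B u)"
    using kern_bound p s0 by (metis lessThan_iff)
  then obtain \<delta> B where \<delta>: "\<And>k. k < r \<Longrightarrow> \<delta> k > 0"
    and B: "\<And>k. k < r \<Longrightarrow> integrable lborel (B k)"
    and B': "\<And>k s u. k < r \<Longrightarrow> s \<in> ball (s0 k) (\<delta> k) \<Longrightarrow>
       norm (kern (p k) s u) * exp (- Re (ray (p k) u) / 2) \<le> B k u"
    by (metis (no_types, lifting) bchoice lessThan_iff)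
  \<comment> \<open>The element 1 covers r = 0, where there is no other radius to minimize
    over.\<close>
  define d where "d = Min (insert 1 (\<delta> ` {..<r}))"
  have d: "d > 0" using \<delta> by (auto simp: d_def)
  have dk: "d \<le> \<delta> k" if "k < r" for k using that by (auto simp: d_def)
  show ?thesis
  proof (rule that [OF d])
    show "integrable (Pi\<^sub>M {..<r} (\<lambda>_. lborel)) (\<lambda>u. \<Prod>k<r. B k (u k))"
      using B by (intro lborel_product.product_integrable_prod) auto
    fix g M z s u
    assume g: "bounded_by M g" and z: "z \<in> half_strip (2 - real r * \<eta>)"
      and s: "\<And>k. k < r \<Longrightarrow> s k \<in> ball (s0 k) d"
    have M: "M \<ge> 0" using g by (simp add: bounded_by_def)
    have "norm (integrand g p s r z u)
        \<le> ((M * exp 1) ^ r * (\<Prod>k<r. exp (- Re (ray (p k) (u k)) / 2))) * (\<Prod>k<r. norm (kern (p k) (s k) (u k)))"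
      unfolding integrand_def norm_mult prod_norm [symmetric]
      using gprod_bound [OF g \<eta> p z] by (intro mult_right_mono) (auto intro: prod_nonneg)
    also have "\<dots> = (M * exp 1) ^ r * (\<Prod>k<r. norm (kern (p k) (s k) (u k)) * exp (- Re (ray (p k) (u k)) / 2))"
      by (simp add: prod.distrib mult_ac)
    also have "\<dots> \<le> (M * exp 1) ^ r * (\<Prod>k<r. B k (u k))"
    proof (intro mult_left_mono prod_mono conjI)
      fix k assume "k \<in> {..<r}"
      then show "norm (kern (p k) (s k) (u k)) * exp (- Re (ray (p k) (u k)) / 2) \<le> B k (u k)"
        using s [of k] dk [of k] by (intro B') auto
    qed (use M in auto)
    finally show "norm (integrand g p s r z u) \<le> (M * exp 1) ^ r * (\<Prod>k<r. B k (u k))" .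
  qed
qed

text \<open>Joint measurability makes \<open>multi\<close> measurable in z, as one more outer
  integration requires.\<close>

lemma integrand_measurable2:
  assumes g: "g \<in> borel_measurable borel" and p: "\<And>k. k < r \<Longrightarrow> p k \<ge> 0"
  shows "(\<lambda>(z, u). integrand g p s r z u) \<in> borel_measurable (borel \<Otimes>\<^sub>M Pi\<^sub>M {..<r} (\<lambda>_. lborel))"
    (is "_ \<in> borel_measurable ?N")
proof -
  have comp: "(\<lambda>zu. snd zu k) \<in> borel_measurable ?N" if "k < r" for k
    using measurable_compose [OF measurable_snd measurable_component_singleton [of k "{..<r}" "\<lambda>_. lborel :: real measure"]] that
    by simp
  have "(\<lambda>zu. gprod g r (fst zu) (\<lambda>k. ray (p k) (snd zu k))) \<in> borel_measurable ?N"
    unfolding gprod_def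
  proof (intro borel_measurable_prod measurable_compose [OF _ g] borel_measurable_add borel_measurable_sum measurable_fst)
    fix j k assume "k \<in> {j..<r}"
    then show "(\<lambda>zu. ray (p k) (snd zu k)) \<in> borel_measurable ?N"
      by (intro measurable_compose [OF comp ray_measurable]) auto
  qed
  moreover have "(\<lambda>zu. \<Prod>k<r. kern (p k) (s k) (snd zu k)) \<in> borel_measurable ?N"
    using p by (intro borel_measurable_prod measurable_compose [OF comp kern_measurable]) auto
  ultimately show ?thesis
    unfolding integrand_def [abs_def] case_prod_beta by (rule borel_measurable_times)
qed

lemma integrand_measurable:
  assumes "g \<in> borel_measurable borel" and "\<And>k. k < r \<Longrightarrow> p k \<ge> 0"
  shows "integrand g p s r z \<in> borel_measurable (Pi\<^sub>M {..<r} (\<lambda>_. lborel))"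
  using measurable_compose [OF measurable_Pair1' [of z] integrand_measurable2 [OF assms]] by simp

lemma multi_measurable:
  assumes "g \<in> borel_measurable borel" and "\<And>k. k < r \<Longrightarrow> p k \<ge> 0"
  shows "multi g p s r \<in> borel_measurable borel"
proof -
  interpret sigma_finite_measure "Pi\<^sub>M {..<r} (\<lambda>_. lborel :: real measure)"
    by (rule lborel_product.sigma_finite) simp
  show ?thesis
    unfolding multi_def [abs_def]
    using integrand_measurable2 [OF assms] by (rule borel_measurable_lebesgue_integral)
qed

lemma weyl_measurable:
  assumes "p \<ge> 0" "f \<in> borel_measurable borel"
  shows "(\<lambda>u. kern p s u * f (z + ray p u)) \<in> borel_measurable lborel"
proof -
  note [measurable] = kern_measurable [OF assms(1)] assms(2)
  show ?thesis by measurable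
qed

text \<open>The family \<open>p\<close> lets some variables run over the ray and others over
  contours at the same time, as exponents on both sides of the imaginary axis require.\<close>

locale iterated =
  fixes p :: "nat \<Rightarrow> real" and s :: "nat \<Rightarrow> complex" and r :: nat and \<eta> :: real
  assumes p: "\<And>k. k < r \<Longrightarrow> 0 \<le> p k \<and> p k \<le> \<eta>" and \<eta>: "\<eta> \<ge> 0"
    and s: "\<And>k. k < r \<Longrightarrow> s k \<in> adm (p k)"
begin

lemma domination:
  obtains B where "integrable (Pi\<^sub>M {..<r} (\<lambda>_. lborel)) B"
    "\<And>g M z u. bounded_by M g \<Longrightarrow> z \<in> half_strip (2 - real r * \<eta>) \<Longrightarrow>
      norm (integrand g p s r z u) \<le> (M * exp 1) ^ r * B u"
proof -
  obtain \<delta> B where "\<delta> > 0" and *: "integrable (Pi\<^sub>M {..<r} (\<lambda>_. lborel)) B"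
    "\<And>g M z s' u. bounded_by M g \<Longrightarrow> z \<in> half_strip (2 - real r * \<eta>) \<Longrightarrow>
      (\<And>k. k < r \<Longrightarrow> s' k \<in> ball (s k) \<delta>) \<Longrightarrow>
      norm (integrand g p s' r z u) \<le> (M * exp 1) ^ r * B u"
    using integrand_bound [of r p \<eta> s] p \<eta> s by blast
  show ?thesis
    by (rule that [OF *(1)]) (use *(2) \<open>\<delta> > 0\<close> in simp)
qed

lemma integrable_integrand:
  assumes "bounded_by M g" "g \<in> borel_measurable borel" "z \<in> half_strip (2 - real r * \<eta>)"
  shows "integrable (Pi\<^sub>M {..<r} (\<lambda>_. lborel)) (integrand g p s r z)"
proof -
  obtain B where B: "integrable (Pi\<^sub>M {..<r} (\<lambda>_. lborel)) B"
    "\<And>g M z u. bounded_by M g \<Longrightarrow> z \<in> half_strip (2 - real r * \<eta>) \<Longrightarrow>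
      norm (integrand g p s r z u) \<le> (M * exp 1) ^ r * B u"
    using domination by blast
  have "integrable (Pi\<^sub>M {..<r} (\<lambda>_. lborel)) (\<lambda>u. (M * exp 1) ^ r * B u)"
    using B(1) by simp
  then show ?thesis
    by (rule Bochner_Integration.integrable_bound)
      (use assms p B(2) in \<open>auto intro!: integrand_measurable AE_I2 order_trans [OF _ abs_ge_self]\<close>)
qed

lemma multi_bounded:
  assumes "bounded_by M g" "g \<in> borel_measurable borel"
  obtains C where "C \<ge> 0" "\<And>z. z \<in> half_strip (2 - real r * \<eta>) \<Longrightarrow> norm (multi g p s r z) \<le> C"
proof -
  obtain B where B: "integrable (Pi\<^sub>M {..<r} (\<lambda>_. lborel)) B"
    "\<And>g M z u. bounded_by M g \<Longrightarrow> z \<in> half_strip (2 - real r * \<eta>) \<Longrightarrow>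
      norm (integrand g p s r z u) \<le> (M * exp 1) ^ r * B u"
    using domination by blast
  define C where "C = (\<integral>u. (M * exp 1) ^ r * B u \<partial>Pi\<^sub>M {..<r} (\<lambda>_. lborel))"
  have C: "norm (multi g p s r z) \<le> C" if z: "z \<in> half_strip (2 - real r * \<eta>)" for z
  proof -
    have int: "integrable (Pi\<^sub>M {..<r} (\<lambda>_. lborel)) (integrand g p s r z)"
      using assms z by (rule integrable_integrand)
    have "norm (multi g p s r z) \<le> (\<integral>u. norm (integrand g p s r z u) \<partial>Pi\<^sub>M {..<r} (\<lambda>_. lborel))"
      unfolding multi_def by (rule integral_norm_bound)
    also have "\<dots> \<le> C"
      unfolding C_def using int B(1) B(2) [OF assms(1) z] by (intro integral_mono) auto
    finally show ?thesis .
  qed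
  show ?thesis
    by (rule that [of "\<bar>C\<bar>"]) (use C in \<open>auto intro: order_trans [OF _ abs_ge_self]\<close>)
qed

lemma gprod_holomorphic:
  assumes "g holomorphic_on half_strip 2" "\<eta> \<ge> 0"
  shows "(\<And>k. k < r \<Longrightarrow> 0 \<le> p k \<and> p k \<le> \<eta>) \<Longrightarrow>
    (\<lambda>z. gprod g r z (\<lambda>k. ray (p k) (u k))) holomorphic_on half_strip (2 - real r * \<eta>)"
proof (induction r)
  case 0
  then show ?case by (simp add: gprod_def)
next
  case (Suc r)
  let ?t = "ray (p r) (u r)"
  have z: "z + ?t \<in> half_strip (2 - real r * \<eta>)" if "z \<in> half_strip (2 - real (Suc r) * \<eta>)" for z
    using add_ray_half_strip [of "p r" \<eta> z "2 - real (Suc r) * \<eta>" "u r"] Suc.prems that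
    by (simp add: algebra_simps)
  then have z2: "z + ?t \<in> half_strip 2" if "z \<in> half_strip (2 - real (Suc r) * \<eta>)" for z
    using half_strip_mono [of "2 - real r * \<eta>" 2] assms(2) that by auto
  have t: "(\<lambda>z. z + ?t) holomorphic_on half_strip (2 - real (Suc r) * \<eta>)"
    by (intro holomorphic_intros)
  have "(g \<circ> (\<lambda>z. z + ?t)) holomorphic_on half_strip (2 - real (Suc r) * \<eta>)"
    by (rule holomorphic_on_compose_gen [OF t assms(1)]) (use z2 in auto)
  moreover have "((\<lambda>z. gprod g r z (\<lambda>k. ray (p k) (u k))) \<circ> (\<lambda>z. z + ?t)) holomorphic_on half_strip (2 - real (Suc r) * \<eta>)"
  proof (rule holomorphic_on_compose_gen [OF t])
    show "(\<lambda>z. gprod g r z (\<lambda>k. ray (p k) (u k))) holomorphic_on half_strip (2 - real r * \<eta>)"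
      using Suc.prems by (intro Suc.IH) simp
  qed (use z in auto)
  ultimately have "(\<lambda>z. g (z + ?t) * gprod g r (z + ?t) (\<lambda>k. ray (p k) (u k))) holomorphic_on half_strip (2 - real (Suc r) * \<eta>)"
    unfolding o_def by (rule holomorphic_on_mult)
  then show ?case by (simp only: gprod_Suc)
qed

lemma gprod_tendsto:
  assumes "\<And>w. w \<in> half_strip 2 \<Longrightarrow> (\<lambda>n. G n w) \<longlonglongrightarrow> g w" "\<eta> \<ge> 0"
  shows "(\<And>k. k < r \<Longrightarrow> 0 \<le> p k \<and> p k \<le> \<eta>) \<Longrightarrow> z \<in> half_strip (2 - real r * \<eta>) \<Longrightarrow>
    (\<lambda>n. gprod (G n) r z (\<lambda>k. ray (p k) (u k))) \<longlonglongrightarrow> gprod g r z (\<lambda>k. ray (p k) (u k))"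
proof (induction r arbitrary: z)
  case 0
  then show ?case by (simp add: gprod_def)
next
  case (Suc r)
  let ?t = "ray (p r) (u r)"
  have z: "z + ?t \<in> half_strip (2 - real r * \<eta>)"
    using add_ray_half_strip [of "p r" \<eta> z "2 - real (Suc r) * \<eta>" "u r"] Suc.prems
    by (simp add: algebra_simps)
  then have z2: "z + ?t \<in> half_strip 2"
    using half_strip_mono [of "2 - real r * \<eta>" 2] assms(2) by auto
  show ?case
    unfolding gprod_Suc using Suc.prems(1) by (intro tendsto_mult assms(1) z2 Suc.IH z) simp
qed

lemma multi_holomorphic:
  assumes g: "bounded_by M g" "g \<in> borel_measurable borel" "g holomorphic_on half_strip 2"
  shows "multi g p s r holomorphic_on half_strip (2 - real r * \<eta>)"
  unfolding multi_def [abs_def]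
proof (rule holomorphic_integral)
  fix u
  show "(\<lambda>z. integrand g p s r z u) holomorphic_on half_strip (2 - real r * \<eta>)"
    unfolding integrand_def using g(3) \<eta> p
    by (intro holomorphic_on_mult gprod_holomorphic holomorphic_on_const) auto
next
  fix z
  show "integrand g p s r z \<in> borel_measurable (Pi\<^sub>M {..<r} (\<lambda>_. lborel))"
    using g p by (intro integrand_measurable) auto
next
  fix z0
  obtain B where B: "integrable (Pi\<^sub>M {..<r} (\<lambda>_. lborel)) B"
    "\<And>g M z u. bounded_by M g \<Longrightarrow> z \<in> half_strip (2 - real r * \<eta>) \<Longrightarrow>
      norm (integrand g p s r z u) \<le> (M * exp 1) ^ r * B u"
    using domination by blast
  show "\<exists>\<delta>>0. \<exists>B. integrable (Pi\<^sub>M {..<r} (\<lambda>_. lborel)) B \<and>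
      (\<forall>z\<in>ball z0 \<delta> \<inter> half_strip (2 - real r * \<eta>). \<forall>u\<in>space (Pi\<^sub>M {..<r} (\<lambda>_. lborel)).
        norm (integrand g p s r z u) \<le> B u)"
    using B g(1) by (intro exI [of _ 1] conjI exI [of _ "\<lambda>u. (M * exp 1) ^ r * B u"]) auto
qed (rule open_half_strip)

lemma multi_holomorphic_s:
  assumes g: "bounded_by M g" "g \<in> borel_measurable borel"
    and z: "z \<in> half_strip (2 - real r * \<eta>)" and i: "i < r"
  shows "(\<lambda>w. multi g p (s(i := w)) r z) holomorphic_on adm (p i)"
  unfolding multi_def
proof (rule holomorphic_integral)
  fix u
  have "(\<lambda>w. kern (p k) ((s(i := w)) k) (u k)) holomorphic_on adm (p i)" for k
    by (cases "k = i") (simp_all add: kern_holomorphic)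
  then show "(\<lambda>w. integrand g p (s(i := w)) r z u) holomorphic_on adm (p i)"
    unfolding integrand_def by (intro holomorphic_on_mult holomorphic_on_const holomorphic_on_prod)
next
  fix w
  show "integrand g p (s(i := w)) r z \<in> borel_measurable (Pi\<^sub>M {..<r} (\<lambda>_. lborel))"
    using g p by (intro integrand_measurable) auto
next
  fix w0 assume "w0 \<in> adm (p i)"
  then have "(s(i := w0)) k \<in> adm (p k)" if "k < r" for k using s that by auto
  then obtain \<delta> B where \<delta>: "\<delta> > 0" and B: "integrable (Pi\<^sub>M {..<r} (\<lambda>_. lborel)) B"
    "\<And>g M z s' u. bounded_by M g \<Longrightarrow> z \<in> half_strip (2 - real r * \<eta>) \<Longrightarrow>
      (\<And>k. k < r \<Longrightarrow> s' k \<in> ball ((s(i := w0)) k) \<delta>) \<Longrightarrow>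
      norm (integrand g p s' r z u) \<le> (M * exp 1) ^ r * B u"
    using integrand_bound [of r p \<eta> "s(i := w0)"] p \<eta> by blast
  show "\<exists>\<delta>>0. \<exists>B. integrable (Pi\<^sub>M {..<r} (\<lambda>_. lborel)) B \<and>
      (\<forall>w\<in>ball w0 \<delta> \<inter> adm (p i). \<forall>u\<in>space (Pi\<^sub>M {..<r} (\<lambda>_. lborel)).
        norm (integrand g p (s(i := w)) r z u) \<le> B u)"
  proof (intro exI [of _ \<delta>] conjI exI [of _ "\<lambda>u. (M * exp 1) ^ r * B u"] ballI \<delta>)
    fix w u assume "w \<in> ball w0 \<delta> \<inter> adm (p i)"
    then show "norm (integrand g p (s(i := w)) r z u) \<le> (M * exp 1) ^ r * B u"
      using \<delta> by (intro B(2) g z) auto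
  qed (use B(1) in simp)
qed (rule open_adm)

lemma multi_tendsto_s:
  assumes g: "bounded_by M g" "g \<in> borel_measurable borel"
    and z: "z \<in> half_strip (2 - real r * \<eta>)"
    and lim: "\<And>k. k < r \<Longrightarrow> (\<lambda>n. S n k) \<longlonglongrightarrow> s k"
  shows "(\<lambda>n. multi g p (S n) r z) \<longlonglongrightarrow> multi g p s r z"
proof -
  obtain \<delta> B where \<delta>: "\<delta> > 0" and B: "integrable (Pi\<^sub>M {..<r} (\<lambda>_. lborel)) B"
    "\<And>g M z s' u. bounded_by M g \<Longrightarrow> z \<in> half_strip (2 - real r * \<eta>) \<Longrightarrow>
      (\<And>k. k < r \<Longrightarrow> s' k \<in> ball (s k) \<delta>) \<Longrightarrow>
      norm (integrand g p s' r z u) \<le> (M * exp 1) ^ r * B u"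
    using integrand_bound [of r p \<eta> s] p \<eta> s by blast
  have "\<forall>k\<in>{..<r}. \<forall>\<^sub>F n in sequentially. S n k \<in> ball (s k) \<delta>"
    using lim \<delta> by (auto intro!: topological_tendstoD simp del: mem_ball)
  then have "\<forall>\<^sub>F n in sequentially. \<forall>k\<in>{..<r}. S n k \<in> ball (s k) \<delta>"
    by (intro eventually_ball_finite) auto
  then obtain N where N: "\<And>n k. n \<ge> N \<Longrightarrow> k < r \<Longrightarrow> S n k \<in> ball (s k) \<delta>"
    by (auto simp: eventually_sequentially)
  have "(\<lambda>n. multi g p (S (n + N)) r z) \<longlonglongrightarrow> multi g p s r z"
    unfolding multi_def
  proof (rule integral_dominated_convergence [where w = "\<lambda>u. (M * exp 1) ^ r * B u"])
    show "AE u in Pi\<^sub>M {..<r} (\<lambda>_. lborel). (\<lambda>n. integrand g p (S (n + N)) r z u) \<longlonglongrightarrow> integrand g p s r z u"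
    proof (intro AE_I2)
      fix u
      have "(\<lambda>n. kern (p k) (S (n + N) k) (u k)) \<longlonglongrightarrow> kern (p k) (s k) (u k)" if "k < r" for k
      proof -
        have "isCont (\<lambda>w. kern (p k) w (u k)) (s k)"
          using holomorphic_on_imp_continuous_on [OF kern_holomorphic] s [OF that]
          by (simp add: continuous_on_eq_continuous_at open_adm)
        then show ?thesis
          by (rule isCont_tendsto_compose) (rule LIMSEQ_ignore_initial_segment [OF lim [OF that]])
      qed
      then show "(\<lambda>n. integrand g p (S (n + N)) r z u) \<longlonglongrightarrow> integrand g p s r z u"
        unfolding integrand_def by (intro tendsto_mult tendsto_const tendsto_prod) simp
    qed
    show "AE u in Pi\<^sub>M {..<r} (\<lambda>_. lborel). norm (integrand g p (S (n + N)) r z u) \<le> (M * exp 1) ^ r * B u" for n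
      using N by (intro AE_I2 B(2) g z) auto
  qed (use B(1) g p in \<open>auto intro!: integrand_measurable\<close>)
  then show ?thesis by (rule LIMSEQ_offset)
qed

lemma multi_tendsto_g:
  assumes G: "\<And>n. bounded_by M (G n)" "\<And>n. G n \<in> borel_measurable borel" "g \<in> borel_measurable borel"
    and z: "z \<in> half_strip (2 - real r * \<eta>)"
    and lim: "\<And>w. w \<in> half_strip 2 \<Longrightarrow> (\<lambda>n. G n w) \<longlonglongrightarrow> g w"
  shows "(\<lambda>n. multi (G n) p s r z) \<longlonglongrightarrow> multi g p s r z"
proof -
  obtain B where B: "integrable (Pi\<^sub>M {..<r} (\<lambda>_. lborel)) B"
    "\<And>g M z u. bounded_by M g \<Longrightarrow> z \<in> half_strip (2 - real r * \<eta>) \<Longrightarrow>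
      norm (integrand g p s r z u) \<le> (M * exp 1) ^ r * B u"
    using domination by blast
  show ?thesis
    unfolding multi_def
  proof (rule integral_dominated_convergence [where w = "\<lambda>u. (M * exp 1) ^ r * B u"])
    show "AE u in Pi\<^sub>M {..<r} (\<lambda>_. lborel). (\<lambda>n. integrand (G n) p s r z u) \<longlonglongrightarrow> integrand g p s r z u"
      unfolding integrand_def using lim \<eta> p z
      by (intro AE_I2 tendsto_mult tendsto_const gprod_tendsto) auto
    show "AE u in Pi\<^sub>M {..<r} (\<lambda>_. lborel). norm (integrand (G n) p s r z u) \<le> (M * exp 1) ^ r * B u" for n
      by (intro AE_I2 B(2) G z)
  qed (use B(1) G p in \<open>auto intro!: integrand_measurable\<close>)
qed

end

lemma integrand_Suc:
  "integrand g p s (Suc r) z u =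
    kern (p r) (s r) (u r) * (g (z + ray (p r) (u r)) * integrand g p s r (z + ray (p r) (u r)) u)"
  by (simp add: integrand_def gprod_Suc)

lemma weyl_multi_measurable:
  assumes "g \<in> borel_measurable borel" "\<And>k. k < Suc r \<Longrightarrow> p k \<ge> 0"
  shows "(\<lambda>v. kern (p r) (s r) v * (g (z + ray (p r) v) * multi g p s r (z + ray (p r) v)))
    \<in> borel_measurable lborel"
  by (rule weyl_measurable [where f = "\<lambda>w. g w * multi g p s r w"])
    (use assms in \<open>auto intro!: borel_measurable_times multi_measurable\<close>)

text \<open>Fubini with the last variable outermost: by \<open>gprod_Suc\<close> it acts on the
  inner integral only through the shift of z.\<close>

lemma multi_Suc:
  assumes it: "iterated p s (Suc r) \<eta>" and g: "bounded_by M g" "g \<in> borel_measurable borel"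
    and z: "z \<in> half_strip (2 - real (Suc r) * \<eta>)"
  shows "multi g p s (Suc r) z = weyl (p r) (s r) (\<lambda>w. g w * multi g p s r w) z"
proof -
  interpret iterated p s "Suc r" \<eta> by (rule it)
  have un: "{..<Suc r} = {r} \<union> {..<r}" by auto
  have int: "integrable (Pi\<^sub>M ({r} \<union> {..<r}) (\<lambda>_. lborel)) (integrand g p s (Suc r) z)"
    using integrable_integrand [OF g z] by (simp only: un)
  let ?h = "\<lambda>v. kern (p r) (s r) v * (g (z + ray (p r) v) * multi g p s r (z + ray (p r) v))"
  have "multi g p s (Suc r) z = (\<integral>x. (\<integral>y. integrand g p s (Suc r) z (merge {r} {..<r} (x, y))
      \<partial>Pi\<^sub>M {..<r} (\<lambda>_. lborel)) \<partial>Pi\<^sub>M {r} (\<lambda>_. lborel))"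
    unfolding multi_def un by (rule lborel_product.product_integral_fold [OF _ _ _ int]) auto
  also have "\<dots> = (\<integral>x. ?h (x r) \<partial>Pi\<^sub>M {r} (\<lambda>_. lborel))"
  proof (intro Bochner_Integration.integral_cong refl)
    fix x :: "nat \<Rightarrow> real"
    have "merge {r} {..<r} (x, y) r = x r" for y by (simp add: merge_def)
    moreover have "integrand g p s r w (merge {r} {..<r} (x, y)) = integrand g p s r w y" for w y
      unfolding integrand_def gprod_def
      by (intro arg_cong2 [where f = "(*)"] prod.cong refl arg_cong [where f = g] arg_cong2 [where f = "(+)"] sum.cong)
        (auto simp: merge_def)
    ultimately show "(\<integral>y. integrand g p s (Suc r) z (merge {r} {..<r} (x, y)) \<partial>Pi\<^sub>M {..<r} (\<lambda>_. lborel)) = ?h (x r)"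
      by (simp add: integrand_Suc multi_def)
  qed
  also have "\<dots> = (\<integral>v. ?h v \<partial>lborel)"
  proof (rule lborel_product.product_integral_singleton)
    show "?h \<in> borel_measurable lborel"
      using p by (intro weyl_multi_measurable g) auto
  qed
  finally show ?thesis by (simp add: weyl_def)
qed

lemma weyl_cong:
  assumes "0 \<le> p" "p \<le> \<eta>" "z \<in> half_strip a" "\<And>w. w \<in> half_strip (a + \<eta>) \<Longrightarrow> f w = h w"
  shows "weyl p s f z = weyl p s h z"
  unfolding weyl_def using assms add_ray_half_strip
  by (intro Bochner_Integration.integral_cong refl) simp

text \<open>Serves to show that, for given z, the shifted argument vanishes only on a null set of
  parameters.\<close>

lemma finite_ray_eq:
  assumes "p \<ge> 0"
  shows "finite {u. ray p u = c}"
proof (cases "p = 0")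
  case True
  have "{u. ray p u = c} \<subseteq> {Re c, - Re c}"
    using True by (auto simp: ray_def abs_if split: if_splits)
  then show ?thesis by (rule finite_subset) simp
next
  case False
  then have p: "p > 0" using assms by simp
  have "{u. ray p u = c} \<subseteq> {p - Re c, Re c - p + 2 * pi} \<union> {2 * pi} \<union> ({u. ray p u = c} \<inter> {0..<2 * pi})"
  proof
    fix u assume u: "u \<in> {u. ray p u = c}"
    consider "u \<le> 0" | "0 \<le> u" "u < 2 * pi" | "u \<ge> 2 * pi" by linarith
    then show "u \<in> {p - Re c, Re c - p + 2 * pi} \<union> {2 * pi} \<union> ({u. ray p u = c} \<inter> {0..<2 * pi})"
      using u False by cases (auto simp: ray_def hankel_cases(1,3) [OF p])
  qed
  moreover have "finite ({u. ray p u = c} \<inter> {0..<2 * pi})"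
  proof -
    have "u = v" if "u \<in> {0..<2 * pi}" "v \<in> {0..<2 * pi}" "ray p u = c" "ray p v = c" for u v
    proof -
      have "exp (\<i> * complex_of_real u) = exp (\<i> * complex_of_real v)"
      proof -
        have "of_real p * exp (\<i> * complex_of_real u) = of_real p * exp (\<i> * complex_of_real v)"
          using that p False by (simp add: ray_def hankel_cases(2) [OF p])
        then show ?thesis using p by simp
      qed
      then have "\<i> * complex_of_real u = \<i> * complex_of_real v"
        by (rule exp_complex_eqI [rotated]) (use that in auto)
      then show ?thesis by simp
    qed
    then have "{u. ray p u = c} \<inter> {0..<2 * pi} = {} \<or> (\<exists>v. {u. ray p u = c} \<inter> {0..<2 * pi} = {v})"
      by blast
    then show ?thesis by (metis finite.emptyI finite.insertI)
  qed
  ultimately show ?thesis using finite_subset by blast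
qed

text \<open>
  The integrand of \<open>hankel_integral\<close> has the junk value 0 where a partial sum of the variables vanishes,
  while \<open>gen 0\<close> is not 0.
\<close>

lemma multi_cong_AE:
  assumes g: "bounded_by M g" "g \<in> borel_measurable borel"
    and h: "bounded_by M h" "h \<in> borel_measurable borel"
    and eq: "\<And>w. w \<noteq> 0 \<Longrightarrow> g w = h w"
  shows "iterated p s r \<eta> \<Longrightarrow> z \<in> half_strip (2 - real r * \<eta>) \<Longrightarrow> multi g p s r z = multi h p s r z"
proof (induction r arbitrary: z)
  case 0
  show ?case by (simp add: multi_def integrand_def gprod_def)
next
  case (Suc r)
  interpret iterated p s "Suc r" \<eta> by (rule Suc.prems)
  have it: "iterated p s r \<eta>" using p \<eta> s by unfold_locales auto
  have pr: "0 \<le> p r" "p r \<le> \<eta>" using p [of r] by auto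
  have "weyl (p r) (s r) (\<lambda>w. g w * multi g p s r w) z = weyl (p r) (s r) (\<lambda>w. h w * multi h p s r w) z"
    unfolding weyl_def
  proof (rule integral_cong_AE)
    have "AE v in lborel. v \<notin> {u. ray (p r) u = - z}"
      using finite_ray_eq [OF pr(1)] by (intro AE_not_in finite_imp_null_set_lborel)
    then show "AE v in lborel. kern (p r) (s r) v * (g (z + ray (p r) v) * multi g p s r (z + ray (p r) v))
        = kern (p r) (s r) v * (h (z + ray (p r) v) * multi h p s r (z + ray (p r) v))"
    proof eventually_elim
      case (elim v)
      then have "z + ray (p r) v \<noteq> 0" by (simp add: add_eq_0_iff)
      moreover have "z + ray (p r) v \<in> half_strip (2 - real r * \<eta>)"
        using add_ray_half_strip [OF pr Suc.prems(2), of v] by (simp add: algebra_simps)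
      ultimately show ?case using eq Suc.IH [OF it] by simp
    qed
  qed (use p in \<open>auto intro!: weyl_multi_measurable [unfolded measurable_lborel2] g h\<close>)
  then show ?case
    using multi_Suc [OF Suc.prems(1) g Suc.prems(2)] multi_Suc [OF Suc.prems(1) h Suc.prems(2)] by simp
qed

section \<open>Independence of the path\<close>

text \<open>The monodromy factor of t^s along a loop around 0.\<close>

definition monod :: "complex \<Rightarrow> complex" where
  "monod s = exp (2 * pi * \<i> * s)"

definition tail :: "complex \<Rightarrow> (complex \<Rightarrow> complex) \<Rightarrow> complex \<Rightarrow> real \<Rightarrow> complex" where
  "tail s f z p = (LINT t:{p<..}|lborel. f (z + of_real t) * exp ((s - 1) * of_real (ln t)))"

text \<open>On the circle dt = i t du, and this factor t raises the exponent from s - 1 to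
  s.\<close>

definition circ :: "complex \<Rightarrow> (complex \<Rightarrow> complex) \<Rightarrow> complex \<Rightarrow> real \<Rightarrow> complex" where
  "circ s f z p = integral {0..2 * pi}
     (\<lambda>u. \<i> * (f (z + exp (Complex (ln p) u)) * exp (s * Complex (ln p) u)))"

lemma weyl_integrable:
  assumes f: "decays b f" "f \<in> borel_measurable borel"
    and p: "0 \<le> p" "p \<le> \<eta>" and s: "s \<in> adm p" and z: "z \<in> half_strip (b - \<eta>)"
  shows "integrable lborel (\<lambda>u. kern p s u * f (z + ray p u))"
proof -
  obtain a where a: "a < b - \<eta>" "z \<in> half_strip a" using half_strip_smaller z by blast
  then have "a + \<eta> < b" by simp
  obtain C where C: "C \<ge> 0" "\<And>w. w \<in> half_strip (a + \<eta>) \<Longrightarrow> norm (f w) \<le> C * exp (- Re w / 2)"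
    using decays_bound [OF f(1) \<open>a + \<eta> < b\<close>] by blast
  obtain \<delta> B where \<delta>: "\<delta> > 0" and B: "integrable lborel B"
    "\<forall>s\<in>ball s \<delta>. \<forall>u. norm (kern p s u) * exp (- Re (ray p u) / 2) \<le> B u"
    using kern_bound [OF p(1) s] by blast
  have "integrable lborel (\<lambda>u. C * exp (- Re z / 2) * B u)" using B(1) by simp
  then show ?thesis
  proof (rule Bochner_Integration.integrable_bound)
    show "AE u in lborel. norm (kern p s u * f (z + ray p u)) \<le> norm (C * exp (- Re z / 2) * B u)"
    proof (intro AE_I2)
      fix u
      have "norm (kern p s u * f (z + ray p u)) \<le> norm (kern p s u) * (C * exp (- Re (z + ray p u) / 2))"
        unfolding norm_mult by (intro mult_left_mono C(2) add_ray_half_strip [OF p a(2)]) auto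
      also have "\<dots> = C * exp (- Re z / 2) * (norm (kern p s u) * exp (- Re (ray p u) / 2))"
      proof -
        have "exp (- Re (z + ray p u) / 2) = exp (- Re z / 2) * exp (- Re (ray p u) / 2)"
          by (simp add: diff_divide_distrib flip: exp_add)
        then show ?thesis by (simp only: mult_ac)
      qed
      also have "\<dots> \<le> C * exp (- Re z / 2) * B u"
        using B(2) \<delta> C(1) by (intro mult_left_mono) auto
      finally show "norm (kern p s u * f (z + ray p u)) \<le> norm (C * exp (- Re z / 2) * B u)"
        by simp
    qed
  qed (rule weyl_measurable [OF p(1) f(2)])
qed

lemma weyl_0: "weyl 0 s f z = rGamma s * tail s f z 0"
proof -
  have "weyl 0 s f z = (\<integral>u. rGamma s * (indicator {0<..} u *\<^sub>R (f (z + of_real u) * exp ((s - 1) * of_real (ln u)))) \<partial>lborel)"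
    unfolding weyl_def
    by (intro Bochner_Integration.integral_cong refl) (auto simp: kern_def coef_def ray_def)
  then show ?thesis
    by (simp only: tail_def set_lebesgue_integral_def integral_mult_right_zero)
qed

lemma coef_nonzero: "p \<noteq> 0 \<Longrightarrow> s \<in> adm p \<Longrightarrow> coef p s \<noteq> 0"
  by (simp add: coef_def adm_def Gamma_eq_zero_iff)

lemma tail_integrable:
  assumes f: "decays b f" and z: "z \<in> half_strip b" and "p \<ge> 0" "p > 0 \<or> Re s > 0"
  shows "set_integrable lborel {p<..} (\<lambda>t. f (z + of_real t) * exp ((s - 1) * of_real (ln t)))"
proof -
  obtain C where C: "C \<ge> 0" "\<And>t. t \<ge> 0 \<Longrightarrow> norm (f (z + of_real t)) \<le> C * exp (- t / 2)"
    using decays_line [OF f z] by blast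
  \<comment> \<open>For Re s <= 0 the lower limit p is positive and t^(Re s - 1) is at most the
    constant p^(Re s - 1); the exponent c = 1 then makes the power of t trivial.\<close>
  define c where "c = (if Re s > 0 then Re s else 1)"
  define K where "K = (if Re s > 0 then 1 else p powr (Re s - 1))"
  have c: "c > 0" by (simp add: c_def)
  have K: "t powr (Re s - 1) \<le> K * t powr (c - 1)" if "t > p" for t
  proof (cases "Re s > 0")
    case True
    then show ?thesis by (simp add: K_def c_def)
  next
    case False
    then have "p > 0" using assms by simp
    then have "t powr (Re s - 1) \<le> p powr (Re s - 1)"
      using that False by (intro powr_mono2') auto
    then show ?thesis using False that \<open>p > 0\<close> by (simp add: K_def c_def)
  qed
  have "continuous_on {p<..} (\<lambda>t. f (z + of_real t) * exp ((s - 1) * of_real (ln t)))"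
  proof (intro continuous_on_mult)
    show "continuous_on {p<..} (\<lambda>t. f (z + of_real t))"
      using assms f isCont_line [OF _ half_strip_add_nonneg [OF z]]
      by (intro continuous_at_imp_continuous_on) (auto simp: decays_def)
    show "continuous_on {p<..} (\<lambda>t. exp ((s - 1) * of_real (ln t)))"
      using assms by (intro continuous_intros) auto
  qed
  then have meas: "set_borel_measurable lborel {p<..} (\<lambda>t. f (z + of_real t) * exp ((s - 1) * of_real (ln t)))"
    unfolding set_borel_measurable_def by (auto intro!: borel_measurable_continuous_on_indicator)
  have "set_integrable lborel {p<..} (\<lambda>t::real. t powr (c - 1) * exp (- t / 2))"
    by (rule set_integrable_subset [OF powr_exp_integrable [OF c]]) (use assms in auto)
  then have int: "set_integrable lborel {p<..} (\<lambda>t::real. (C * K) * (t powr (c - 1) * exp (- t / 2)))"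
    by (rule set_integrable_mult_right)
  show ?thesis
  proof (rule set_integrable_bound [OF int meas], intro AE_I2 impI)
    fix t assume "t \<in> {p<..}"
    then have t: "t > p" "t > 0" using assms by auto
    have "norm (exp ((s - 1) * of_real (ln t))) = t powr (Re s - 1)"
      using t by (simp add: powr_def)
    then have "norm (f (z + of_real t) * exp ((s - 1) * of_real (ln t))) \<le> (C * exp (- t / 2)) * (K * t powr (c - 1))"
      unfolding norm_mult using C K [OF t(1)] t by (intro mult_mono) auto
    also have "\<dots> = (C * K) * (t powr (c - 1) * exp (- t / 2))" by simp
    also have "\<dots> \<le> norm \<dots>" by simp
    finally show "norm (f (z + of_real t) * exp ((s - 1) * of_real (ln t))) \<le> norm ((C * K) * (t powr (c - 1) * exp (- t / 2)))" .
  qed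
qed

text \<open>The two straight pieces run over the same half line, inwards with weight -1 and outwards
  with the monodromy factor, which leaves one tail with the factor
  \<open>monod s - 1\<close>.\<close>

lemma weyl_Hankel:
  assumes f: "decays b f" "f \<in> borel_measurable borel"
    and p: "0 < p" "p \<le> \<eta>" and s: "s \<in> adm p" and z: "z \<in> half_strip (b - \<eta>)"
  shows "weyl p s f z = coef p s * (circ s f z p + (monod s - 1) * tail s f z p)"
proof -
  define h where "h u = exp ((s - 1) * hankel_log p u) * vector_derivative (hankel p) (at u) * f (z + hankel p u)" for u
  have kern: "kern p s u * f (z + ray p u) = coef p s * h u" for u
    using p by (simp add: kern_def ray_def h_def)
  have "integrable lborel (\<lambda>u. coef p s * h u)"
    using weyl_integrable [OF f _ p(2) s z] p by (simp add: kern)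
  then have "integrable lborel (\<lambda>u. inverse (coef p s) * (coef p s * h u))"
    by (rule integrable_mult_right)
  moreover have "coef p s \<noteq> 0" using coef_nonzero [OF _ s] p by simp
  ultimately have int: "integrable lborel h" by (simp flip: mult.assoc)
  then have si: "set_integrable lborel X h" if "X \<in> sets borel" for X
    using that by (auto simp: set_integrable_def intro!: integrable_mult_indicator)
  have pi: "0 \<le> 2 * pi" "0 < 2 * pi" using pi_gt_zero by linarith+
  have un: "(\<integral>u. h u \<partial>lborel) = (LINT u:{..<0}|lborel. h u) + (LINT u:{0..2 * pi}|lborel. h u) + (LINT u:{2 * pi<..}|lborel. h u)"
  proof -
    have *: "({..<0} \<union> {0..c}) \<inter> {c<..} = {}" "{..<0} \<inter> {0..c} = {}"
      "({..<0} \<union> {0..c}) \<union> {c<..} = UNIV" if "c > 0" for c :: real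
      using that by auto
    have "(LINT u:({..<0} \<union> {0..2 * pi}) \<union> {2 * pi<..}|lborel. h u)
        = (LINT u:{..<0} \<union> {0..2 * pi}|lborel. h u) + (LINT u:{2 * pi<..}|lborel. h u)"
      by (rule set_integral_Un [OF *(1) [OF pi(2)] si si]) auto
    also have "(LINT u:{..<0} \<union> {0..2 * pi}|lborel. h u) = (LINT u:{..<0}|lborel. h u) + (LINT u:{0..2 * pi}|lborel. h u)"
      by (rule set_integral_Un [OF *(2) [OF pi(2)] si si]) auto
    also note *(3) [OF pi(2)]
    finally show ?thesis by (simp add: set_lebesgue_integral_def)
  qed
  have hl1: "hankel_log p u = of_real (ln (p - u))" if "u < 0" for u
    using that by (simp add: hankel_log_def complex_eq_iff)
  have hl3: "hankel_log p u = of_real (ln (p + (u - 2 * pi))) + 2 * pi * \<i>" if "u > 2 * pi" for u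
  proof -
    have "\<not> u \<le> 0" using that pi by linarith
    then show ?thesis using that by (simp add: hankel_log_def complex_eq_iff)
  qed
  have "(LINT u:{..<0}|lborel. h u) = (\<integral>u. indicator {..<0} u *\<^sub>R h u \<partial>lborel)"
    by (simp add: set_lebesgue_integral_def)
  also have "\<dots> = \<bar>- 1\<bar> *\<^sub>R (\<integral>t. indicator {..<0} (p + (- 1) * t) *\<^sub>R h (p + (- 1) * t) \<partial>lborel)"
    by (rule lborel_integral_real_affine) simp
  also have "\<dots> = (\<integral>t. - (indicator {p<..} t *\<^sub>R (f (z + of_real t) * exp ((s - 1) * of_real (ln t)))) \<partial>lborel)"
  proof -
    have "indicator {..<0} (p + (- 1) * t) *\<^sub>R h (p + (- 1) * t)
        = - (indicator {p<..} t *\<^sub>R (f (z + of_real t) * exp ((s - 1) * of_real (ln t))))" for t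
    proof (cases "t > p")
      case True
      define u where "u = p + (- 1) * t"
      have u: "u < 0" "p - u = t" using True by (auto simp: u_def)
      have "h u = - (f (z + of_real t) * exp ((s - 1) * of_real (ln t)))"
        using u by (simp add: h_def hl1 hankel_vector_derivative(1) [OF p(1)] hankel_cases(1) [OF p(1)] del: of_real_diff)
      then show ?thesis using u True by (simp add: u_def)
    next
      case False
      then show ?thesis by simp
    qed
    then show ?thesis by simp
  qed
  also have "\<dots> = - tail s f z p" by (simp add: tail_def set_lebesgue_integral_def)
  finally have I1: "(LINT u:{..<0}|lborel. h u) = - tail s f z p" .
  have "exp ((s - 1) * (of_real x + 2 * pi * \<i>)) = monod s * exp ((s - 1) * of_real x)" for x
  proof -
    have "exp ((s - 1) * (of_real x + 2 * pi * \<i>)) = exp (2 * pi * \<i> * s + (s - 1) * of_real x - 2 * of_real pi * \<i>)"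
      by (simp add: algebra_simps)
    then show ?thesis by (simp add: exp_diff exp_add monod_def)
  qed
  note E = this
  have "(LINT u:{2 * pi<..}|lborel. h u) = (\<integral>u. indicator {2 * pi<..} u *\<^sub>R h u \<partial>lborel)"
    by (simp add: set_lebesgue_integral_def)
  also have "\<dots> = \<bar>1\<bar> *\<^sub>R (\<integral>t. indicator {2 * pi<..} ((2 * pi - p) + 1 * t) *\<^sub>R h ((2 * pi - p) + 1 * t) \<partial>lborel)"
    by (rule lborel_integral_real_affine) simp
  also have "\<dots> = (\<integral>t. monod s * (indicator {p<..} t *\<^sub>R (f (z + of_real t) * exp ((s - 1) * of_real (ln t)))) \<partial>lborel)"
  proof -
    have "indicator {2 * pi<..} ((2 * pi - p) + 1 * t) *\<^sub>R h ((2 * pi - p) + 1 * t)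
        = monod s * (indicator {p<..} t *\<^sub>R (f (z + of_real t) * exp ((s - 1) * of_real (ln t))))" for t
    proof (cases "t > p")
      case True
      define u where "u = (2 * pi - p) + 1 * t"
      have u: "u > 2 * pi" "p + (u - 2 * pi) = t" using True by (auto simp: u_def)
      have "h u = exp ((s - 1) * (of_real (ln t) + 2 * pi * \<i>)) * f (z + of_real t)"
        using u by (simp add: h_def hl3 hankel_vector_derivative(3) [OF p(1)] hankel_cases(3) [OF p(1)] del: of_real_add of_real_diff)
      then have "h u = monod s * (f (z + of_real t) * exp ((s - 1) * of_real (ln t)))"
        unfolding E by simp
      then show ?thesis using u True by (simp add: u_def)
    next
      case False
      then show ?thesis by simp
    qed
    then show ?thesis by simp
  qed
  also have "\<dots> = monod s * tail s f z p"
    by (simp only: tail_def set_lebesgue_integral_def integral_mult_right_zero)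
  finally have I3: "(LINT u:{2 * pi<..}|lborel. h u) = monod s * tail s f z p" .
  have "(LINT u:{0..2 * pi}|lborel. h u) = integral {0..2 * pi} h"
    by (rule set_borel_integral_eq_integral(2) [OF si]) simp
  also have "\<dots> = circ s f z p"
    unfolding circ_def
  proof (rule integral_spike [of "{0, 2 * pi}"])
    fix u assume "u \<in> {0..2 * pi} - {0, 2 * pi}"
    then have u: "0 < u" "u < 2 * pi" by auto
    have hl: "hankel_log p u = Complex (ln p) u" using u by (simp add: hankel_log_def)
    have "exp ((s - 1) * Complex (ln p) u) * exp (Complex (ln p) u) = exp (s * Complex (ln p) u)"
      by (simp add: left_diff_distrib flip: exp_add)
    then show "\<i> * (f (z + exp (Complex (ln p) u)) * exp (s * Complex (ln p) u)) = h u"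
      using u by (simp add: h_def hankel_vector_derivative(2) [OF p(1)] hankel_def hl mult_ac)
  qed auto
  finally have I2: "(LINT u:{0..2 * pi}|lborel. h u) = circ s f z p" .
  have "weyl p s f z = coef p s * (\<integral>u. h u \<partial>lborel)"
    by (simp add: weyl_def kern)
  also have "(\<integral>u. h u \<partial>lborel) = circ s f z p + (monod s - 1) * tail s f z p"
    unfolding un I1 I2 I3 by (simp add: algebra_simps)
  finally show ?thesis .
qed

text \<open>
  In the coordinate $w = \log t$ the Hankel contour is the boundary of a half-infinite rectangle of
  height $2\pi$ and $t^{s-1} f(z+t)\,dt$ is $\varphi(w)\,dw$ with $\varphi(w + 2\pi i) = e^{2\pi i s} \varphi(w)$.
  Hence a primitive \<open>F\<close> of $\varphi$ satisfies the same relation up to an additive constant.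
\<close>

lemma circ_tail_primitive:
  assumes f: "decays b f" and \<eta>: "\<eta> > 0" and z: "z \<in> half_strip (b - \<eta>)"
  obtains F where
    "\<And>p. 0 < p \<Longrightarrow> p \<le> \<eta> \<Longrightarrow> circ s f z p = F (Complex (ln p) (2 * pi)) - F (of_real (ln p))"
    "\<And>p q. 0 < q \<Longrightarrow> q \<le> p \<Longrightarrow> p \<le> \<eta> \<Longrightarrow> tail s f z q = F (of_real (ln p)) - F (of_real (ln q)) + tail s f z p"
    "\<And>p q. 0 < q \<Longrightarrow> q \<le> p \<Longrightarrow> p \<le> \<eta> \<Longrightarrow> F (Complex (ln p) (2 * pi)) - monod s * F (of_real (ln p))
       = F (Complex (ln q) (2 * pi)) - monod s * F (of_real (ln q))"
proof -
  obtain a where a: "a < b - \<eta>" "z \<in> half_strip a" using half_strip_smaller z by blast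
  \<comment> \<open>For |e^w| < \<open>\<rho>\<close> the point z + e^w stays in
    \<open>half_strip b\<close>. As \<open>\<rho>\<close> exceeds \<open>\<eta>\<close>, the half
    plane \<open>H\<close> contains the logarithms of all radii up to \<open>\<eta>\<close>.\<close>
  define \<rho> where "\<rho> = b - a"
  have \<rho>: "\<eta> < \<rho>" "\<rho> > 0" using a \<eta> by (auto simp: \<rho>_def)
  have zb: "z \<in> half_strip b" using a \<eta> half_strip_mono [of a b] by auto
  define H where "H = {w. Re w < ln \<rho>}"
  have H: "open H" "convex H" unfolding H_def by (simp_all add: open_halfspace_Re_lt convex_halfspace_Re_lt)
  have zexp: "z + exp w \<in> half_strip b" if "w \<in> H" for w
  proof -
    have n: "norm (exp w) < \<rho>"
      using that \<rho> by (simp add: H_def) (metis exp_less_cancel_iff exp_ln)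
    have "z + exp w \<in> half_strip (a + norm (exp w))"
      using abs_Re_le_cmod [of "exp w"] abs_Im_le_cmod [of "exp w"]
      by (intro half_strip_add a(2)) linarith+
    then show ?thesis using n half_strip_mono [of "a + norm (exp w)" b] by (auto simp: \<rho>_def)
  qed
  define \<phi> where "\<phi> w = f (z + exp w) * exp (s * w)" for w
  have "(f \<circ> (\<lambda>w. z + exp w)) holomorphic_on H"
    by (rule holomorphic_on_compose_gen [of _ _ _ "half_strip b"])
      (use f zexp in \<open>auto simp: decays_def intro!: holomorphic_intros\<close>)
  then have \<phi>: "\<phi> holomorphic_on H"
    unfolding \<phi>_def [abs_def] o_def by (intro holomorphic_intros)
  obtain F where F': "\<And>w. w \<in> H \<Longrightarrow> (F has_field_derivative \<phi> w) (at w within H)"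
    using holomorphic_convex_primitive' [OF H(2) H(1) \<phi>] by blast
  have F: "(F has_field_derivative \<phi> w) (at w)" if "w \<in> H" for w
    using F' [OF that] at_within_open [OF that H(1)] by simp
  have lnH: "Complex (ln p) u \<in> H" if "0 < p" "p \<le> \<eta>" for p u
    using that \<rho> by (simp add: H_def)
  have lnH': "of_real (ln p) \<in> H" if "0 < p" "p \<le> \<eta>" for p
    using that \<rho> by (simp add: H_def)
  show ?thesis
  proof (rule that)
    fix p assume p: "0 < p" "p \<le> \<eta>"
    have "((\<lambda>u. \<i> * \<phi> (Complex (ln p) u)) has_integral (F (Complex (ln p) (2 * pi)) - F (Complex (ln p) 0))) {0..2 * pi}"
    proof (rule fundamental_theorem_of_calculus)
      fix u
      have "((\<lambda>u. of_real (ln p) + \<i> * of_real u) has_vector_derivative \<i>) (at u within {0..2 * pi})"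
        by (auto intro!: derivative_eq_intros)
      then have "((\<lambda>u. Complex (ln p) u) has_vector_derivative \<i>) (at u within {0..2 * pi})"
        by (simp add: Complex_eq)
      from field_vector_diff_chain_within [OF this has_field_derivative_at_within [OF F [OF lnH [OF p]]]]
      show "((\<lambda>u. F (Complex (ln p) u)) has_vector_derivative \<i> * \<phi> (Complex (ln p) u)) (at u within {0..2 * pi})"
        by (simp add: o_def)
    qed (use pi_gt_zero in simp)
    moreover have "Complex (ln p) 0 = of_real (ln p)" by (simp add: complex_eq_iff)
    ultimately show "circ s f z p = F (Complex (ln p) (2 * pi)) - F (of_real (ln p))"
      unfolding circ_def \<phi>_def by (metis integral_unique)
  next
    fix p q :: real assume pq: "0 < q" "q \<le> p" "p \<le> \<eta>"
    let ?g = "\<lambda>t. f (z + of_real t) * exp ((s - 1) * of_real (ln t))"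
    have int: "set_integrable lborel {q<..} ?g"
      by (rule tail_integrable [OF f zb]) (use pq in auto)
    have un: "{q<..} = {q<..p} \<union> {p<..}" using pq by auto
    have "tail s f z q = (LINT t:{q<..p}|lborel. ?g t) + tail s f z p"
      unfolding tail_def un
      by (rule set_integral_Un) (use pq in \<open>auto intro: set_integrable_subset [OF int]\<close>)
    also have "(LINT t:{q<..p}|lborel. ?g t) = (LBINT t=ereal q..ereal p. ?g t)"
      using pq by (subst interval_integral_Ioc) auto
    also have "\<dots> = F (of_real (ln p)) - F (of_real (ln q))"
    proof (rule interval_integral_FTC_finite)
      have c1: "isCont (\<lambda>t. f (z + of_real t)) t" if "t \<ge> q" for t
        using f pq that by (intro isCont_line [of _ b] half_strip_add_nonneg zb) (auto simp: decays_def)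
      have "continuous_on {q..p} ?g"
      proof (intro continuous_on_mult)
        show "continuous_on {q..p} (\<lambda>t. f (z + of_real t))"
          using c1 by (simp add: continuous_at_imp_continuous_on)
        show "continuous_on {q..p} (\<lambda>t. exp ((s - 1) * of_real (ln t)))"
          using pq by (intro continuous_intros) auto
      qed
      then show "continuous_on {min q p..max q p} ?g" using pq by simp
      fix t assume "min q p \<le> t" "t \<le> max q p"
      then have t: "0 < t" "t \<le> \<eta>" using pq by auto
      have "(ln has_real_derivative 1 / t) (at t)"
        using t by (auto intro!: derivative_eq_intros)
      then have "((\<lambda>t. complex_of_real (ln t)) has_vector_derivative of_real (1 / t)) (at t)"
        by (intro has_vector_derivative_of_real) (simp add: has_real_derivative_iff_has_vector_derivative)
      from field_vector_diff_chain_at [OF this F [OF lnH' [OF t]]]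
      have d: "((\<lambda>t. F (of_real (ln t))) has_vector_derivative of_real (1 / t) * \<phi> (of_real (ln t))) (at t)"
        by (simp add: o_def)
      have "of_real (1 / t) = exp (- complex_of_real (ln t))"
        using t by (simp add: exp_minus inverse_eq_divide exp_of_real)
      then have "of_real (1 / t) * \<phi> (of_real (ln t)) = f (z + exp (of_real (ln t))) * (exp (- complex_of_real (ln t)) * exp (s * of_real (ln t)))"
        by (simp add: \<phi>_def)
      also have "exp (- complex_of_real (ln t)) * exp (s * of_real (ln t)) = exp ((s - 1) * of_real (ln t))"
        by (simp add: algebra_simps flip: exp_add)
      also have "exp (complex_of_real (ln t)) = of_real t"
        using t by (simp add: exp_of_real)
      finally show "((\<lambda>t. F (of_real (ln t))) has_vector_derivative ?g t) (at t within {min q p..max q p})"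
        using d by (metis has_vector_derivative_at_within)
    qed
    finally show "tail s f z q = F (of_real (ln p)) - F (of_real (ln q)) + tail s f z p" .
  next
    fix p q :: real assume pq: "0 < q" "q \<le> p" "p \<le> \<eta>"
    let ?G = "\<lambda>w. F (w + 2 * pi * \<i>) - monod s * F w"
    have "\<exists>c. \<forall>w\<in>H. ?G w = c"
    proof (rule has_field_derivative_zero_constant [OF H(2)])
      fix w assume w: "w \<in> H"
      then have w': "w + 2 * pi * \<i> \<in> H" by (simp add: H_def)
      have "\<phi> (w + 2 * pi * \<i>) = monod s * \<phi> w"
        by (simp add: \<phi>_def monod_def exp_add distrib_left mult_ac)
      moreover have "((\<lambda>w. F (w + 2 * pi * \<i>)) has_field_derivative \<phi> (w + 2 * pi * \<i>) * 1) (at w)"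
        by (rule DERIV_chain2 [where f = F and g = "\<lambda>w. w + 2 * pi * \<i>", OF F [OF w']]) (auto intro!: derivative_eq_intros)
      moreover have "((\<lambda>w. monod s * F w) has_field_derivative monod s * \<phi> w) (at w)"
        by (rule DERIV_cmult [OF F [OF w]])
      ultimately have "(?G has_field_derivative 0) (at w)"
        using DERIV_diff by fastforce
      then show "(?G has_field_derivative 0) (at w within H)"
        by (rule has_field_derivative_at_within)
    qed
    then have "?G (of_real (ln p)) = ?G (of_real (ln q))"
      using lnH' [of p] lnH' [of q] pq by auto
    moreover have "of_real x + 2 * pi * \<i> = Complex x (2 * pi)" for x
      by (simp add: complex_eq_iff)
    ultimately show "F (Complex (ln p) (2 * pi)) - monod s * F (of_real (ln p))
       = F (Complex (ln q) (2 * pi)) - monod s * F (of_real (ln q))" by simp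
  qed
qed

text \<open>With the primitive F the sum at p is (F(ln p + 2 pi i) - \<open>monod s\<close> F(ln p))
  + (\<open>monod s\<close> - 1) (F(ln p) + \<open>tail s f z p\<close>), and neither bracket with F
  depends on p.\<close>

lemma circ_tail_independent:
  assumes f: "decays b f" and \<eta>: "\<eta> > 0" and z: "z \<in> half_strip (b - \<eta>)"
    and pq: "0 < q" "q \<le> p" "p \<le> \<eta>"
  shows "circ s f z q + (monod s - 1) * tail s f z q = circ s f z p + (monod s - 1) * tail s f z p"
proof -
  obtain F where F:
    "\<And>p. 0 < p \<Longrightarrow> p \<le> \<eta> \<Longrightarrow> circ s f z p = F (Complex (ln p) (2 * pi)) - F (of_real (ln p))"
    "\<And>p q. 0 < q \<Longrightarrow> q \<le> p \<Longrightarrow> p \<le> \<eta> \<Longrightarrow> tail s f z q = F (of_real (ln p)) - F (of_real (ln q)) + tail s f z p"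
    "\<And>p q. 0 < q \<Longrightarrow> q \<le> p \<Longrightarrow> p \<le> \<eta> \<Longrightarrow> F (Complex (ln p) (2 * pi)) - monod s * F (of_real (ln p))
       = F (Complex (ln q) (2 * pi)) - monod s * F (of_real (ln q))"
    using circ_tail_primitive [OF f \<eta> z, of s] by blast
  have "circ s f z p = F (Complex (ln p) (2 * pi)) - F (of_real (ln p))"
    "circ s f z q = F (Complex (ln q) (2 * pi)) - F (of_real (ln q))"
    using pq by (simp_all add: F(1))
  then show ?thesis
    using F(2) [OF pq] F(3) [OF pq] by algebra
qed

text \<open>On the circle |t^s| <= p^(Re s) exp(2 pi |Im s|), while f stays bounded.\<close>

lemma circ_tendsto_0:
  assumes f: "decays b f" and \<eta>: "\<eta> > 0" and z: "z \<in> half_strip (b - \<eta>)" and s: "Re s > 0"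
    and q: "\<And>n. 0 < q n" "\<And>n. q n \<le> \<eta>" "q \<longlonglongrightarrow> 0"
  shows "(\<lambda>n. circ s f z (q n)) \<longlonglongrightarrow> 0"
proof -
  obtain a where a: "a < b - \<eta>" "z \<in> half_strip a" using half_strip_smaller z by blast
  have ab: "a + \<eta> < b" using a by simp
  obtain C where C: "C \<ge> 0" "\<And>w. w \<in> half_strip (a + \<eta>) \<Longrightarrow> norm (f w) \<le> C * exp (- Re w / 2)"
    using decays_bound [OF f ab] by blast
  define K where "K = C * exp ((a + \<eta>) / 2) * exp (\<bar>Im s\<bar> * (2 * pi)) * (2 * pi - 0)"
  have "norm (circ s f z p) \<le> K * p powr Re s" if p: "0 < p" "p \<le> \<eta>" for p
  proof -
    have in_strip: "z + exp (Complex (ln p) u) \<in> half_strip (a + \<eta>)" for u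
    proof -
      have "norm (exp (Complex (ln p) u)) \<le> \<eta>" using p by simp
      then show ?thesis
        using abs_Re_le_cmod [of "exp (Complex (ln p) u)"] abs_Im_le_cmod [of "exp (Complex (ln p) u)"]
        by (intro half_strip_add a(2)) linarith+
    qed
    have "norm (circ s f z p) \<le> (C * exp ((a + \<eta>) / 2) * (p powr Re s * exp (\<bar>Im s\<bar> * (2 * pi)))) * (2 * pi - 0)"
      unfolding circ_def
    proof (rule integral_bound)
      have cf: "continuous_on (half_strip (a + \<eta>)) f"
        using f ab half_strip_mono [of "a + \<eta>" b]
        by (auto simp: decays_def intro!: holomorphic_on_imp_continuous_on elim: holomorphic_on_subset)
      have c: "continuous_on {0..2 * pi} (\<lambda>u. Complex (ln p) u)"
        unfolding Complex_eq by (intro continuous_intros)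
      then have "continuous_on {0..2 * pi} (\<lambda>u. z + exp (Complex (ln p) u))"
        by (intro continuous_on_add continuous_on_const continuous_on_exp)
      then have "continuous_on {0..2 * pi} (\<lambda>u. f (z + exp (Complex (ln p) u)))"
        by (rule continuous_on_compose2 [OF cf]) (use in_strip in blast)
      with c show "continuous_on {0..2 * pi} (\<lambda>u. \<i> * (f (z + exp (Complex (ln p) u)) * exp (s * Complex (ln p) u)))"
        by (intro continuous_on_mult continuous_on_const continuous_on_exp)
      fix u assume u: "u \<in> {0..2 * pi}"
      have "norm (f (z + exp (Complex (ln p) u))) \<le> C * exp (- Re (z + exp (Complex (ln p) u)) / 2)"
        by (rule C(2) [OF in_strip])
      also have "\<dots> \<le> C * exp ((a + \<eta>) / 2)"
        using C(1) in_strip [of u] by (intro mult_left_mono) (auto simp: half_strip_def)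
      finally have 1: "norm (f (z + exp (Complex (ln p) u))) \<le> C * exp ((a + \<eta>) / 2)" .
      have "\<bar>Im s\<bar> * u \<le> \<bar>Im s\<bar> * (2 * pi)"
        using u by (intro mult_left_mono) auto
      moreover have "(- Im s) * u \<le> \<bar>Im s\<bar> * u"
        using u by (intro mult_right_mono) auto
      ultimately have "- (Im s * u) \<le> \<bar>Im s\<bar> * (2 * pi)" by simp
      then have "norm (exp (s * Complex (ln p) u)) \<le> exp (Re s * ln p + \<bar>Im s\<bar> * (2 * pi))"
        by simp
      also have "\<dots> = p powr Re s * exp (\<bar>Im s\<bar> * (2 * pi))"
        using p by (simp add: powr_def exp_add)
      finally have 2: "norm (exp (s * Complex (ln p) u)) \<le> p powr Re s * exp (\<bar>Im s\<bar> * (2 * pi))" .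
      show "norm (\<i> * (f (z + exp (Complex (ln p) u)) * exp (s * Complex (ln p) u)))
          \<le> C * exp ((a + \<eta>) / 2) * (p powr Re s * exp (\<bar>Im s\<bar> * (2 * pi)))"
        using mult_mono [OF 1 2 order_trans [OF norm_ge_zero 1] norm_ge_zero] by (simp add: norm_mult)
    qed simp
    also have "\<dots> = K * p powr Re s" by (simp add: K_def mult_ac)
    finally show ?thesis .
  qed
  then have le: "\<forall>\<^sub>F n in sequentially. norm (circ s f z (q n)) \<le> K * q n powr Re s"
    using q by simp
  have "(\<lambda>n. K * q n powr Re s) \<longlonglongrightarrow> K * 0"
    using q s by (intro tendsto_mult tendsto_const tendsto_zero_powrI [of q _ "\<lambda>_. Re s"]) (auto simp: less_imp_le)
  then have "(\<lambda>n. K * q n powr Re s) \<longlonglongrightarrow> 0" by simp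
  with le show ?thesis by (rule Lim_null_comparison)
qed

lemma tail_tendsto:
  assumes f: "decays b f" and z: "z \<in> half_strip b" and s: "Re s > 0"
    and q: "\<And>n. 0 < q n" "q \<longlonglongrightarrow> 0"
  shows "(\<lambda>n. tail s f z (q n)) \<longlonglongrightarrow> tail s f z 0"
  unfolding tail_def set_lebesgue_integral_def
proof (rule integral_dominated_convergence)
  let ?g = "\<lambda>t. f (z + of_real t) * exp ((s - 1) * of_real (ln t))"
  have si: "set_integrable lborel {0<..} ?g"
    by (rule tail_integrable [OF f z]) (use s in auto)
  then show "(\<lambda>t. indicator {0<..} t *\<^sub>R ?g t) \<in> borel_measurable lborel"
    by (auto simp: set_integrable_def)
  show "integrable lborel (\<lambda>t. norm (indicator {0<..} t *\<^sub>R ?g t))"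
    using si by (simp only: set_integrable_def integrable_norm)
  show "(\<lambda>t. indicator {q n<..} t *\<^sub>R ?g t) \<in> borel_measurable lborel" for n
  proof -
    have "set_integrable lborel {q n<..} ?g"
      by (rule tail_integrable [OF f z]) (use s q in \<open>auto simp: less_imp_le\<close>)
    then show ?thesis by (auto simp: set_integrable_def)
  qed
  show "AE t in lborel. (\<lambda>n. indicator {q n<..} t *\<^sub>R ?g t) \<longlonglongrightarrow> indicator {0<..} t *\<^sub>R ?g t"
  proof (intro AE_I2)
    fix t :: real
    have "\<forall>\<^sub>F n in sequentially. indicator {q n<..} t *\<^sub>R ?g t = indicator {0<..} t *\<^sub>R ?g t"
    proof (cases "t > 0")
      case True
      then have "\<forall>\<^sub>F n in sequentially. q n < t" using q(2) by (auto intro: order_tendstoD)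
      then show ?thesis by eventually_elim (use True in simp)
    next
      case False
      then have "\<not> q n < t" for n using q(1) [of n] by linarith
      then show ?thesis using False by simp
    qed
    then show "(\<lambda>n. indicator {q n<..} t *\<^sub>R ?g t) \<longlonglongrightarrow> indicator {0<..} t *\<^sub>R ?g t"
      by (rule tendsto_eventually)
  qed
  show "AE t in lborel. norm (indicator {q n<..} t *\<^sub>R ?g t) \<le> norm (indicator {0<..} t *\<^sub>R ?g t)" for n
    using q(1) [of n] by (intro AE_I2) (auto split: split_indicator)
qed

text \<open>The left side does not depend on the radius, which may thus shrink to 0; the circle
  disappears because Re s > 0.\<close>

lemma circ_tail_Re_pos:
  assumes f: "decays b f" and p: "0 < p" "p \<le> \<eta>" and z: "z \<in> half_strip (b - \<eta>)" and s: "Re s > 0"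
  shows "circ s f z p + (monod s - 1) * tail s f z p = (monod s - 1) * tail s f z 0"
proof -
  define q where "q n = p / real (Suc n)" for n
  have q: "0 < q n" "q n \<le> p" "q n \<le> \<eta>" for n
  proof -
    show "0 < q n" using p by (simp add: q_def)
    show "q n \<le> p" using p by (simp add: q_def divide_le_eq)
    then show "q n \<le> \<eta>" using p by simp
  qed
  have "q \<longlonglongrightarrow> 0"
    unfolding q_def using LIMSEQ_inverse_real_of_nat tendsto_mult_right_zero [of "\<lambda>n. inverse (real (Suc n))" sequentially p]
    by (simp add: divide_inverse)
  have \<eta>: "\<eta> > 0" using p by simp
  have zb: "z \<in> half_strip b" using z half_strip_mono [of "b - \<eta>" b] \<eta> by auto
  have "(\<lambda>n. circ s f z (q n) + (monod s - 1) * tail s f z (q n)) \<longlonglongrightarrow> 0 + (monod s - 1) * tail s f z 0"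
    using q \<open>q \<longlonglongrightarrow> 0\<close> by (intro tendsto_add tendsto_mult tendsto_const circ_tendsto_0 [OF f \<eta> z s] tail_tendsto [OF f zb s]) auto
  moreover have "circ s f z (q n) + (monod s - 1) * tail s f z (q n) = circ s f z p + (monod s - 1) * tail s f z p" for n
    by (rule circ_tail_independent [OF f \<eta> z q(1) q(2) p(2)])
  ultimately show ?thesis
    using LIMSEQ_unique [OF tendsto_const] by simp
qed

text \<open>Two contours share the coefficient and the sum of circle and tail. A contour is compared
  with the ray through \<open>coef p s\<close> (e^(2 pi i s) - 1) = \<open>rGamma s\<close>.\<close>

lemma weyl_switch:
  assumes f: "decays b f" "f \<in> borel_measurable borel"
    and p: "0 \<le> p" "p \<le> \<eta>" and q: "0 \<le> q" "q \<le> \<eta>"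
    and s: "s \<in> adm p" "s \<in> adm q" and z: "z \<in> half_strip (b - \<eta>)"
  shows "weyl p s f z = weyl q s f z"
proof -
  have zero: "weyl p s f z = weyl 0 s f z" if "p > 0" "p \<le> \<eta>" "s \<in> adm p" "s \<in> adm 0" for p
  proof -
    have Re: "Re s > 0" using that by (simp add: adm_def)
    \<comment> \<open>Re s > 0 excludes the nonpositive integers, and admissibility on the contour
      excludes the positive ones.\<close>
    have "s \<notin> \<int>"
    proof
      assume "s \<in> \<int>"
      then obtain n where n: "s = of_int n" by (auto elim: Ints_cases)
      then have "n \<ge> 1" using Re by simp
      then have "1 - s \<in> \<int>\<^sub>\<le>\<^sub>0" unfolding n by (auto simp: nonpos_Ints_def intro!: exI [of _ "1 - n"])
      then show False using that by (simp add: adm_def)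
    qed
    then have c: "coef p s = 1 / ((monod s - 1) * Gamma s)"
      unfolding monod_def using coef_Hankel that by simp
    moreover have "coef p s \<noteq> 0" using coef_nonzero that by simp
    ultimately have "(monod s - 1) * Gamma s \<noteq> 0" by auto
    then have "coef p s * (monod s - 1) = rGamma s"
      unfolding c rGamma_inverse_Gamma by (simp add: divide_simps)
    then show ?thesis
      unfolding weyl_Hankel [OF f that(1,2,3) z] circ_tail_Re_pos [OF f(1) that(1,2) z Re] weyl_0
      by (simp flip: mult.assoc)
  qed
  have pos: "weyl p s f z = weyl q s f z" if "0 < q" "q \<le> p" "p \<le> \<eta>" "s \<in> adm p" "s \<in> adm q" for p q
  proof -
    have "p > 0" "q \<le> \<eta>" "\<eta> > 0" using that by auto
    moreover have "coef p s = coef q s" using that by (simp add: coef_def)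
    ultimately show ?thesis
      using weyl_Hankel [OF f _ _ _ z] circ_tail_independent [OF f(1) _ z that(1-3)] that by simp
  qed
  consider "p = 0" "q = 0" | "p = 0" "q > 0" | "p > 0" "q = 0" | "p > 0" "q > 0" using p q by force
  then show ?thesis
  proof cases
    case 4
    then show ?thesis using pos [of q p] pos [of p q] p q s by (cases "q \<le> p") auto
  qed (use zero p q s in auto)
qed

section \<open>Values at the integers\<close>

lemma nice_measurable:
  assumes "nice f"
  shows "f \<in> borel_measurable borel"
proof -
  have "(\<lambda>z. indicator (half_strip 2) z *\<^sub>R f z) \<in> borel_measurable borel"
    using assms by (intro borel_measurable_continuous_on_indicator)
      (auto simp: nice_def decays_def intro: holomorphic_on_imp_continuous_on)
  moreover have "(\<lambda>z. indicator (half_strip 2) z *\<^sub>R f z) = f"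
    using assms by (auto simp: nice_def indicator_def)
  ultimately show ?thesis by simp
qed

text \<open>Integration by parts: - f is the derivative of \<open>I_fun f\<close>, and t^m/m! is
  that of t^(m+1)/(m+1)!.\<close>

lemma weyl_0_Suc:
  assumes f: "nice f" and z: "z \<in> half_strip 2"
  shows "weyl 0 (of_nat (Suc (Suc m))) f z = weyl 0 (of_nat (Suc m)) (I_fun f) z"
proof -
  let ?If = "I_fun f"
  have nI: "nice ?If" using f by (rule nice_I)
  have d: "decays 2 f" "decays 2 ?If" using f nI by (auto simp: nice_def)
  have e: "exp ((of_nat (Suc n) - 1) * complex_of_real (ln t)) = of_real t ^ n" if "t > 0" for n t
    using that by (simp add: exp_of_nat_mult exp_of_real)
  have rG: "rGamma (of_nat (Suc n) :: complex) = 1 / fact n" for n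
    by (simp add: rGamma_inverse_Gamma Gamma_fact [symmetric] divide_inverse add.commute)
  define g1 where "g1 t = f (z + of_real t) * of_real t ^ Suc m / fact (Suc m)" for t :: real
  define g2 where "g2 t = ?If (z + of_real t) * of_real t ^ m / fact m" for t :: real
  have tail1: "set_integrable lborel {0<..} (\<lambda>t. f (z + of_real t) * exp ((of_nat (Suc (Suc m)) - 1) * of_real (ln t)))"
    "set_integrable lborel {0<..} (\<lambda>t. ?If (z + of_real t) * exp ((of_nat (Suc m) - 1) * of_real (ln t)))"
    by (rule tail_integrable [OF d(1) z], simp, simp) (rule tail_integrable [OF d(2) z], simp, simp)
  have pt1: "(1 / fact (Suc m)) * (f (z + of_real t) * exp ((of_nat (Suc (Suc m)) - 1) * of_real (ln t))) = g1 t"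
    and pt2: "(1 / fact m) * (?If (z + of_real t) * exp ((of_nat (Suc m) - 1) * of_real (ln t))) = g2 t"
    if "t \<in> {0<..}" for t
    using that by (simp_all only: g1_def g2_def e greaterThan_iff) (simp_all only: divide_inverse mult_ac mult_1_left mult_1_right)
  have eq1: "set_integrable lborel {0<..} g1 \<and> (LINT t:{0<..}|lborel. g1 t) = weyl 0 (of_nat (Suc (Suc m))) f z"
  proof
    have "set_integrable lborel {0<..} (\<lambda>t. (1 / fact (Suc m)) * (f (z + of_real t) * exp ((of_nat (Suc (Suc m)) - 1) * of_real (ln t))))"
      by (rule set_integrable_mult_right [OF tail1(1)])
    then show "set_integrable lborel {0<..} g1"
      by (rule set_integrable_cong [OF refl refl, THEN iffD1, rotated]) (rule pt1)
    have "weyl 0 (of_nat (Suc (Suc m))) f z = (LINT t:{0<..}|lborel. (1 / fact (Suc m)) * (f (z + of_real t) * exp ((of_nat (Suc (Suc m)) - 1) * of_real (ln t))))"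
      unfolding weyl_0 tail_def rG by (rule set_integral_mult_right [symmetric])
    also have "\<dots> = (LINT t:{0<..}|lborel. g1 t)"
      by (rule set_lebesgue_integral_cong) (simp, intro allI impI, rule pt1)
    finally show "(LINT t:{0<..}|lborel. g1 t) = weyl 0 (of_nat (Suc (Suc m))) f z" by simp
  qed
  have eq2: "set_integrable lborel {0<..} g2 \<and> (LINT t:{0<..}|lborel. g2 t) = weyl 0 (of_nat (Suc m)) ?If z"
  proof
    have "set_integrable lborel {0<..} (\<lambda>t. (1 / fact m) * (?If (z + of_real t) * exp ((of_nat (Suc m) - 1) * of_real (ln t))))"
      by (rule set_integrable_mult_right [OF tail1(2)])
    then show "set_integrable lborel {0<..} g2"
      by (rule set_integrable_cong [OF refl refl, THEN iffD1, rotated]) (rule pt2)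
    have "weyl 0 (of_nat (Suc m)) ?If z = (LINT t:{0<..}|lborel. (1 / fact m) * (?If (z + of_real t) * exp ((of_nat (Suc m) - 1) * of_real (ln t))))"
      unfolding weyl_0 tail_def rG by (rule set_integral_mult_right [symmetric])
    also have "\<dots> = (LINT t:{0<..}|lborel. g2 t)"
      by (rule set_lebesgue_integral_cong) (simp, intro allI impI, rule pt2)
    finally show "(LINT t:{0<..}|lborel. g2 t) = weyl 0 (of_nat (Suc m)) ?If z" by simp
  qed
  \<comment> \<open>A primitive of \<open>g1\<close> - \<open>g2\<close>. It vanishes at 0 because
    of the power of t and at infinity by decay, so the two integrals agree.\<close>
  define F where "F t = - (?If (z + of_real t) * of_real t ^ Suc m / fact (Suc m))" for t :: real
  have zt: "z + of_real t \<in> half_strip 2" if "t \<ge> 0" for t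
    using half_strip_add_nonneg z that by blast
  have deriv: "(F has_vector_derivative g1 t - g2 t) (at t)" if "t > 0" for t
  proof -
    have a: "((\<lambda>t. ?If (z + of_real t)) has_vector_derivative - f (z + of_real t)) (at t)"
      using nice_has_derivative [OF nI zt [of t]] that
      by (intro has_vector_derivative_line) (simp add: D_I f)
    have b: "((\<lambda>t. complex_of_real t ^ Suc m) has_vector_derivative of_nat (Suc m) * of_real t ^ m) (at t)"
      by (rule has_vector_derivative_real_field [where f = "\<lambda>w. w ^ Suc m"])
        (rule DERIV_cong [OF DERIV_power_Suc [OF DERIV_ident]], simp)
    from has_vector_derivative_mult [OF a b]
    have "((\<lambda>t. (- 1 / fact (Suc m)) * (?If (z + of_real t) * of_real t ^ Suc m)) has_vector_derivative
        (- 1 / fact (Suc m)) * (?If (z + of_real t) * (of_nat (Suc m) * of_real t ^ m) + - f (z + of_real t) * of_real t ^ Suc m)) (at t)"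
      by (rule has_vector_derivative_mult_right)
    moreover have "(- 1 / fact (Suc m)) * (?If (z + of_real t) * (of_nat (Suc m) * of_real t ^ m) + - f (z + of_real t) * of_real t ^ Suc m)
        = g1 t - g2 t"
      by (simp add: g1_def g2_def divide_simps del: power_Suc of_nat_Suc)
    moreover have "(\<lambda>t. (- 1 / fact (Suc m)) * (?If (z + of_real t) * of_real t ^ Suc m)) = F"
      by (auto simp: F_def)
    ultimately show ?thesis by simp
  qed
  have cont: "isCont (\<lambda>t. f (z + of_real t)) t" "isCont (\<lambda>t. ?If (z + of_real t)) t" if "t \<ge> 0" for t
    using d isCont_line zt [OF that] by (auto simp: decays_def)
  have "(LINT t:{0<..}|lborel. g1 t - g2 t) = 0 - 0"
  proof (rule FTC_half_line [OF deriv])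
    show "isCont (\<lambda>t. g1 t - g2 t) t" if "t > 0" for t
      unfolding g1_def g2_def using cont that by (intro continuous_intros) (auto simp del: fact_Suc)
    show "set_integrable lborel {0<..} (\<lambda>t. g1 t - g2 t)"
      using eq1 eq2 by (intro set_integral_diff) auto
    have "isCont F 0" unfolding F_def using cont [of 0] by (intro continuous_intros) (auto simp del: fact_Suc)
    then have "(F \<longlongrightarrow> F 0) (at 0)" by (simp add: isCont_def)
    then show "(F \<longlongrightarrow> 0) (at_right 0)" by (auto simp: filterlim_at_split F_def)
    obtain C where C: "C \<ge> 0" "\<And>t. t \<ge> 0 \<Longrightarrow> norm (?If (z + of_real t)) \<le> C * exp (- t / 2)"
      using decays_line [OF d(2) z] by blast
    have "((\<lambda>t::real. (t / 2) ^ Suc m / exp (t / 2)) \<longlongrightarrow> 0) at_top"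
      by (rule filterlim_compose [OF tendsto_power_div_exp_0]) real_asymp
    then have "((\<lambda>t::real. (C * 2 ^ Suc m) * ((t / 2) ^ Suc m / exp (t / 2))) \<longlongrightarrow> (C * 2 ^ Suc m) * 0) at_top"
      by (intro tendsto_mult tendsto_const)
    then have lim: "((\<lambda>t::real. (C * 2 ^ Suc m) * ((t / 2) ^ Suc m / exp (t / 2))) \<longlongrightarrow> 0) at_top"
      by simp
    show "(F \<longlongrightarrow> 0) at_top"
    proof (rule Lim_null_comparison [OF _ lim])
      show "\<forall>\<^sub>F t in at_top. norm (F t) \<le> (C * 2 ^ Suc m) * ((t / 2) ^ Suc m / exp (t / 2))"
        using eventually_ge_at_top [of 0]
      proof eventually_elim
        case (elim t)
        have "norm (F t) = norm (?If (z + of_real t)) * t ^ Suc m / fact (Suc m)"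
          using elim by (simp add: F_def norm_mult norm_divide norm_power del: power_Suc fact_Suc)
        also have "\<dots> \<le> norm (?If (z + of_real t)) * t ^ Suc m"
        proof -
          have *: "x / F \<le> x" if "x \<ge> 0" "F \<ge> 1" for x F :: real
            using frac_le [of x x 1 F] that by simp
          show ?thesis by (rule * [OF _ fact_ge_1]) (use elim in simp)
        qed
        also have "\<dots> \<le> C * exp (- t / 2) * t ^ Suc m"
          using C(2) [OF elim] elim by (intro mult_right_mono) auto
        also have "\<dots> = (C * 2 ^ Suc m) * ((t / 2) ^ Suc m / exp (t / 2))"
        proof -
          have "2 ^ Suc m * (t / 2) ^ Suc m = t ^ Suc m"
            by (simp del: power_Suc flip: power_mult_distrib)
          moreover have "exp (- t / 2) = 1 / exp (t / 2)"
            by (simp add: exp_minus inverse_eq_divide)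
          moreover have "C * (1 / e) * x = (C * a) * (b / e)" if "a * b = x" for a b x e :: real
            using that by auto
          ultimately show ?thesis by (simp only:)
        qed
        finally show ?case .
      qed
    qed
  qed
  moreover have "(LINT t:{0<..}|lborel. g1 t - g2 t) = (LINT t:{0<..}|lborel. g1 t) - (LINT t:{0<..}|lborel. g2 t)"
    using eq1 eq2 by (intro set_integral_diff) auto
  ultimately show ?thesis using eq1 eq2 by simp
qed

lemma weyl_0_pos:
  "nice f \<Longrightarrow> z \<in> half_strip 2 \<Longrightarrow> weyl 0 (of_nat (Suc n)) f z = (I_fun ^^ Suc n) f z"
proof (induction n arbitrary: f)
  case 0
  have "tail 1 f z 0 = J_fun f z"
    by (simp add: tail_def J_fun_def)
  then show ?case using 0 by (simp add: weyl_0 I_fun_def)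
next
  case (Suc n)
  then have "weyl 0 (of_nat (Suc (Suc n))) f z = (I_fun ^^ Suc n) (I_fun f) z"
    using weyl_0_Suc nice_I by metis
  then show ?case by (simp add: funpow_swap1)
qed

lemma D_fun_funpow:
  assumes f: "nice f"
  shows "z \<in> half_strip 2 \<Longrightarrow> (D_fun ^^ n) f z = (- 1) ^ n * (deriv ^^ n) f z"
proof (induction n arbitrary: z)
  case (Suc n)
  have hol: "(deriv ^^ n) f holomorphic_on half_strip 2"
    using f by (intro holomorphic_higher_deriv) (auto simp: nice_def decays_def)
  have "((\<lambda>z. (- 1) ^ n * (deriv ^^ n) f z) has_field_derivative (- 1) ^ n * deriv ((deriv ^^ n) f) z) (at z)"
    by (rule DERIV_cmult [OF holomorphic_derivI [OF hol open_half_strip Suc.prems]])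
  then have "((D_fun ^^ n) f has_field_derivative (- 1) ^ n * deriv ((deriv ^^ n) f) z) (at z)"
    by (rule has_field_derivative_transform_within_open [OF _ open_half_strip Suc.prems])
      (simp add: Suc.IH)
  then have "D_fun ((D_fun ^^ n) f) z = - ((- 1) ^ n * deriv ((deriv ^^ n) f) z)"
    by (intro D_fun_eqI Suc.prems) simp
  then show ?case by simp
qed simp

text \<open>At s = -n the monodromy is trivial, so the two rays cancel and only the circle is left.
  With the coefficient (-1)^n n!/(2 pi i) it is Cauchy's formula for the n-th derivative, and D is
  minus the derivative.\<close>

lemma weyl_nonpos:
  assumes f: "nice f" and p: "0 < p" "p \<le> \<eta>" and z: "z \<in> half_strip (2 - \<eta>)"
  shows "weyl p (- of_nat n) f z = (D_fun ^^ n) f z"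
proof -
  have d: "decays 2 f" using f by (simp add: nice_def)
  have z2: "z \<in> half_strip 2" using z p half_strip_mono [of "2 - \<eta>" 2] by auto
  have sub: "cball z p \<subseteq> half_strip 2"
    using cball_half_strip [OF z, of p] half_strip_mono [of "2 - \<eta> + p" 2] p by auto
  have s: "- of_nat n \<in> adm p"
  proof -
    have "(1 - - of_nat n :: complex) = of_int (int (Suc n))" by simp
    moreover have "of_int (int (Suc n)) \<notin> (\<int>\<^sub>\<le>\<^sub>0 :: complex set)"
      unfolding nonpos_Ints_def by (auto simp only: of_int_eq_iff mem_Collect_eq)
    ultimately show ?thesis using p by (simp only: adm_def mem_Collect_eq) simp
  qed
  have mon1: "monod (- of_nat n) = 1"
    unfolding monod_def by (simp add: exp_eq_1) (metis mult.commute mult_minus_left of_int_minus of_int_of_nat_eq)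
  have "((\<lambda>u. f u / (u - z) ^ Suc n) has_contour_integral (2 * pi * \<i> / fact n * (deriv ^^ n) f z)) (circlepath z p)"
  proof (rule Cauchy_has_contour_integral_higher_derivative_circlepath)
    have hol: "f holomorphic_on cball z p" using d sub by (auto simp: decays_def intro: holomorphic_on_subset)
    show "continuous_on (cball z p) f" by (rule holomorphic_on_imp_continuous_on [OF hol])
    show "f holomorphic_on ball z p" by (rule holomorphic_on_subset [OF hol ball_subset_cball])
  qed (use p in simp)
  then have "((\<lambda>t. f (z + of_real p * cis t) / (z + of_real p * cis t - z) ^ Suc n * of_real p * \<i> * cis t)
      has_integral (2 * pi * \<i> / fact n * (deriv ^^ n) f z)) {0..2 * pi}"
    unfolding circlepath_def by (subst (asm) has_contour_integral_part_circlepath_iff) auto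
  moreover have "f (z + of_real p * cis t) / (z + of_real p * cis t - z) ^ Suc n * of_real p * \<i> * cis t
      = \<i> * (f (z + exp (Complex (ln p) t)) * exp (- of_nat n * Complex (ln p) t))" for t
  proof -
    have "exp (Complex (ln p) t) = of_real p * cis t"
      using p by (simp add: Complex_eq exp_add exp_of_real cis_conv_exp)
    moreover have "exp (- of_nat n * Complex (ln p) t) = inverse (exp (Complex (ln p) t) ^ n)"
      by (simp add: exp_minus exp_of_nat_mult)
    ultimately show ?thesis using p by (simp add: divide_simps)
  qed
  ultimately have circ: "circ (- of_nat n) f z p = 2 * pi * \<i> / fact n * (deriv ^^ n) f z"
    unfolding circ_def by (intro integral_unique) (simp only:)
  have cf: "coef p (- of_nat n) = (- 1) ^ n * fact n / (2 * of_real pi * \<i>)"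
  proof -
    have "Gamma (1 - - of_nat n :: complex) = fact n" by (simp add: Gamma_fact)
    moreover have "exp (- (of_real pi * \<i> * - of_nat n)) = (- 1 :: complex) ^ n"
    proof -
      have "exp (- (of_real pi * \<i> * - of_nat n)) = exp (of_nat n * (\<i> * of_real pi) :: complex)"
        by (simp add: mult_ac)
      then show ?thesis by (simp only: exp_of_nat_mult exp_pi_i')
    qed
    ultimately show ?thesis using p by (simp only: coef_def if_False) simp
  qed
  have "weyl p (- of_nat n) f z = (- 1) ^ n * (deriv ^^ n) f z"
  proof -
    have *: "c * F / j * (j / F * x + (1 - 1) * y) = c * x" if "F \<noteq> 0" "j \<noteq> 0" for c F j x y :: complex
      using that by simp
    show ?thesis
      unfolding weyl_Hankel [OF d nice_measurable [OF f] p s z] circ mon1 cf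
      by (simp only: of_real_mult of_real_numeral) (rule *, simp_all)
  qed
  then show ?thesis using D_fun_funpow [OF f z2] by simp
qed

lemma weyl_int:
  assumes "nice f" "0 < \<eta>" "z \<in> half_strip (2 - \<eta>)"
  shows "weyl (if k > 0 then 0 else \<eta>) (of_int k) f z = I_pow k f z"
proof (cases "k > 0")
  case True
  have z2: "z \<in> half_strip 2" using assms half_strip_mono [of "2 - \<eta>" 2] by auto
  define n where "n = nat (k - 1)"
  have k: "k = int (Suc n)" using True by (simp add: n_def)
  have "weyl 0 (of_nat (Suc n)) f z = (I_fun ^^ Suc n) f z"
    by (rule weyl_0_pos [OF assms(1) z2])
  moreover have "I_pow k = I_fun ^^ Suc n"
    unfolding I_pow_def k by (simp only: nat_int) simp
  moreover have "(of_int k :: complex) = of_nat (Suc n)" by (simp only: k of_int_of_nat_eq)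
  ultimately show ?thesis using True by (simp only: if_True)
next
  case False
  define n where "n = nat (- k)"
  have k: "k = - int n" using False by (simp add: n_def)
  have "weyl \<eta> (- of_nat n) f z = (D_fun ^^ n) f z"
    by (rule weyl_nonpos [OF assms(1,2) order_refl assms(3)])
  moreover have "I_pow k = D_fun ^^ n"
    unfolding I_pow_def k by (cases n) (simp_all add: nat_add_distrib)
  moreover have "(of_int k :: complex) = - of_nat n" by (simp add: k)
  ultimately show ?thesis using False by (simp only: if_False)
qed

section \<open>The desingularized zeta function\<close>

lemma deriv_bern_bound:
  assumes "a < 2 * pi"
  obtains C where "C \<ge> 0" "\<And>z. z \<in> half_strip a \<Longrightarrow> norm (deriv bern z) \<le> C * exp (- (3 / 4) * Re z)"
proof -
  let ?f = "\<lambda>z. exp (z / 4) * bern z"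
  obtain C1 where C1: "C1 \<ge> 0" "\<And>z. z \<in> half_strip a \<Longrightarrow> norm (?f z) \<le> C1 * exp (- Re z / 2)"
    using decays_bound [OF bern_weighted_decays assms] by blast
  obtain C2 where C2: "C2 \<ge> 0" "\<And>z. z \<in> half_strip a \<Longrightarrow> norm (deriv ?f z) \<le> C2 * exp (- Re z / 2)"
    using decays_bound [OF decays_deriv [OF bern_weighted_decays] assms] by blast
  have "norm (deriv bern z) \<le> (C1 + C2) * exp (- (3 / 4) * Re z)" if z: "z \<in> half_strip a" for z
  proof -
    have z': "z \<in> half_strip (2 * pi)" using z assms half_strip_mono [of a "2 * pi"] by auto
    \<comment> \<open>Solving the product rule for B' and removing the weight e^(z/4) improves the
      rate from 1/2 to 3/4.\<close>
    have "(?f has_field_derivative exp (z / 4) * (1 / 4) * bern z + deriv bern z * exp (z / 4)) (at z)"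
      by (intro DERIV_mult holomorphic_derivI [OF bern_holomorphic open_half_strip z'])
        (auto intro!: derivative_eq_intros)
    then have "deriv ?f z = (1 / 4) * ?f z + deriv bern z * exp (z / 4)"
      by (subst DERIV_imp_deriv) auto
    then have "deriv bern z * exp (z / 4) = deriv ?f z - (1 / 4) * ?f z" by simp
    then have "norm (deriv bern z * exp (z / 4)) \<le> norm (deriv ?f z) + norm ((1 / 4) * ?f z)"
      by (simp only: norm_triangle_ineq4)
    also have "norm ((1 / 4) * ?f z) = norm (?f z) / 4" by (simp add: norm_mult)
    also have "norm (deriv ?f z) + norm (?f z) / 4 \<le> (C1 + C2) * exp (- Re z / 2)"
      using C1(2) [OF z] C2(2) [OF z] norm_ge_zero [of "?f z"] by (simp only: distrib_right)
    finally have "norm (deriv bern z) * exp (Re z / 4) \<le> (C1 + C2) * exp (- Re z / 2)"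
      by (simp add: norm_mult)
    then have "norm (deriv bern z) * exp (Re z / 4) * exp (- Re z / 4) \<le> (C1 + C2) * exp (- Re z / 2) * exp (- Re z / 4)"
      by (rule mult_right_mono) simp
    moreover have "exp (Re z / 4) * exp (- Re z / 4) = 1" "exp (- Re z / 2) * exp (- Re z / 4) = exp (- (3 / 4) * Re z)"
      by (simp_all flip: exp_add)
    ultimately show ?thesis by (simp only: mult.assoc mult_1_right)
  qed
  then show ?thesis using C1(1) C2(1) by (intro that [of "C1 + C2"]) auto
qed

lemma two_pi_gt: "5 / 2 < 2 * pi"
  using pi_gt3 by simp

lemma gen_bounded: obtains M where "bounded_by M gen"
proof -
  obtain C where C: "C \<ge> 0" "\<And>z. z \<in> half_strip 2 \<Longrightarrow> norm (deriv bern z) \<le> C * exp (- Re z / 2)"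
    using decays_bound [OF decays_deriv [OF bern_decays] two_less_2pi] by blast
  then have "bounded_by C gen" by (auto simp: bounded_by_def gen_def)
  then show ?thesis by (rule that)
qed

lemma gen_measurable: "gen \<in> borel_measurable borel"
  by (rule nice_measurable [OF nice_gen])

lemma gen_holomorphic: "gen holomorphic_on half_strip 2"
  using gen_decays by (simp add: decays_def)

definition approx :: "real \<Rightarrow> complex \<Rightarrow> complex" where
  "approx c w = (1 / (exp w - 1) - of_real c / (exp (of_real c * w) - 1)) / (1 - of_real c)"

lemma approx_eq:
  assumes "w \<noteq> 0" "c \<noteq> 0" "c \<noteq> 1"
  shows "approx c w = (bern w - bern (of_real c * w)) / (w - of_real c * w)"
proof -
  have "1 / (exp w - 1) = bern w / w" "of_real c / (exp (of_real c * w) - 1) = bern (of_real c * w) / w"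
    using assms by (simp_all add: bern_def)
  moreover have "w - of_real c * w = w * (1 - of_real c)" by (simp add: algebra_simps)
  ultimately show ?thesis by (simp add: approx_def diff_divide_distrib)
qed

lemma approx_measurable: "approx c \<in> borel_measurable borel"
  unfolding approx_def [abs_def] by measurable

text \<open>The mean value inequality between c w and w, with constants independent of c. The
  segment lies in \<open>half_strip (5 / 2)\<close>, away from the poles of B. For Re w >= 0 the
  rate 3/4 is reduced by c to no less than 9/16, which still exceeds 1/2.\<close>

lemma approx_bounded:
  obtains M where "\<And>c. 3 / 4 \<le> c \<Longrightarrow> c \<le> 5 / 4 \<Longrightarrow> c \<noteq> 1 \<Longrightarrow> bounded_by M (approx c)"
proof -
  obtain C where C: "C \<ge> 0" "\<And>z. z \<in> half_strip (5 / 2) \<Longrightarrow> norm (deriv bern z) \<le> C * exp (- (3 / 4) * Re z)"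
    using deriv_bern_bound [OF two_pi_gt] by blast
  have "bounded_by (C * exp 2) (approx c)" if c: "3 / 4 \<le> c" "c \<le> 5 / 4" "c \<noteq> 1" for c
    unfolding bounded_by_def
  proof (intro conjI ballI)
    show "0 \<le> C * exp 2" using C by simp
    fix w assume w: "w \<in> half_strip 2"
    show "norm (approx c w) \<le> C * exp 2 * exp (- Re w / 2)"
    proof (cases "w = 0")
      case True
      then show ?thesis using C by (simp add: approx_def)
    next
      case False
      define m where "m = min (Re w) (c * Re w)"
      \<comment> \<open>For Re w < 0 the bound c <= 5/4 gives - (3/4) m <= - (15/16) Re w, and since
        Re w > - 2 the constant 2 covers the excess over - Re w/2.\<close>
      have m: "- (3 / 4) * m \<le> 2 - Re w / 2"
      proof (cases "Re w \<ge> 0")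
        case True
        then have "c * Re w \<ge> 3 / 4 * Re w" using c by (intro mult_right_mono) auto
        then have "m \<ge> 3 / 4 * Re w" using True by (simp add: m_def)
        then show ?thesis using True by simp
      next
        case False
        then have "c * Re w \<ge> 5 / 4 * Re w" "Re w \<ge> 5 / 4 * Re w" using c by (auto intro: mult_right_mono_neg)
        then have "m \<ge> 5 / 4 * Re w" by (simp add: m_def)
        moreover have "Re w > - 2" using w by (simp add: half_strip_def)
        ultimately show ?thesis using False by simp
      qed
      define A where "A = half_strip (5 / 2) \<inter> {y. Re y \<ge> m}"
      have cw: "of_real c * w \<in> half_strip (5 / 2)"
      proof -
        have "c * \<bar>Im w\<bar> < 5 / 4 * 2" using w c
          by (intro mult_le_less_imp_less) (auto simp: half_strip_def)
        moreover have "c * Re w > - (5 / 2)"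
        proof (cases "Re w \<ge> 0")
          case True
          then have "c * Re w \<ge> 0" using c by simp
          then show ?thesis by linarith
        next
          case False
          then have "c * Re w \<ge> 5 / 4 * Re w" using c by (auto intro: mult_right_mono_neg)
          moreover have "Re w > - 2" using w by (simp add: half_strip_def)
          ultimately show ?thesis by linarith
        qed
        ultimately show ?thesis using c by (simp add: half_strip_def abs_mult)
      qed
      have "norm (bern w - bern (of_real c * w)) \<le> C * exp (2 - Re w / 2) * norm (w - of_real c * w)"
      proof (rule field_differentiable_bound [of A bern "deriv bern"])
        show "convex A" unfolding A_def by (intro convex_Int convex_halfspace_Re_ge) auto
        show "w \<in> A" "of_real c * w \<in> A"
          using w cw half_strip_mono [of 2 "5 / 2"] by (auto simp: A_def m_def)
        fix y assume y: "y \<in> A"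
        then have "y \<in> half_strip (2 * pi)"
          using half_strip_mono [of "5 / 2" "2 * pi"] two_pi_gt by (auto simp: A_def)
        then show "(bern has_field_derivative deriv bern y) (at y within A)"
          using holomorphic_derivI [OF bern_holomorphic open_half_strip] has_field_derivative_at_within by blast
        have "norm (deriv bern y) \<le> C * exp (- (3 / 4) * Re y)" using C y by (auto simp: A_def)
        also have "\<dots> \<le> C * exp (2 - Re w / 2)"
          using C(1) m y by (intro mult_left_mono) (auto simp: A_def)
        finally show "norm (deriv bern y) \<le> C * exp (2 - Re w / 2)" .
      qed
      moreover have "w - of_real c * w \<noteq> 0" using False c by simp
      ultimately have "norm (approx c w) \<le> C * exp (2 - Re w / 2)"
        using False c by (simp add: approx_eq norm_divide pos_divide_le_eq)
      also have "\<dots> = C * exp 2 * exp (- Re w / 2)" by (simp add: mult.assoc flip: exp_add)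
      finally show ?thesis .
    qed
  qed
  then show ?thesis by (rule that)
qed

lemma approx_tendsto:
  assumes w: "w \<in> half_strip 2" and X: "X \<longlonglongrightarrow> 1" "\<And>n. X n \<noteq> 1" "\<And>n. X n \<noteq> 0"
  shows "(\<lambda>n. approx (X n) w) \<longlonglongrightarrow> (if w = 0 then 0 else gen w)"
proof (cases "w = 0")
  case True
  then show ?thesis by (simp add: approx_def)
next
  case False
  have "w \<in> half_strip (2 * pi)" using w half_strip_mono [of 2 "2 * pi"] two_less_2pi by auto
  then have "(bern has_field_derivative deriv bern w) (at w)"
    by (rule holomorphic_derivI [OF bern_holomorphic open_half_strip])
  then have "((\<lambda>h. (bern (w + h) - bern w) / h) \<longlongrightarrow> deriv bern w) (at 0)"
    by (simp add: DERIV_def)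
  moreover have "filterlim (\<lambda>n. of_real (X n) * w - w) (at 0) sequentially"
  proof -
    have "(\<lambda>n. of_real (X n) * w - w) \<longlonglongrightarrow> of_real 1 * w - w"
      using X by (intro tendsto_intros)
    moreover have "of_real (X n) * w - w \<noteq> 0" for n
      using X(2) [of n] False by simp
    ultimately show ?thesis by (simp add: filterlim_at)
  qed
  ultimately have "(\<lambda>n. (bern (w + (of_real (X n) * w - w)) - bern w) / (of_real (X n) * w - w)) \<longlonglongrightarrow> deriv bern w"
    by (rule filterlim_compose)
  moreover have "(bern (w + (of_real (X n) * w - w)) - bern w) / (of_real (X n) * w - w) = approx (X n) w" for n
  proof -
    have "(a - b) / (x - y) = (b - a) / (y - x)" for a b x y :: complex
      by (metis minus_diff_eq minus_divide_divide)
    then show ?thesis using approx_eq [OF False X(3) X(2)] by simp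
  qed
  ultimately show ?thesis using False w by (simp add: gen_def)
qed

section \<open>Mixed paths and the entire extension\<close>

lemma iterated_Suc: "iterated p s (Suc r) \<eta> \<Longrightarrow> iterated p s r \<eta>"
  by (simp add: iterated_def)

text \<open>Induction on the depth: the inner integrals agree by hypothesis, and
  \<open>weyl_switch\<close> changes the outermost path. It applies because \<open>gen\<close>
  decays and the inner integral is bounded and holomorphic in z, so their product decays.\<close>

lemma multi_switch:
  "iterated p s r \<eta> \<Longrightarrow> iterated q s r \<eta> \<Longrightarrow> z \<in> half_strip (2 - real r * \<eta>) \<Longrightarrow>
    multi gen p s r z = multi gen q s r z"
proof (induction r arbitrary: z)
  case 0
  show ?case by (simp add: multi_def integrand_def gprod_def)
next
  case (Suc r)
  obtain M where M: "bounded_by M gen" by (rule gen_bounded)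
  interpret P: iterated p s "Suc r" \<eta> by (rule Suc.prems)
  interpret Q: iterated q s "Suc r" \<eta> by (rule Suc.prems)
  interpret Q': iterated q s r \<eta> by (rule iterated_Suc [OF Suc.prems(2)])
  define b where "b = 2 - real r * \<eta>"
  have b: "b \<le> 2" and z: "z \<in> half_strip (b - \<eta>)"
    using Suc.prems(3) P.\<eta> by (simp_all add: b_def algebra_simps)
  let ?f = "\<lambda>w. gen w * multi gen q s r w"
  obtain C where C: "C \<ge> 0" "\<And>w. w \<in> half_strip b \<Longrightarrow> norm (multi gen q s r w) \<le> C"
    using Q'.multi_bounded [OF M gen_measurable] by (auto simp: b_def)
  have dec: "decays b ?f"
    unfolding decays_def
  proof (intro conjI allI impI)
    show "?f holomorphic_on half_strip b"
      unfolding b_def using half_strip_mono [OF b]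
      by (intro holomorphic_on_mult Q'.multi_holomorphic [OF M gen_measurable gen_holomorphic]
          holomorphic_on_subset [OF gen_holomorphic]) (simp add: b_def)
    fix a assume "a < b"
    have "norm (?f w) \<le> (M * C) * exp (- Re w / 2)" if w: "w \<in> half_strip a" for w
    proof -
      have "w \<in> half_strip b" "w \<in> half_strip 2"
        using w half_strip_mono [of a b] half_strip_mono [of a 2] \<open>a < b\<close> b by auto
      then have "norm (gen w) \<le> M * exp (- Re w / 2)" "norm (multi gen q s r w) \<le> C"
        using M C by (auto simp: bounded_by_def)
      then have "norm (gen w) * norm (multi gen q s r w) \<le> (M * exp (- Re w / 2)) * C"
        using C(1) M by (intro mult_mono) (auto simp: bounded_by_def)
      then show ?thesis by (simp only: norm_mult mult_ac)
    qed
    then show "\<exists>C. \<forall>w\<in>half_strip a. norm (?f w) \<le> C * exp (- Re w / 2)" by blast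
  qed
  have meas: "?f \<in> borel_measurable borel"
    using Q'.p by (intro borel_measurable_times gen_measurable multi_measurable) auto
  have pr: "0 \<le> p r" "p r \<le> \<eta>" and qr: "0 \<le> q r" "q r \<le> \<eta>"
    and sr: "s r \<in> adm (p r)" "s r \<in> adm (q r)"
    using P.p [of r] Q.p [of r] P.s [of r] Q.s [of r] by auto
  have "multi gen p s (Suc r) z = weyl (p r) (s r) (\<lambda>w. gen w * multi gen p s r w) z"
    by (rule multi_Suc [OF Suc.prems(1) M gen_measurable Suc.prems(3)])
  also have "\<dots> = weyl (p r) (s r) ?f z"
  proof (rule weyl_cong [OF pr z])
    fix w assume "w \<in> half_strip (b - \<eta> + \<eta>)"
    then have "multi gen p s r w = multi gen q s r w"
      by (intro Suc.IH [OF iterated_Suc [OF Suc.prems(1)] iterated_Suc [OF Suc.prems(2)]]) (simp add: b_def)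
    then show "gen w * multi gen p s r w = gen w * multi gen q s r w" by simp
  qed
  also have "\<dots> = weyl (q r) (s r) ?f z"
    by (rule weyl_switch [OF dec meas pr qr sr z])
  also have "\<dots> = multi gen q s (Suc r) z"
    by (rule multi_Suc [OF Suc.prems(2) M gen_measurable Suc.prems(3), symmetric])
  finally show ?case .
qed

lemma nonpos_in_adm: "Re s \<le> 0 \<Longrightarrow> \<eta> \<noteq> 0 \<Longrightarrow> s \<in> adm \<eta>"
proof -
  assume s: "Re s \<le> 0" and \<eta>: "\<eta> \<noteq> 0"
  have "1 - s \<notin> \<int>\<^sub>\<le>\<^sub>0"
  proof
    assume "1 - s \<in> \<int>\<^sub>\<le>\<^sub>0"
    then obtain n where n: "1 - s = of_int n" "n \<le> 0" by (auto simp: nonpos_Ints_def)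
    then have "Re (1 - s) \<le> 0" by simp
    then show False using s by simp
  qed
  then show ?thesis using \<eta> by (simp add: adm_def)
qed

text \<open>The ray is taken exactly where it converges; this includes the positive integers, at
  which the contour coefficient has poles.\<close>

definition ray_choice :: "real \<Rightarrow> (nat \<Rightarrow> complex) \<Rightarrow> nat \<Rightarrow> real" where
  "ray_choice \<eta> s k = (if Re (s k) > 0 then 0 else \<eta>)"

lemma iterated_ray_choice: "\<eta> > 0 \<Longrightarrow> iterated (ray_choice \<eta> s) s r \<eta>"
proof unfold_locales
  fix k assume "\<eta> > 0"
  then show "s k \<in> adm (ray_choice \<eta> s k)"
    using nonpos_in_adm [of "s k" \<eta>] by (cases "Re (s k) > 0") (auto simp: ray_choice_def adm_def)
qed (auto simp: ray_choice_def)

text \<open>Together r contours of this radius use at most r/(r + 1) < 1 of the width 2.\<close>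

definition radius :: "nat \<Rightarrow> real" where
  "radius r = 1 / real (Suc r)"

lemma radius_pos: "radius r > 0"
  by (simp add: radius_def)

lemma zero_half_strip_radius: "0 \<in> half_strip (2 - real r * radius r)"
proof -
  have "real r * radius r \<le> 1" by (simp add: radius_def divide_le_eq)
  then show ?thesis by (simp add: half_strip_def)
qed

definition zeta_ext :: "nat \<Rightarrow> (nat \<Rightarrow> complex) \<Rightarrow> complex" where
  "zeta_ext r s = multi gen (ray_choice (radius r) s) s r 0"

text \<open>\<open>ray_choice\<close> jumps at Re s = 0. As any admissible paths give the same value
  and admissibility is an open condition, the paths can be frozen near a given point; continuity and
  holomorphy are proved in this way.\<close>

lemma zeta_ext_eq:
  assumes "iterated p s r (radius r)"
  shows "zeta_ext r s = multi gen p s r 0"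
  unfolding zeta_ext_def
  by (rule multi_switch [OF iterated_ray_choice [OF radius_pos] assms zero_half_strip_radius])

lemma zeta_ext_continuous: "continuous_on (Cn r) (zeta_ext r)"
  unfolding continuous_on_sequentially
proof (intro allI ballI impI)
  fix S s assume "s \<in> Cn r" and S: "(\<forall>n. S n \<in> Cn r) \<and> S \<longlonglongrightarrow> s"
  obtain M where M: "bounded_by M gen" by (rule gen_bounded)
  define p where "p = ray_choice (radius r) s"
  interpret iterated p s r "radius r" unfolding p_def by (rule iterated_ray_choice [OF radius_pos])
  have lim: "(\<lambda>n. S n k) \<longlonglongrightarrow> s k" for k
  proof -
    have "isCont (\<lambda>s :: nat \<Rightarrow> complex. s k) s"
      using continuous_on_product_coordinates [of k] continuous_on_eq_continuous_at [OF open_UNIV] by blast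
    then show ?thesis using S isCont_tendsto_compose by blast
  qed
  have "\<forall>k\<in>{..<r}. \<forall>\<^sub>F n in sequentially. S n k \<in> adm (p k)"
    using s by (auto intro: topological_tendstoD [OF lim open_adm])
  then have "\<forall>\<^sub>F n in sequentially. \<forall>k\<in>{..<r}. S n k \<in> adm (p k)"
    by (intro eventually_ball_finite) auto
  then have "\<forall>\<^sub>F n in sequentially. multi gen p (S n) r 0 = (zeta_ext r \<circ> S) n"
  proof eventually_elim
    case (elim n)
    have "iterated p (S n) r (radius r)" using elim p \<eta> by unfold_locales auto
    then show ?case using zeta_ext_eq by simp
  qed
  moreover have "(\<lambda>n. multi gen p (S n) r 0) \<longlonglongrightarrow> zeta_ext r s"
    unfolding zeta_ext_def p_def [symmetric]
    by (rule multi_tendsto_s [OF M gen_measurable zero_half_strip_radius lim])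
  ultimately show "(zeta_ext r \<circ> S) \<longlonglongrightarrow> zeta_ext r s"
    by (rule Lim_transform_eventually [rotated])
qed

lemma zeta_ext_holomorphic:
  assumes i: "i < r"
  shows "(\<lambda>z. zeta_ext r (s(i := z))) holomorphic_on UNIV"
  unfolding holomorphic_on_open [OF open_UNIV]
proof
  fix z0
  obtain M where M: "bounded_by M gen" by (rule gen_bounded)
  define s0 where "s0 = s(i := z0)"
  define p where "p = ray_choice (radius r) s0"
  interpret iterated p s0 r "radius r" unfolding p_def by (rule iterated_ray_choice [OF radius_pos])
  have "(\<lambda>z. multi gen p (s0(i := z)) r 0) holomorphic_on adm (p i)"
    by (rule multi_holomorphic_s [OF M gen_measurable zero_half_strip_radius i])
  moreover have z0: "z0 \<in> adm (p i)" using s [OF i] by (simp add: s0_def)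
  ultimately obtain d where "((\<lambda>z. multi gen p (s0(i := z)) r 0) has_field_derivative d) (at z0)"
    unfolding holomorphic_on_open [OF open_adm] by blast
  then have "((\<lambda>z. zeta_ext r (s(i := z))) has_field_derivative d) (at z0)"
  proof (rule has_field_derivative_transform_within_open [OF _ open_adm z0])
    fix z assume z: "z \<in> adm (p i)"
    have "iterated p (s0(i := z)) r (radius r)"
      using z p \<eta> s by unfold_locales auto
    then have "zeta_ext r (s0(i := z)) = multi gen p (s0(i := z)) r 0" by (rule zeta_ext_eq)
    then show "multi gen p (s0(i := z)) r 0 = zeta_ext r (s(i := z))" by (simp add: s0_def)
  qed
  then show "\<exists>d. ((\<lambda>z. zeta_ext r (s(i := z))) has_field_derivative d) (at z0)" by blast
qed

lemma zeta_des_approx_eq: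
  assumes "\<epsilon> > 0" and s: "\<And>k. k < r \<Longrightarrow> s k \<notin> \<int>"
  shows "zeta_des_approx \<epsilon> c r s = multi (approx c) (\<lambda>_. \<epsilon>) s r 0"
proof -
  let ?K = "\<lambda>k. 1 / ((exp (2 * pi * \<i> * s k) - 1) * Gamma (s k))"
  let ?t = "\<lambda>u j. \<Sum>k\<in>{j..<r}. hankel \<epsilon> (u k)"
  have "1 / (1 - of_real c) ^ r * (\<Prod>k<r. ?K k) *
      ((\<Prod>j<r. 1 / (exp (?t u j) - 1) - of_real c / (exp (of_real c * ?t u j) - 1)) *
       (\<Prod>k<r. exp ((s k - 1) * hankel_log \<epsilon> (u k)) * vector_derivative (hankel \<epsilon>) (at (u k))))
      = integrand (approx c) (\<lambda>_. \<epsilon>) s r 0 u" for u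
  proof -
    have ray: "ray \<epsilon> v = hankel \<epsilon> v" for v using assms(1) by (simp add: ray_def)
    have "gprod (approx c) r 0 (\<lambda>k. ray \<epsilon> (u k))
        = (\<Prod>j<r. 1 / (exp (?t u j) - 1) - of_real c / (exp (of_real c * ?t u j) - 1)) * (1 / (1 - of_real c) ^ r)"
      by (simp add: gprod_def ray approx_def prod_dividef)
    moreover have "(\<Prod>k<r. kern \<epsilon> (s k) (u k))
        = (\<Prod>k<r. ?K k) * (\<Prod>k<r. exp ((s k - 1) * hankel_log \<epsilon> (u k)) * vector_derivative (hankel \<epsilon>) (at (u k)))"
      unfolding prod.distrib [symmetric]
    proof (rule prod.cong [OF refl])
      fix k assume "k \<in> {..<r}"
      then have "coef \<epsilon> (s k) = ?K k" using coef_Hankel [of \<epsilon> "s k"] s [of k] assms(1) by simp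
      then show "kern \<epsilon> (s k) (u k) = ?K k * (exp ((s k - 1) * hankel_log \<epsilon> (u k)) * vector_derivative (hankel \<epsilon>) (at (u k)))"
        using assms(1) by (simp only: kern_def if_False less_irrefl) simp
    qed
    ultimately show ?thesis unfolding integrand_def by (simp only: mult_ac)
  qed
  then show ?thesis
    unfolding zeta_des_approx_def hankel_integral_def multi_def
    by (subst integral_mult_right_zero [symmetric]) (simp only:)
qed

lemma zeta_des_approx_tendsto:
  assumes s: "\<And>k. k < r \<Longrightarrow> s k \<notin> \<int>" and \<epsilon>: "0 < \<epsilon>" "\<epsilon> \<le> radius r"
  shows "((\<lambda>c. zeta_des_approx \<epsilon> c r s) \<longlongrightarrow> zeta_ext r s) (at 1)"
proof -
  obtain M1 where M1: "bounded_by M1 gen" by (rule gen_bounded)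
  obtain M2 where M2: "\<And>c. 3 / 4 \<le> c \<Longrightarrow> c \<le> 5 / 4 \<Longrightarrow> c \<noteq> 1 \<Longrightarrow> bounded_by M2 (approx c)"
    using approx_bounded by blast
  have "s k \<in> adm \<epsilon>" if "k < r" for k
    using s [OF that] \<epsilon> by (auto simp: adm_def nonpos_Ints_def) (metis Ints_1 Ints_diff Ints_of_int diff_diff_eq2 add_diff_cancel_left')
  note nonint = s
  from \<open>\<And>k. k < r \<Longrightarrow> s k \<in> adm \<epsilon>\<close> interpret iterated "\<lambda>_. \<epsilon>" s r "radius r"
    using \<epsilon> radius_pos [of r] by unfold_locales (auto simp: less_imp_le)
  \<comment> \<open>The pointwise limit of \<open>approx c\<close>, which has the default value 0 at
    0. It may differ from \<open>gen\<close> there, and \<open>multi_cong_AE\<close> shows that this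
    does not affect the integral.\<close>
  define g where "g w = (if w = 0 then 0 else gen w)" for w
  have g_meas: "g \<in> borel_measurable borel"
    unfolding g_def [abs_def] using gen_measurable by simp
  have g_bd: "bounded_by M1 g" using M1 by (simp add: bounded_by_def g_def)
  have eq: "multi g (\<lambda>_. \<epsilon>) s r 0 = zeta_ext r s"
  proof -
    have "multi g (\<lambda>_. \<epsilon>) s r 0 = multi gen (\<lambda>_. \<epsilon>) s r 0"
      by (rule multi_cong_AE [OF g_bd g_meas M1 gen_measurable _ iterated_axioms zero_half_strip_radius])
        (simp add: g_def)
    then show ?thesis using zeta_ext_eq [OF iterated_axioms] by simp
  qed
  show ?thesis
    unfolding tendsto_at_iff_sequentially o_def
  proof (intro allI impI)
    fix X :: "nat \<Rightarrow> real"
    assume X1: "\<forall>n. X n \<in> UNIV - {1}" and X: "X \<longlonglongrightarrow> 1"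
    have "\<forall>\<^sub>F n in sequentially. X n \<in> {3 / 4<..<5 / 4}"
      by (rule topological_tendstoD [OF X]) auto
    then obtain N where N: "\<And>n. n \<ge> N \<Longrightarrow> X n \<in> {3 / 4<..<5 / 4}"
      by (auto simp: eventually_sequentially)
    have XN: "3 / 4 \<le> X (n + N)" "X (n + N) \<le> 5 / 4" "X (n + N) \<noteq> 1" "X (n + N) \<noteq> 0" for n
      using N [of "n + N"] X1 by auto
    have "(\<lambda>n. multi (approx (X (n + N))) (\<lambda>_. \<epsilon>) s r 0) \<longlonglongrightarrow> multi g (\<lambda>_. \<epsilon>) s r 0"
    proof (rule multi_tendsto_g [OF M2 approx_measurable g_meas zero_half_strip_radius])
      fix w assume "w \<in> half_strip 2"
      then show "(\<lambda>n. approx (X (n + N)) w) \<longlonglongrightarrow> g w"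
        unfolding g_def using XN by (intro approx_tendsto LIMSEQ_ignore_initial_segment [OF X])
    qed (use XN in auto)
    then have "(\<lambda>n. zeta_des_approx \<epsilon> (X (n + N)) r s) \<longlonglongrightarrow> zeta_ext r s"
      using zeta_des_approx_eq [OF \<epsilon>(1) nonint] by (simp add: eq)
    then show "(\<lambda>n. zeta_des_approx \<epsilon> (X n) r s) \<longlonglongrightarrow> zeta_ext r s"
      by (rule LIMSEQ_offset)
  qed
qed

lemma is_zeta_des_zeta_ext: "is_zeta_des r (zeta_ext r)"
  unfolding is_zeta_des_def entire_on_Cn_def
proof (intro conjI ballI allI impI)
  show "continuous_on (Cn r) (zeta_ext r)" by (rule zeta_ext_continuous)
  show "(\<lambda>z. zeta_ext r (s(i := z))) holomorphic_on UNIV" if "i < r" for s i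
    using that by (rule zeta_ext_holomorphic)
  fix s :: "nat \<Rightarrow> complex" assume s: "\<forall>k<r. s k \<notin> \<int>"
  have "eventually (\<lambda>\<epsilon>. \<epsilon> \<in> {0<..<radius r}) (at_right 0)"
    by (rule eventually_at_right_real [OF radius_pos])
  then show "\<forall>\<^sub>F \<epsilon> in at_right 0. ((\<lambda>c. zeta_des_approx \<epsilon> c r s) \<longlongrightarrow> zeta_ext r s) (at 1)"
    by eventually_elim (use s in \<open>auto intro!: zeta_des_approx_tendsto\<close>)
qed

text \<open>At points without integer coordinates the limits in c determine the value; all other
  points are reached through such points by continuity.\<close>

lemma is_zeta_des_unique:
  assumes F: "is_zeta_des r F" and F': "is_zeta_des r F'" and s: "s \<in> Cn r"
  shows "F s = F' s"
proof -
  have nonint: "F s = F' s" if s: "s \<in> Cn r" "\<forall>k<r. s k \<notin> \<int>" for s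
  proof -
    have "\<forall>\<^sub>F \<epsilon> in at_right 0. ((\<lambda>c. zeta_des_approx \<epsilon> c r s) \<longlongrightarrow> F s) (at 1)"
      "\<forall>\<^sub>F \<epsilon> in at_right 0. ((\<lambda>c. zeta_des_approx \<epsilon> c r s) \<longlongrightarrow> F' s) (at 1)"
      using F F' s unfolding is_zeta_des_def by blast+
    then have "\<forall>\<^sub>F \<epsilon> in at_right (0 :: real). F s = F' s"
      by eventually_elim (rule tendsto_unique [OF at_neq_bot])
    then show ?thesis by simp
  qed
  \<comment> \<open>Moving all r coordinates by the same small t > 0 leads away from the integers;
    the remaining coordinates stay fixed, so that the point remains in \<open>Cn r\<close>.\<close>
  define \<gamma> where "\<gamma> t = (\<lambda>k. if k < r then s k + complex_of_real t else s k)" for t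
  have \<gamma>: "\<gamma> t \<in> Cn r" for t using s by (auto simp: Cn_def PiE_iff \<gamma>_def extensional_def)
  have "continuous_on UNIV \<gamma>"
  proof (rule continuous_on_coordinatewise_then_product)
    show "continuous_on UNIV (\<lambda>t. \<gamma> t k)" for k
      unfolding \<gamma>_def by (cases "k < r") (auto intro!: continuous_intros)
  qed
  then have lim: "((\<lambda>t. H (\<gamma> t)) \<longlongrightarrow> H s) (at_right 0)" if "continuous_on (Cn r) H" for H :: "_ \<Rightarrow> complex"
  proof -
    have "continuous_on UNIV (\<lambda>t. H (\<gamma> t))"
      by (rule continuous_on_compose2 [OF that \<open>continuous_on UNIV \<gamma>\<close>]) (use \<gamma> in auto)
    then have "isCont (\<lambda>t. H (\<gamma> t)) 0" by (simp add: continuous_on_eq_continuous_at)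
    then have "((\<lambda>t. H (\<gamma> t)) \<longlongrightarrow> H (\<gamma> 0)) (at 0)" unfolding isCont_def .
    moreover have "\<gamma> 0 = s" by (auto simp: \<gamma>_def)
    ultimately show ?thesis by (simp add: filterlim_at_split)
  qed
  have ev: "\<forall>\<^sub>F t in at_right 0. s k + complex_of_real t \<notin> \<int>" for k
  proof (cases "s k \<in> \<int>")
    case True
    have "eventually (\<lambda>t::real. t \<in> {0<..<1}) (at_right 0)"
      by (rule eventually_at_right_real) simp
    then show ?thesis
    proof eventually_elim
      case (elim t)
      show ?case
      proof
        assume "s k + complex_of_real t \<in> \<int>"
        then have "complex_of_real t \<in> \<int>" using True Ints_diff by fastforce
        then obtain n where "complex_of_real t = of_int n" by (auto elim: Ints_cases)
        then have "t = of_int n" by (metis of_real_eq_iff of_real_of_int_eq)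
        then show False using elim by auto
      qed
    qed
  next
    case False
    have "((\<lambda>t. s k + complex_of_real t) \<longlongrightarrow> s k + of_real 0) (at_right 0)"
      by (intro tendsto_intros)
    then have "((\<lambda>t. s k + complex_of_real t) \<longlongrightarrow> s k) (at_right 0)" by simp
    moreover have "open (- \<int> :: complex set)" by (intro open_Compl closed_Ints)
    ultimately have "\<forall>\<^sub>F t in at_right 0. s k + complex_of_real t \<in> - \<int>"
      using False by (intro topological_tendstoD) auto
    then show ?thesis by simp
  qed
  have "\<forall>\<^sub>F t in at_right 0. \<forall>k\<in>{..<r}. s k + complex_of_real t \<notin> \<int>"
    using ev by (intro eventually_ball_finite) auto
  then have eq: "\<forall>\<^sub>F t in at_right 0. F (\<gamma> t) = F' (\<gamma> t)"
    by eventually_elim (intro nonint \<gamma>, simp add: \<gamma>_def)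
  have 1: "((\<lambda>t. F (\<gamma> t)) \<longlongrightarrow> F s) (at_right 0)" and 2: "((\<lambda>t. F' (\<gamma> t)) \<longlongrightarrow> F' s) (at_right 0)"
    using F F' by (auto intro!: lim simp: is_zeta_des_def entire_on_Cn_def)
  have "((\<lambda>t. F' (\<gamma> t)) \<longlongrightarrow> F s) (at_right 0)"
    by (rule Lim_transform_eventually [OF 1 eq])
  then show ?thesis by (rule tendsto_unique [OF trivial_limit_at_right_real _ 2])
qed

lemma zeta_des_eq:
  assumes "s \<in> Cn r"
  shows "zeta_des r s = zeta_ext r s"
  unfolding zeta_des_def
  using is_zeta_des_unique [OF is_zeta_des_zeta_ext _ assms] is_zeta_des_zeta_ext
  by (intro the_equality) auto

text \<open>The last variable belongs to the outermost transform, so its exponent is the first one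
  of the word; hence the reversed list of indices.\<close>

lemma multi_int:
  assumes "\<eta> > 0"
  shows "z \<in> half_strip (2 - real r * \<eta>) \<Longrightarrow>
    multi gen (ray_choice \<eta> (\<lambda>k. of_int (l k))) (\<lambda>k. of_int (l k)) r z = val (yword (map l (rev [0..<r]))) z"
proof (induction r arbitrary: z)
  case 0
  have "multi gen p s 0 z = 1" for p s
    by (simp add: multi_def integrand_def gprod_def lessThan_0 PiM_empty)
  then show ?case by simp
next
  case (Suc r)
  let ?s = "\<lambda>k. complex_of_int (l k)"
  let ?p = "ray_choice \<eta> ?s"
  obtain M where M: "bounded_by M gen" by (rule gen_bounded)
  have z: "z \<in> half_strip (2 - real r * \<eta> - \<eta>)" using Suc.prems by (simp add: algebra_simps)
  have p: "?p r = (if l r > 0 then 0 else \<eta>)" by (simp add: ray_choice_def)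
  have z2: "z \<in> half_strip (2 - \<eta>)"
    using z half_strip_mono [of "2 - real r * \<eta> - \<eta>" "2 - \<eta>"] assms by auto
  have "multi gen ?p ?s (Suc r) z = weyl (?p r) (?s r) (\<lambda>w. gen w * multi gen ?p ?s r w) z"
    by (rule multi_Suc [OF iterated_ray_choice [OF assms] M gen_measurable Suc.prems])
  also have "\<dots> = weyl (?p r) (?s r) (\<lambda>w. gen w * val (yword (map l (rev [0..<r]))) w) z"
  proof (rule weyl_cong [OF _ _ z, where \<eta> = \<eta>])
    show "0 \<le> ?p r" "?p r \<le> \<eta>" using assms by (simp_all add: ray_choice_def)
    fix w assume "w \<in> half_strip (2 - real r * \<eta> - \<eta> + \<eta>)"
    then have "multi gen ?p ?s r w = val (yword (map l (rev [0..<r]))) w"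
      by (intro Suc.IH) simp
    then show "gen w * multi gen ?p ?s r w = gen w * val (yword (map l (rev [0..<r]))) w"
      by simp
  qed
  also have "\<dots> = I_pow (l r) (\<lambda>w. gen w * val (yword (map l (rev [0..<r]))) w) z"
    unfolding p by (rule weyl_int [OF nice_gen_val assms z2])
  also have "\<dots> = val (yword (map l (rev [0..<Suc r]))) z" by simp
  finally show ?case .
qed

lemma zeta_des_int:
  "zeta_des (length ks) (\<lambda>i\<in>{..<length ks}. of_int (ks ! i)) = val (yword (rev ks)) 0"
proof -
  let ?r = "length ks"
  let ?s = "\<lambda>i\<in>{..<?r}. complex_of_int (ks ! i)"
  have "zeta_des ?r ?s = zeta_ext ?r ?s"
    by (rule zeta_des_eq) (simp add: Cn_def)
  \<comment> \<open>The restricted exponent function may be replaced by the unrestricted one, since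
    the integrand reads only indices below the length.\<close>
  also have "\<dots> = multi gen (ray_choice (radius ?r) (\<lambda>k. of_int (ks ! k))) (\<lambda>k. of_int (ks ! k)) ?r 0"
    unfolding zeta_ext_def multi_def integrand_def gprod_def
    by (intro Bochner_Integration.integral_cong arg_cong2 [where f = "(*)"] prod.cong refl
        arg_cong [where f = gen] arg_cong2 [where f = "(+)"] sum.cong) (auto simp: ray_choice_def)
  also have "\<dots> = val (yword (map (\<lambda>k. ks ! k) (rev [0..<?r]))) 0"
    by (rule multi_int [OF radius_pos zero_half_strip_radius])
  also have "map (\<lambda>k. ks ! k) (rev [0..<?r]) = rev ks"
    by (simp add: rev_map [symmetric] map_nth)
  finally show ?thesis .
qed

theorem theorem4p8:
  shows "(\<exists>!Z. is_zeta_des_sha Z) \<and>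
    (\<forall>Z. is_zeta_des_sha Z \<longrightarrow>
       (\<forall>x y. Z (x * y) = Z x * Z y) \<and>
       (\<forall>ks. ks \<noteq> [] \<longrightarrow>
          complex_of_real (Z (sha_class (yword (rev ks))))
            = zeta_des (length ks) (\<lambda>i\<in>{..<length ks}. of_int (ks ! i))))"
proof -
  have "Z = zeta_sha" if "is_zeta_des_sha Z" for Z
    using is_zeta_des_sha_unique is_zeta_des_sha_zeta_sha that by blast
  then show ?thesis
    using is_zeta_des_sha_zeta_sha by (metis zeta_sha_mult of_real_zeta_sha_yword zeta_des_int)
qed

end
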